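(* Let $a,b\in\mathbb{R}$. If \[ \mathbb{R}=(-\infty,b]\cup(a,\infty), \] then either $a<b$ or $a=b$. Furthermore, in case the second alternative holds, LPO holds.
   Context: The setting is Bishop-style constructive mathematics: intuitionistic logic (no law of excluded middle), with countable and dependent choice allowed. "Either $A$ or $B$" is the constructive disjunction $A\lor B$; the hypothesis means that for every $x\in\mathbb{R}$, $x\leqslant b$ or $a<x$, as a constructive disjunction. LPO is the statement: for every binary sequence $(a_n)_{n\geqslant1}$, either $a_n=0$ for all $n$ or there exists $n$ with $a_n=1$. *)

theory Defs
  imports Main
begin

text \<open>
  Isabelle/HOL is classical, so a constructive theorem cannot be rendered by the HOL connectives:
  LPO would simply be true.  We therefore formalise constructive mathematics as an object theory,
  and a constructive theorem is stated as derivability of a sentence of that theory.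

  The object theory is intuitionistic arithmetic in all finite types (Troelstra's HA^omega, with
  product types, with equality at every type, and without extensionality),
  extended by countable choice and by relativised dependent choice.  This is a standard formal
  system for Bishop-style mathematics.  No instance of excluded middle, Markov's principle or LPO is
  among the axioms.
\<close>

subsection \<open>Types, terms, formulas\<close>

datatype ty = NatT | FunT ty ty (infixr \<open>\<rightarrow>\<close> 70) | ProdT ty ty

type_synonym var = "string \<times> ty"

datatype const =
    CZero | CSucc | CPlus | CTimes
  | CK ty ty | CS ty ty ty | CRec ty
  | CPair ty ty | CFst ty ty | CSnd ty ty

fun const_ty :: "const \<Rightarrow> ty" where
  "const_ty CZero = NatT"
| "const_ty CSucc = NatT \<rightarrow> NatT"
| "const_ty CPlus = NatT \<rightarrow> NatT \<rightarrow> NatT"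
| "const_ty CTimes = NatT \<rightarrow> NatT \<rightarrow> NatT"
| "const_ty (CK \<sigma> \<tau>) = \<sigma> \<rightarrow> \<tau> \<rightarrow> \<sigma>"
| "const_ty (CS \<rho> \<sigma> \<tau>) = (\<rho> \<rightarrow> \<sigma> \<rightarrow> \<tau>) \<rightarrow> (\<rho> \<rightarrow> \<sigma>) \<rightarrow> \<rho> \<rightarrow> \<tau>"
| "const_ty (CRec \<tau>) = \<tau> \<rightarrow> (NatT \<rightarrow> \<tau> \<rightarrow> \<tau>) \<rightarrow> NatT \<rightarrow> \<tau>"
| "const_ty (CPair \<sigma> \<tau>) = \<sigma> \<rightarrow> \<tau> \<rightarrow> ProdT \<sigma> \<tau>"
| "const_ty (CFst \<sigma> \<tau>) = ProdT \<sigma> \<tau> \<rightarrow> \<sigma>"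
| "const_ty (CSnd \<sigma> \<tau>) = ProdT \<sigma> \<tau> \<rightarrow> \<tau>"

text \<open>
  Locally nameless syntax: free variables are (name, type) pairs, bound variables are
  de Bruijn indices.  All quantified formulas below are written with the named quantifiers
  \<open>all\<close> and \<open>ex\<close>, so indices never appear except in the order on the natural numbers.
\<close>

datatype tm = Var var | Bound nat | Const const | App tm tm (infixl \<open>\<cdot>\<close> 95)

datatype fm =
    Eq ty tm tm
  | Falsum
  | And fm fm (infixr \<open>\<^bold>\<and>\<close> 35)
  | Or fm fm (infixr \<open>\<^bold>\<or>\<close> 30)
  | Imp fm fm (infixr \<open>\<^bold>\<longrightarrow>\<close> 25)
  | All ty fm
  | Ex ty fm

inductive has_type :: "ty list \<Rightarrow> tm \<Rightarrow> ty \<Rightarrow> bool" where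
  "has_type bs (Var (x, \<tau>)) \<tau>"
| "i < length bs \<Longrightarrow> has_type bs (Bound i) (bs ! i)"
| "has_type bs (Const c) (const_ty c)"
| "has_type bs f (\<sigma> \<rightarrow> \<tau>) \<Longrightarrow> has_type bs t \<sigma> \<Longrightarrow> has_type bs (f \<cdot> t) \<tau>"

fun wff_in :: "ty list \<Rightarrow> fm \<Rightarrow> bool" where
  "wff_in bs (Eq \<tau> s t) \<longleftrightarrow> has_type bs s \<tau> \<and> has_type bs t \<tau>"
| "wff_in bs Falsum \<longleftrightarrow> True"
| "wff_in bs (A \<^bold>\<and> B) \<longleftrightarrow> wff_in bs A \<and> wff_in bs B"
| "wff_in bs (A \<^bold>\<or> B) \<longleftrightarrow> wff_in bs A \<and> wff_in bs B"
| "wff_in bs (A \<^bold>\<longrightarrow> B) \<longleftrightarrow> wff_in bs A \<and> wff_in bs B"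
| "wff_in bs (All \<tau> A) \<longleftrightarrow> wff_in (\<tau> # bs) A"
| "wff_in bs (Ex \<tau> A) \<longleftrightarrow> wff_in (\<tau> # bs) A"

text \<open>\<open>t\<close> is a term, resp. \<open>A\<close> a formula, without dangling bound variables.\<close>

abbreviation typed :: "tm \<Rightarrow> ty \<Rightarrow> bool" where "typed t \<tau> \<equiv> has_type [] t \<tau>"
abbreviation wff :: "fm \<Rightarrow> bool" where "wff A \<equiv> wff_in [] A"

fun fv_tm :: "tm \<Rightarrow> var set" where
  "fv_tm (Var v) = {v}"
| "fv_tm (Bound i) = {}"
| "fv_tm (Const c) = {}"
| "fv_tm (f \<cdot> t) = fv_tm f \<union> fv_tm t"

fun fv :: "fm \<Rightarrow> var set" where
  "fv (Eq \<tau> s t) = fv_tm s \<union> fv_tm t"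
| "fv Falsum = {}"
| "fv (A \<^bold>\<and> B) = fv A \<union> fv B"
| "fv (A \<^bold>\<or> B) = fv A \<union> fv B"
| "fv (A \<^bold>\<longrightarrow> B) = fv A \<union> fv B"
| "fv (All \<tau> A) = fv A"
| "fv (Ex \<tau> A) = fv A"

text \<open>
  Substitution for a free variable.  It is only ever used with typed terms, which have no dangling
  indices, so no capture can occur.
\<close>

fun subst_tm :: "var \<Rightarrow> tm \<Rightarrow> tm \<Rightarrow> tm" where
  "subst_tm v u (Var w) = (if w = v then u else Var w)"
| "subst_tm v u (Bound i) = Bound i"
| "subst_tm v u (Const c) = Const c"
| "subst_tm v u (f \<cdot> t) = subst_tm v u f \<cdot> subst_tm v u t"

fun subst :: "var \<Rightarrow> tm \<Rightarrow> fm \<Rightarrow> fm" where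
  "subst v u (Eq \<tau> s t) = Eq \<tau> (subst_tm v u s) (subst_tm v u t)"
| "subst v u Falsum = Falsum"
| "subst v u (A \<^bold>\<and> B) = (subst v u A \<^bold>\<and> subst v u B)"
| "subst v u (A \<^bold>\<or> B) = (subst v u A \<^bold>\<or> subst v u B)"
| "subst v u (A \<^bold>\<longrightarrow> B) = (subst v u A \<^bold>\<longrightarrow> subst v u B)"
| "subst v u (All \<tau> A) = All \<tau> (subst v u A)"
| "subst v u (Ex \<tau> A) = Ex \<tau> (subst v u A)"

fun bind :: "nat \<Rightarrow> var \<Rightarrow> fm \<Rightarrow> fm" where
  "bind k v (Eq \<tau> s t) = Eq \<tau> (subst_tm v (Bound k) s) (subst_tm v (Bound k) t)"
| "bind k v Falsum = Falsum"
| "bind k v (A \<^bold>\<and> B) = (bind k v A \<^bold>\<and> bind k v B)"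
| "bind k v (A \<^bold>\<or> B) = (bind k v A \<^bold>\<or> bind k v B)"
| "bind k v (A \<^bold>\<longrightarrow> B) = (bind k v A \<^bold>\<longrightarrow> bind k v B)"
| "bind k v (All \<tau> A) = All \<tau> (bind (Suc k) v A)"
| "bind k v (Ex \<tau> A) = Ex \<tau> (bind (Suc k) v A)"

definition all :: "var \<Rightarrow> fm \<Rightarrow> fm" where "all v A = All (snd v) (bind 0 v A)"
definition ex :: "var \<Rightarrow> fm \<Rightarrow> fm" where "ex v A = Ex (snd v) (bind 0 v A)"

abbreviation Zero :: tm where "Zero \<equiv> Const CZero"
abbreviation Succ :: "tm \<Rightarrow> tm" where "Succ t \<equiv> Const CSucc \<cdot> t"
abbreviation One :: tm where "One \<equiv> Succ Zero"
abbreviation Two :: tm where "Two \<equiv> Succ One"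
abbreviation Plus :: "tm \<Rightarrow> tm \<Rightarrow> tm" (infixl \<open>\<^bold>+\<close> 65) where "s \<^bold>+ t \<equiv> Const CPlus \<cdot> s \<cdot> t"
abbreviation Times :: "tm \<Rightarrow> tm \<Rightarrow> tm" (infixl \<open>\<^bold>*\<close> 70) where "s \<^bold>* t \<equiv> Const CTimes \<cdot> s \<cdot> t"

abbreviation NEq :: "tm \<Rightarrow> tm \<Rightarrow> fm" (infix \<open>\<doteq>\<close> 50) where "s \<doteq> t \<equiv> Eq NatT s t"

subsection \<open>Axioms and derivability\<close>

inductive nonlogical_axiom :: "fm \<Rightarrow> bool" where
  succ_nonzero:
    "typed t NatT \<Longrightarrow> nonlogical_axiom (Succ t \<doteq> Zero \<^bold>\<longrightarrow> Falsum)"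
| succ_inject:
    "typed s NatT \<Longrightarrow> typed t NatT \<Longrightarrow> nonlogical_axiom (Succ s \<doteq> Succ t \<^bold>\<longrightarrow> s \<doteq> t)"
| plus_zero:
    "typed s NatT \<Longrightarrow> nonlogical_axiom (s \<^bold>+ Zero \<doteq> s)"
| plus_succ:
    "typed s NatT \<Longrightarrow> typed t NatT \<Longrightarrow> nonlogical_axiom (s \<^bold>+ Succ t \<doteq> Succ (s \<^bold>+ t))"
| times_zero:
    "typed s NatT \<Longrightarrow> nonlogical_axiom (s \<^bold>* Zero \<doteq> Zero)"
| times_succ:
    "typed s NatT \<Longrightarrow> typed t NatT \<Longrightarrow> nonlogical_axiom (s \<^bold>* Succ t \<doteq> s \<^bold>* t \<^bold>+ s)"
| comb_K:
    "typed s \<sigma> \<Longrightarrow> typed t \<tau> \<Longrightarrow> nonlogical_axiom (Eq \<sigma> (Const (CK \<sigma> \<tau>) \<cdot> s \<cdot> t) s)"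
| comb_S:
    "typed f (\<rho> \<rightarrow> \<sigma> \<rightarrow> \<tau>) \<Longrightarrow> typed g (\<rho> \<rightarrow> \<sigma>) \<Longrightarrow> typed t \<rho> \<Longrightarrow>
     nonlogical_axiom (Eq \<tau> (Const (CS \<rho> \<sigma> \<tau>) \<cdot> f \<cdot> g \<cdot> t) (f \<cdot> t \<cdot> (g \<cdot> t)))"
| rec_zero:
    "typed s \<tau> \<Longrightarrow> typed f (NatT \<rightarrow> \<tau> \<rightarrow> \<tau>) \<Longrightarrow>
     nonlogical_axiom (Eq \<tau> (Const (CRec \<tau>) \<cdot> s \<cdot> f \<cdot> Zero) s)"
| rec_succ:
    "typed s \<tau> \<Longrightarrow> typed f (NatT \<rightarrow> \<tau> \<rightarrow> \<tau>) \<Longrightarrow> typed t NatT \<Longrightarrow>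
     nonlogical_axiom
       (Eq \<tau> (Const (CRec \<tau>) \<cdot> s \<cdot> f \<cdot> Succ t) (f \<cdot> t \<cdot> (Const (CRec \<tau>) \<cdot> s \<cdot> f \<cdot> t)))"
| fst_pair:
    "typed s \<sigma> \<Longrightarrow> typed t \<tau> \<Longrightarrow>
     nonlogical_axiom (Eq \<sigma> (Const (CFst \<sigma> \<tau>) \<cdot> (Const (CPair \<sigma> \<tau>) \<cdot> s \<cdot> t)) s)"
| snd_pair:
    "typed s \<sigma> \<Longrightarrow> typed t \<tau> \<Longrightarrow>
     nonlogical_axiom (Eq \<tau> (Const (CSnd \<sigma> \<tau>) \<cdot> (Const (CPair \<sigma> \<tau>) \<cdot> s \<cdot> t)) t)"
| pair_surj:
    "typed p (ProdT \<sigma> \<tau>) \<Longrightarrow>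
     nonlogical_axiom
       (Eq (ProdT \<sigma> \<tau>)
          (Const (CPair \<sigma> \<tau>) \<cdot> (Const (CFst \<sigma> \<tau>) \<cdot> p) \<cdot> (Const (CSnd \<sigma> \<tau>) \<cdot> p)) p)"
| induction:
    "wff A \<Longrightarrow> n = (x, NatT) \<Longrightarrow>
     nonlogical_axiom
       (subst n Zero A \<^bold>\<longrightarrow> all n (A \<^bold>\<longrightarrow> subst n (Succ (Var n)) A) \<^bold>\<longrightarrow> all n A)"
| countable_choice:
    \<comment> \<open>\<open>(\<forall>n \<exists>y. A(n, y)) \<longrightarrow> (\<exists>f \<forall>n. A(n, f n))\<close>\<close>
    "wff A \<Longrightarrow> n = (n', NatT) \<Longrightarrow> y = (y', \<tau>) \<Longrightarrow> f = (f', NatT \<rightarrow> \<tau>) \<Longrightarrow> n \<noteq> y \<Longrightarrow> f \<notin> fv A \<Longrightarrow>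
     nonlogical_axiom
       (all n (ex y A) \<^bold>\<longrightarrow> ex f (all n (subst y (Var f \<cdot> Var n) A)))"
| dependent_choice:
    \<comment> \<open>\<open>(\<forall>x. D(x) \<longrightarrow> (\<exists>y. D(y) \<and> A(x, y))) \<longrightarrow>\<close>
        \<open>(\<forall>x. D(x) \<longrightarrow> (\<exists>f. f 0 = x \<and> (\<forall>n. D(f n) \<and> A(f n, f (n + 1)))))\<close>\<close>
    "wff D \<Longrightarrow> wff A \<Longrightarrow> x = (x', \<tau>) \<Longrightarrow> y = (y', \<tau>) \<Longrightarrow> f = (f', NatT \<rightarrow> \<tau>) \<Longrightarrow> n = (n', NatT) \<Longrightarrow>
     x \<noteq> y \<Longrightarrow> n \<noteq> x \<Longrightarrow> n \<noteq> y \<Longrightarrow> y \<notin> fv D \<Longrightarrow> f \<notin> fv D \<union> fv A \<Longrightarrow> n \<notin> fv D \<union> fv A \<Longrightarrow>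
     nonlogical_axiom
       (all x (D \<^bold>\<longrightarrow> ex y (subst x (Var y) D \<^bold>\<and> A)) \<^bold>\<longrightarrow>
        all x (D \<^bold>\<longrightarrow>
          ex f (Eq \<tau> (Var f \<cdot> Zero) (Var x) \<^bold>\<and>
                all n (subst x (Var f \<cdot> Var n) D \<^bold>\<and>
                       subst x (Var f \<cdot> Var n) (subst y (Var f \<cdot> Succ (Var n)) A)))))"

text \<open>Intuitionistic natural deduction.\<close>

inductive derivable :: "fm set \<Rightarrow> fm \<Rightarrow> bool" (infix \<open>\<turnstile>\<close> 20) where
  hyp: "A \<in> \<Gamma> \<Longrightarrow> wff A \<Longrightarrow> \<Gamma> \<turnstile> A"
| axiom: "nonlogical_axiom A \<Longrightarrow> \<Gamma> \<turnstile> A"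
| FalsumE: "\<Gamma> \<turnstile> Falsum \<Longrightarrow> wff A \<Longrightarrow> \<Gamma> \<turnstile> A"
| AndI: "\<Gamma> \<turnstile> A \<Longrightarrow> \<Gamma> \<turnstile> B \<Longrightarrow> \<Gamma> \<turnstile> A \<^bold>\<and> B"
| AndE1: "\<Gamma> \<turnstile> A \<^bold>\<and> B \<Longrightarrow> \<Gamma> \<turnstile> A"
| AndE2: "\<Gamma> \<turnstile> A \<^bold>\<and> B \<Longrightarrow> \<Gamma> \<turnstile> B"
| OrI1: "\<Gamma> \<turnstile> A \<Longrightarrow> wff B \<Longrightarrow> \<Gamma> \<turnstile> A \<^bold>\<or> B"
| OrI2: "\<Gamma> \<turnstile> B \<Longrightarrow> wff A \<Longrightarrow> \<Gamma> \<turnstile> A \<^bold>\<or> B"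
| OrE: "\<Gamma> \<turnstile> A \<^bold>\<or> B \<Longrightarrow> insert A \<Gamma> \<turnstile> C \<Longrightarrow> insert B \<Gamma> \<turnstile> C \<Longrightarrow> \<Gamma> \<turnstile> C"
| ImpI: "insert A \<Gamma> \<turnstile> B \<Longrightarrow> wff A \<Longrightarrow> \<Gamma> \<turnstile> A \<^bold>\<longrightarrow> B"
| ImpE: "\<Gamma> \<turnstile> A \<^bold>\<longrightarrow> B \<Longrightarrow> \<Gamma> \<turnstile> A \<Longrightarrow> \<Gamma> \<turnstile> B"
| AllI: "\<Gamma> \<turnstile> A \<Longrightarrow> v \<notin> \<Union>(fv ` \<Gamma>) \<Longrightarrow> \<Gamma> \<turnstile> all v A"
| AllE: "\<Gamma> \<turnstile> all v A \<Longrightarrow> wff A \<Longrightarrow> typed t (snd v) \<Longrightarrow> \<Gamma> \<turnstile> subst v t A"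
| ExI: "\<Gamma> \<turnstile> subst v t A \<Longrightarrow> wff A \<Longrightarrow> typed t (snd v) \<Longrightarrow> \<Gamma> \<turnstile> ex v A"
| ExE: "\<Gamma> \<turnstile> ex v A \<Longrightarrow> wff A \<Longrightarrow> insert A \<Gamma> \<turnstile> C \<Longrightarrow> v \<notin> \<Union>(fv ` \<Gamma>) \<union> fv C \<Longrightarrow> \<Gamma> \<turnstile> C"
| EqI: "typed t \<tau> \<Longrightarrow> \<Gamma> \<turnstile> Eq \<tau> t t"
| EqE: "\<Gamma> \<turnstile> Eq (snd v) s t \<Longrightarrow> \<Gamma> \<turnstile> subst v s A \<Longrightarrow> wff A \<Longrightarrow>
        typed s (snd v) \<Longrightarrow> typed t (snd v) \<Longrightarrow> \<Gamma> \<turnstile> subst v t A"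

subsection \<open>Natural and rational numbers\<close>

text \<open>
  \<open>s \<le> t\<close> is \<open>\<exists>k. s + k = t\<close>, for terms \<open>s\<close>, \<open>t\<close> without dangling indices.
\<close>

definition nat_le :: "tm \<Rightarrow> tm \<Rightarrow> fm" where "nat_le s t = Ex NatT (s \<^bold>+ Bound 0 \<doteq> t)"
definition nat_less :: "tm \<Rightarrow> tm \<Rightarrow> fm" where "nat_less s t = nat_le (Succ s) t"

text \<open>
  The triple \<open>(p, q, d)\<close> of natural number terms stands for the rational \<open>(p - q) / d\<close>; in all uses
  \<open>d\<close> denotes a positive number.  An object of type \<open>RatT\<close> with components \<open>(p, q, r)\<close> stands
  for \<open>(p - q) / (r + 1)\<close>; thus every object of that type is a rational, and every rational arises.
\<close>

type_synonym rat_tm = "tm \<times> tm \<times> tm"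

abbreviation RatT :: ty where "RatT \<equiv> ProdT NatT (ProdT NatT NatT)"

definition rat_of :: "tm \<Rightarrow> rat_tm" where
  "rat_of t =
     (let u = Const (CSnd NatT (ProdT NatT NatT)) \<cdot> t
      in (Const (CFst NatT (ProdT NatT NatT)) \<cdot> t,
          Const (CFst NatT NatT) \<cdot> u,
          Succ (Const (CSnd NatT NatT) \<cdot> u)))"

definition frac :: "tm \<Rightarrow> tm \<Rightarrow> rat_tm" where "frac k n = (k, Zero, n)"

fun rat_neg :: "rat_tm \<Rightarrow> rat_tm" where "rat_neg (p, q, d) = (q, p, d)"

fun rat_add :: "rat_tm \<Rightarrow> rat_tm \<Rightarrow> rat_tm" where
  "rat_add (p, q, d) (p', q', d') = (p \<^bold>* d' \<^bold>+ p' \<^bold>* d, q \<^bold>* d' \<^bold>+ q' \<^bold>* d, d \<^bold>* d')"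

definition rat_diff :: "rat_tm \<Rightarrow> rat_tm \<Rightarrow> rat_tm" where "rat_diff u v = rat_add u (rat_neg v)"

fun rat_le :: "rat_tm \<Rightarrow> rat_tm \<Rightarrow> fm" where
  "rat_le (p, q, d) (p', q', d') = nat_le (p \<^bold>* d' \<^bold>+ q' \<^bold>* d) (p' \<^bold>* d \<^bold>+ q \<^bold>* d')"

fun rat_less :: "rat_tm \<Rightarrow> rat_tm \<Rightarrow> fm" where
  "rat_less (p, q, d) (p', q', d') = nat_less (p \<^bold>* d' \<^bold>+ q' \<^bold>* d) (p' \<^bold>* d \<^bold>+ q \<^bold>* d')"

definition rat_abs_le :: "rat_tm \<Rightarrow> rat_tm \<Rightarrow> fm" where
  "rat_abs_le u v = (rat_le u v \<^bold>\<and> rat_le (rat_neg u) v)"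

subsection \<open>Quantification over the positive integers\<close>

text \<open>
  The name supplied to the quantifiers below must not occur in the terms that the body
  refers to from outside; the names \<open>m\<close> and \<open>n\<close> are reserved, at type \<open>NatT\<close>, for this purpose.
\<close>

definition all_pos :: "string \<Rightarrow> (tm \<Rightarrow> fm) \<Rightarrow> fm" where
  "all_pos s F = all (s, NatT) (F (Succ (Var (s, NatT))))"

definition ex_pos :: "string \<Rightarrow> (tm \<Rightarrow> fm) \<Rightarrow> fm" where
  "ex_pos s F = ex (s, NatT) (F (Succ (Var (s, NatT))))"

subsection \<open>Bishop's real numbers\<close>

text \<open>
  A real number is a regular sequence \<open>(x\<^sub>n)\<close>, \<open>n \<ge> 1\<close>, of rationals:
  \<open>\<bar>x\<^sub>m - x\<^sub>n\<bar> \<le> 1/m + 1/n\<close>.  A sequence indexed by the positive integers is represented by a function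
  on the natural numbers whose value at \<open>0\<close> is irrelevant.  Equality of reals is
  \<open>\<bar>x\<^sub>n - y\<^sub>n\<bar> \<le> 2/n\<close> for all \<open>n\<close>; \<open>x < y\<close> and \<open>x \<le> y\<close> say that the real number \<open>y - x\<close>, whose
  \<open>n\<close>-th term is \<open>y\<^sub>2\<^sub>n - x\<^sub>2\<^sub>n\<close>, is positive (some term exceeds \<open>1/n\<close>), respectively nonnegative
  (every term is at least \<open>-1/n\<close>).
\<close>

abbreviation RatSeqT :: ty where "RatSeqT \<equiv> NatT \<rightarrow> RatT"

definition is_real :: "tm \<Rightarrow> fm" where
  "is_real x =
     all_pos ''m'' (\<lambda>m. all_pos ''n'' (\<lambda>n.
       rat_abs_le (rat_diff (rat_of (x \<cdot> m)) (rat_of (x \<cdot> n))) (rat_add (frac One m) (frac One n))))"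

definition real_eq :: "tm \<Rightarrow> tm \<Rightarrow> fm" (infix \<open>=\<^sub>R\<close> 50) where
  "x =\<^sub>R y =
     all_pos ''n'' (\<lambda>n. rat_abs_le (rat_diff (rat_of (x \<cdot> n)) (rat_of (y \<cdot> n))) (frac Two n))"

definition real_less :: "tm \<Rightarrow> tm \<Rightarrow> fm" (infix \<open><\<^sub>R\<close> 50) where
  "x <\<^sub>R y =
     ex_pos ''n'' (\<lambda>n.
       rat_less (frac One n) (rat_diff (rat_of (y \<cdot> (Two \<^bold>* n))) (rat_of (x \<cdot> (Two \<^bold>* n)))))"

definition real_le :: "tm \<Rightarrow> tm \<Rightarrow> fm" (infix \<open>\<le>\<^sub>R\<close> 50) where
  "x \<le>\<^sub>R y =
     all_pos ''n'' (\<lambda>n.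
       rat_le (rat_neg (frac One n)) (rat_diff (rat_of (y \<cdot> (Two \<^bold>* n))) (rat_of (x \<cdot> (Two \<^bold>* n)))))"

definition all_real :: "string \<Rightarrow> (tm \<Rightarrow> fm) \<Rightarrow> fm" where
  "all_real s F =
     all (s, RatSeqT) (is_real (Var (s, RatSeqT)) \<^bold>\<longrightarrow> F (Var (s, RatSeqT)))"

subsection \<open>The limited principle of omniscience\<close>

definition LPO :: fm where
  "LPO =
     (let \<alpha> = (''alpha'', NatT \<rightarrow> NatT)
      in all \<alpha>
           (all_pos ''n'' (\<lambda>n. Var \<alpha> \<cdot> n \<doteq> Zero \<^bold>\<or> Var \<alpha> \<cdot> n \<doteq> One) \<^bold>\<longrightarrow>
            all_pos ''n'' (\<lambda>n. Var \<alpha> \<cdot> n \<doteq> Zero) \<^bold>\<or> ex_pos ''n'' (\<lambda>n. Var \<alpha> \<cdot> n \<doteq> One)))"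

end

theory Submission
  imports Defs
begin

text \<open>
  The mathematics.  Write \<open>H\<close> for the hypothesis.  Applied to \<open>x = a\<close> it gives \<open>a \<le> b\<close>, because \<open>a < a\<close> is
  absurd.  Applied to the reflection \<open>x = 2b - a\<close> of \<open>a\<close> in \<open>b\<close> it decides the first claim: \<open>2b - a \<le> b\<close>
  means \<open>b \<le> a\<close>, so \<open>a = b\<close>, and \<open>a < 2b - a\<close> means \<open>a < b\<close>.  Suppose now \<open>a = b\<close> and let \<open>\<alpha>\<close> be a
  binary sequence.  The series \<open>z = \<Sum>\<^sub>j \<alpha>\<^sub>j / (j (j + 1))\<close> is dominated by the telescoping series
  \<open>\<Sum>\<^sub>j (1/j - 1/(j + 1))\<close>, so its partial sums form a regular sequence and \<open>z\<close> is a real number.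
  Apply \<open>H\<close> to \<open>x = a + z\<close>.  If \<open>x \<le> b\<close> then \<open>z \<le> 0\<close>, hence no \<open>\<alpha>\<^sub>j\<close> can be \<open>1\<close>; if \<open>a < x\<close> then some
  partial sum is not \<open>\<le> 0\<close>, and a search through its finitely many summands finds a \<open>j\<close> with \<open>\<alpha>\<^sub>j = 1\<close>.
  The two halves are \<open>split_line_less_or_eq\<close> and \<open>split_line_eq_imp_LPO\<close>.

  The derivation.  Producing a derivation in the object theory rests on four devices.

  \<^item> \<open>\<Gamma> \<tturnstile> A\<close> means that \<open>A\<close> is derivable from every finite extension of \<open>\<Gamma>\<close>.  This relation is monotone by
    definition, and the rules with eigenvariables turn into rules about arbitrary terms, since a fresh
    variable can be chosen separately for each extension.  Contexts then act like the worlds of a Kripke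
    model: implication, disjunction and existence are handled by passing to a larger context.

  \<^item> Terms of type \<open>NatT\<close> modulo provable equality form a commutative semiring \<open>natq\<close>, and formal fractions
    over it form an abelian group \<open>ratq\<close>.  Identities between them need no hypotheses, so equational
    reasoning in the object theory becomes simplification in these types.  Only the order depends on \<open>\<Gamma>\<close>:
    \<open>nonneg \<Gamma> x\<close> says that \<open>\<Gamma>\<close> proves \<open>x \<ge> 0\<close>.  A linear inequality is derived by exhibiting it as a sum of
    known ones, an identity in \<open>ratq\<close>.

  \<^item> Strict inequalities are treated as refutations of the opposite weak inequality, which is legitimate
    because the order on the rationals is decidable (\<open>entails_rat_less\<close>).

  \<^item> Bracket abstraction (\<open>abstraction\<close>) and the recursor provide closed forms for the sequences \<open>2b - a\<close>,
    \<open>z\<close> and \<open>a + z\<close>.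
\<close>

section \<open>Derivability in all finite extensions\<close>

text \<open>
  The quantification over extensions makes weakening immediate; for derivations themselves it would call for
  renaming their eigenvariables.  Finiteness leaves fresh variables available.
\<close>

definition entails :: "fm set \<Rightarrow> fm \<Rightarrow> bool" (infix \<open>\<tturnstile>\<close> 20) where
  "(\<Gamma> \<tturnstile> A) \<longleftrightarrow> (\<forall>\<Delta>. finite \<Delta> \<longrightarrow> \<Gamma> \<subseteq> \<Delta> \<longrightarrow> (\<Delta> \<turnstile> A))"

lemma entails_mono: "\<Gamma> \<tturnstile> A \<Longrightarrow> \<Gamma> \<subseteq> \<Delta> \<Longrightarrow> \<Delta> \<tturnstile> A"
  unfolding entails_def by blast

lemma entails_derivable: "\<Gamma> \<tturnstile> A \<Longrightarrow> finite \<Gamma> \<Longrightarrow> \<Gamma> \<turnstile> A"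
  unfolding entails_def by blast

lemma has_type_simps [simp]:
  "has_type bs (Var v) \<tau> \<longleftrightarrow> snd v = \<tau>"
  "has_type bs (Bound i) \<tau> \<longleftrightarrow> i < length bs \<and> \<tau> = bs ! i"
  "has_type bs (Const c) \<tau> \<longleftrightarrow> \<tau> = const_ty c"
  "has_type bs (f \<cdot> t) \<tau> \<longleftrightarrow> (\<exists>\<sigma>. has_type bs f (\<sigma> \<rightarrow> \<tau>) \<and> has_type bs t \<sigma>)"
  by (cases v; auto elim: has_type.cases intro: has_type.intros)
     (auto elim: has_type.cases intro: has_type.intros)

lemma has_type_append: "has_type bs t \<tau> \<Longrightarrow> has_type (bs @ cs) t \<tau>"
  by (induction t arbitrary: \<tau>) (auto simp: nth_append)

lemma typed_weaken: "typed t \<tau> \<Longrightarrow> has_type bs t \<tau>"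
  using has_type_append[of "[]" t \<tau> bs] by simp

lemma finite_fv_tm [simp]: "finite (fv_tm t)" by (induction t) auto
lemma finite_fv [simp]: "finite (fv A)" by (induction A) auto

lemma subst_tm_fresh [simp]: "v \<notin> fv_tm t \<Longrightarrow> subst_tm v u t = t"
  by (induction t) auto

lemma has_type_bind: "has_type bs t \<tau> \<Longrightarrow> has_type (bs @ [snd v]) (subst_tm v (Bound (length bs)) t) \<tau>"
  by (induction t arbitrary: \<tau>) (auto simp: nth_append)

text \<open>
  The binder for \<open>v\<close> is the outermost one, so its type is appended at the end of the list of types.
\<close>

lemma wff_bind: "wff_in bs A \<Longrightarrow> wff_in (bs @ [snd v]) (bind (length bs) v A)"
proof (induction A arbitrary: bs)
  case (All \<tau> A)
  from All.IH[of "\<tau> # bs"] All.prems show ?case by simp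
next
  case (Ex \<tau> A)
  from Ex.IH[of "\<tau> # bs"] Ex.prems show ?case by simp
qed (auto simp: has_type_bind)

lemma wff_all: "wff A \<Longrightarrow> wff (all v A)"
  using wff_bind[of "[]" A v] by (simp add: all_def)

lemma wff_ex: "wff A \<Longrightarrow> wff (ex v A)"
  using wff_bind[of "[]" A v] by (simp add: ex_def)

lemma subst_tm_bind_comm:
  "v \<noteq> w \<Longrightarrow> w \<notin> fv_tm t \<Longrightarrow>
   subst_tm w (Bound k) (subst_tm v t s) = subst_tm v t (subst_tm w (Bound k) s)"
  by (induction s) auto

lemma subst_bind_comm:
  "v \<noteq> w \<Longrightarrow> w \<notin> fv_tm t \<Longrightarrow> bind k w (subst v t A) = subst v t (bind k w A)"
  by (induction A arbitrary: k) (auto simp: subst_tm_bind_comm)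

lemma subst_all: "v \<noteq> w \<Longrightarrow> w \<notin> fv_tm t \<Longrightarrow> subst v t (all w A) = all w (subst v t A)"
  by (simp add: all_def subst_bind_comm)

lemma subst_ex: "v \<noteq> w \<Longrightarrow> w \<notin> fv_tm t \<Longrightarrow> subst v t (ex w A) = ex w (subst v t A)"
  by (simp add: ex_def subst_bind_comm)

lemma bind_tm_rename:
  "w \<notin> fv_tm s \<Longrightarrow> subst_tm w (Bound k) (subst_tm v (Var w) s) = subst_tm v (Bound k) s"
  by (induction s) auto

lemma bind_rename: "w \<notin> fv A \<Longrightarrow> bind k w (subst v (Var w) A) = bind k v A"
  by (induction A arbitrary: k) (auto simp: bind_tm_rename)

lemma subst_tm_twice:
  "subst_tm v t (subst_tm v s u) = subst_tm v (subst_tm v t s) u"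
  by (induction u) auto

lemma subst_twice: "subst v t (subst v s A) = subst v (subst_tm v t s) A"
  by (induction A) (auto simp: subst_tm_twice)

text \<open>
  The names that occur as binders.  Eigenvariables avoid them, so that substituting a term below a binder
  never needs a renaming.
\<close>

definition bound_names :: "string set" where
  "bound_names = {''m'', ''n'', ''a'', ''b'', ''x'', ''alpha''}"

definition clean :: "ty \<Rightarrow> tm \<Rightarrow> bool" where
  "clean \<tau> t \<longleftrightarrow> typed t \<tau> \<and> (\<forall>v\<in>fv_tm t. fst v \<notin> bound_names)"

lemma clean_typed: "clean \<tau> t \<Longrightarrow> typed t \<tau>" by (simp add: clean_def)
lemma clean_has_type: "clean \<tau> t \<Longrightarrow> has_type bs t \<tau>" by (simp add: clean_def typed_weaken)

text \<open>
  Binder names do not occur in clean terms, hence the side conditions for commuting substitutions with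
  quantifiers simplify to true.
\<close>

lemma clean_fresh [simp]: "clean \<tau> t \<Longrightarrow> s \<in> bound_names \<Longrightarrow> (s, \<sigma>) \<notin> fv_tm t"
  by (force simp: clean_def)

lemma bound_names_mem [simp]:
  "''m'' \<in> bound_names" "''n'' \<in> bound_names" "''a'' \<in> bound_names" "''b'' \<in> bound_names"
  "''x'' \<in> bound_names" "''alpha'' \<in> bound_names"
  by (simp_all add: bound_names_def)

lemma clean_Const: "\<tau> = const_ty c \<Longrightarrow> clean \<tau> (Const c)" by (simp add: clean_def)
lemma clean_App: "clean (\<sigma> \<rightarrow> \<tau>) f \<Longrightarrow> clean \<sigma> t \<Longrightarrow> clean \<tau> (f \<cdot> t)" by (auto simp: clean_def)

lemma clean_nat [simp]:
  "clean NatT Zero"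
  "clean NatT s \<Longrightarrow> clean NatT (Succ s)"
  "clean NatT s \<Longrightarrow> clean NatT t \<Longrightarrow> clean NatT (s \<^bold>+ t)"
  "clean NatT s \<Longrightarrow> clean NatT t \<Longrightarrow> clean NatT (s \<^bold>* t)"
  by (auto simp: clean_def)

lemma entails_hyp: "A \<in> \<Gamma> \<Longrightarrow> wff A \<Longrightarrow> \<Gamma> \<tturnstile> A"
  unfolding entails_def by (blast intro: hyp)
lemma entails_axiom: "nonlogical_axiom A \<Longrightarrow> \<Gamma> \<tturnstile> A"
  unfolding entails_def by (blast intro: axiom)
lemma entails_FalsumE: "\<Gamma> \<tturnstile> Falsum \<Longrightarrow> wff A \<Longrightarrow> \<Gamma> \<tturnstile> A"
  unfolding entails_def by (blast intro: FalsumE)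
lemma entails_AndI: "\<Gamma> \<tturnstile> A \<Longrightarrow> \<Gamma> \<tturnstile> B \<Longrightarrow> \<Gamma> \<tturnstile> A \<^bold>\<and> B"
  unfolding entails_def by (blast intro: AndI)
lemma entails_AndE1: "\<Gamma> \<tturnstile> A \<^bold>\<and> B \<Longrightarrow> \<Gamma> \<tturnstile> A"
  unfolding entails_def by (blast intro: AndE1)
lemma entails_AndE2: "\<Gamma> \<tturnstile> A \<^bold>\<and> B \<Longrightarrow> \<Gamma> \<tturnstile> B"
  unfolding entails_def by (blast intro: AndE2)
lemma entails_And_iff: "(\<Gamma> \<tturnstile> A \<^bold>\<and> B) \<longleftrightarrow> (\<Gamma> \<tturnstile> A) \<and> (\<Gamma> \<tturnstile> B)"
  by (blast intro: entails_AndI entails_AndE1 entails_AndE2)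
lemma entails_OrI1: "\<Gamma> \<tturnstile> A \<Longrightarrow> wff B \<Longrightarrow> \<Gamma> \<tturnstile> A \<^bold>\<or> B"
  unfolding entails_def by (blast intro: OrI1)
lemma entails_OrI2: "\<Gamma> \<tturnstile> B \<Longrightarrow> wff A \<Longrightarrow> \<Gamma> \<tturnstile> A \<^bold>\<or> B"
  unfolding entails_def by (blast intro: OrI2)
lemma entails_ImpE: "\<Gamma> \<tturnstile> A \<^bold>\<longrightarrow> B \<Longrightarrow> \<Gamma> \<tturnstile> A \<Longrightarrow> \<Gamma> \<tturnstile> B"
  unfolding entails_def by (blast intro: ImpE)

text \<open>
  Implication as in a Kripke model; the context \<open>insert A \<Gamma>\<close> is the generic extension.
\<close>

lemma entails_ImpI:
  assumes "\<And>\<Delta>. \<Gamma> \<subseteq> \<Delta> \<Longrightarrow> \<Delta> \<tturnstile> A \<Longrightarrow> \<Delta> \<tturnstile> B" and "wff A"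
  shows "\<Gamma> \<tturnstile> A \<^bold>\<longrightarrow> B"
proof -
  have "insert A \<Gamma> \<tturnstile> B" using assms by (intro assms(1)) (auto intro: entails_hyp)
  then show ?thesis unfolding entails_def
    by (metis ImpI assms(2) finite_insert insert_mono)
qed

lemma entails_OrE:
  assumes "\<Gamma> \<tturnstile> A \<^bold>\<or> B" and "wff A" and "wff B"
    and "\<And>\<Delta>. \<Gamma> \<subseteq> \<Delta> \<Longrightarrow> \<Delta> \<tturnstile> A \<Longrightarrow> \<Delta> \<tturnstile> C"
    and "\<And>\<Delta>. \<Gamma> \<subseteq> \<Delta> \<Longrightarrow> \<Delta> \<tturnstile> B \<Longrightarrow> \<Delta> \<tturnstile> C"
  shows "\<Gamma> \<tturnstile> C"
proof -
  have "insert A \<Gamma> \<tturnstile> C" "insert B \<Gamma> \<tturnstile> C"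
    by (rule assms(4)[OF _ entails_hyp] assms(5)[OF _ entails_hyp]; use assms(2,3) in blast)+
  then show ?thesis using assms(1) unfolding entails_def
    by (metis OrE finite_insert insert_mono)
qed

lemma obtain_fresh:
  assumes "finite S"
  obtains w :: string where "\<And>\<sigma>. (w, \<sigma>) \<notin> S" "w \<notin> bound_names"
proof -
  have "finite (fst ` S \<union> bound_names)" using assms by (simp add: bound_names_def)
  then obtain w where "w \<notin> fst ` S \<union> bound_names"
    using ex_new_if_finite[OF infinite_UNIV_listI] by blast
  then show ?thesis by (intro that[of w]) force+
qed

lemma clean_Var: "w \<notin> bound_names \<Longrightarrow> clean \<tau> (Var (w, \<tau>))" by (simp add: clean_def)

text \<open>
  A term that is fresh for a given extension exists because the extension is finite; hence a premise about
  all clean terms covers each extension with its own eigenvariable.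
\<close>

lemma entails_allI:
  assumes "\<And>t. clean \<tau> t \<Longrightarrow> \<Gamma> \<tturnstile> subst (x, \<tau>) t A"
  shows "\<Gamma> \<tturnstile> all (x, \<tau>) A"
  unfolding entails_def
proof (intro allI impI)
  fix \<Delta> assume "finite \<Delta>" "\<Gamma> \<subseteq> \<Delta>"
  then have "finite (\<Union>(fv ` \<Delta>) \<union> fv A)" by simp
  then obtain w where w: "\<And>\<sigma>. (w, \<sigma>) \<notin> \<Union>(fv ` \<Delta>) \<union> fv A" "w \<notin> bound_names"
    by (rule obtain_fresh) blast
  have "\<Delta> \<turnstile> subst (x, \<tau>) (Var (w, \<tau>)) A"
    using assms[OF clean_Var[OF w(2)]] \<open>finite \<Delta>\<close> \<open>\<Gamma> \<subseteq> \<Delta>\<close> unfolding entails_def by blast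
  then have "\<Delta> \<turnstile> all (w, \<tau>) (subst (x, \<tau>) (Var (w, \<tau>)) A)"
    by (rule AllI) (use w in blast)
  then show "\<Delta> \<turnstile> all (x, \<tau>) A" using w by (simp add: all_def bind_rename)
qed

lemma entails_allE: "\<Gamma> \<tturnstile> all (x, \<tau>) A \<Longrightarrow> wff A \<Longrightarrow> clean \<tau> t \<Longrightarrow> \<Gamma> \<tturnstile> subst (x, \<tau>) t A"
  unfolding entails_def using AllE[of _ "(x, \<tau>)" A t] by (simp add: clean_typed)

lemma entails_exI: "\<Gamma> \<tturnstile> subst (x, \<tau>) t A \<Longrightarrow> wff A \<Longrightarrow> clean \<tau> t \<Longrightarrow> \<Gamma> \<tturnstile> ex (x, \<tau>) A"
  unfolding entails_def using ExI[of _ "(x, \<tau>)" t A] by (simp add: clean_typed)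

lemma has_type_subst: "has_type bs s \<tau> \<Longrightarrow> typed t (snd v) \<Longrightarrow> has_type bs (subst_tm v t s) \<tau>"
  by (induction s arbitrary: \<tau>) (auto simp: typed_weaken)

lemma wff_subst: "wff_in bs A \<Longrightarrow> typed t (snd v) \<Longrightarrow> wff_in bs (subst v t A)"
  by (induction A arbitrary: bs) (auto simp: has_type_subst)

text \<open>
  Each extension gets its own fresh eigenvariable as the witness; the last premise applies to it because it
  is a clean term.
\<close>

lemma entails_exE:
  assumes "\<Gamma> \<tturnstile> ex (x, \<tau>) A" and "wff A"
    and "\<And>\<Delta> t. \<Gamma> \<subseteq> \<Delta> \<Longrightarrow> clean \<tau> t \<Longrightarrow> \<Delta> \<tturnstile> subst (x, \<tau>) t A \<Longrightarrow> \<Delta> \<tturnstile> C"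
  shows "\<Gamma> \<tturnstile> C"
  unfolding entails_def
proof (intro allI impI)
  fix \<Delta> assume \<Delta>: "finite \<Delta>" "\<Gamma> \<subseteq> \<Delta>"
  then have "finite (\<Union>(fv ` \<Delta>) \<union> fv A \<union> fv C)" by simp
  then obtain w where w: "\<And>\<sigma>. (w, \<sigma>) \<notin> \<Union>(fv ` \<Delta>) \<union> fv A \<union> fv C" "w \<notin> bound_names"
    by (rule obtain_fresh) blast
  let ?B = "subst (x, \<tau>) (Var (w, \<tau>)) A"
  have wffB: "wff ?B" using assms(2) by (simp add: wff_subst)
  have "insert ?B \<Delta> \<tturnstile> C"
    by (rule assms(3)[OF _ clean_Var[OF w(2)]]) (use \<Delta> wffB in \<open>auto intro: entails_hyp\<close>)
  then have C: "insert ?B \<Delta> \<turnstile> C" using \<Delta> by (simp add: entails_derivable)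
  have "\<Delta> \<turnstile> ex (x, \<tau>) A" using assms(1) \<Delta> unfolding entails_def by blast
  then have "\<Delta> \<turnstile> ex (w, \<tau>) ?B" using w by (simp add: ex_def bind_rename)
  then show "\<Delta> \<turnstile> C" by (rule ExE[OF _ wffB C]) (use w in blast)
qed

lemma entails_refl: "clean \<tau> t \<Longrightarrow> \<Gamma> \<tturnstile> Eq \<tau> t t"
  unfolding entails_def by (simp add: EqI clean_typed)

lemma entails_EqE:
  "\<Gamma> \<tturnstile> Eq \<tau> s t \<Longrightarrow> \<Gamma> \<tturnstile> subst (x, \<tau>) s A \<Longrightarrow> wff A \<Longrightarrow> clean \<tau> s \<Longrightarrow> clean \<tau> t \<Longrightarrow>
   \<Gamma> \<tturnstile> subst (x, \<tau>) t A"
  unfolding entails_def using EqE[of _ "(x, \<tau>)" s t A] by (simp add: clean_typed)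

lemma entails_sym: "\<Gamma> \<tturnstile> Eq \<tau> s t \<Longrightarrow> clean \<tau> s \<Longrightarrow> clean \<tau> t \<Longrightarrow> \<Gamma> \<tturnstile> Eq \<tau> t s"
  using entails_EqE[of \<Gamma> \<tau> s t "''n''" "Eq \<tau> (Var (''n'', \<tau>)) s"]
  by (simp add: entails_refl clean_typed)

lemma entails_trans:
  "\<Gamma> \<tturnstile> Eq \<tau> s t \<Longrightarrow> \<Gamma> \<tturnstile> Eq \<tau> t u \<Longrightarrow> clean \<tau> s \<Longrightarrow> clean \<tau> t \<Longrightarrow> clean \<tau> u \<Longrightarrow> \<Gamma> \<tturnstile> Eq \<tau> s u"
  using entails_EqE[of \<Gamma> \<tau> t u "''n''" "Eq \<tau> s (Var (''n'', \<tau>))"] by (simp add: clean_typed)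

lemma entails_cong_arg:
  "\<Gamma> \<tturnstile> Eq \<sigma> s t \<Longrightarrow> clean (\<sigma> \<rightarrow> \<tau>) f \<Longrightarrow> clean \<sigma> s \<Longrightarrow> clean \<sigma> t \<Longrightarrow> \<Gamma> \<tturnstile> Eq \<tau> (f \<cdot> s) (f \<cdot> t)"
  using entails_EqE[of \<Gamma> \<sigma> s t "''n''" "Eq \<tau> (f \<cdot> s) (f \<cdot> Var (''n'', \<sigma>))"]
    clean_App[of \<sigma> \<tau> f s] clean_typed[of "\<sigma> \<rightarrow> \<tau>" f] clean_typed[of \<sigma> s]
  by (simp add: entails_refl) blast

lemma entails_cong_fun:
  "\<Gamma> \<tturnstile> Eq (\<sigma> \<rightarrow> \<tau>) f g \<Longrightarrow> clean \<sigma> s \<Longrightarrow> clean (\<sigma> \<rightarrow> \<tau>) f \<Longrightarrow> clean (\<sigma> \<rightarrow> \<tau>) g \<Longrightarrow> \<Gamma> \<tturnstile> Eq \<tau> (f \<cdot> s) (g \<cdot> s)"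
  using entails_EqE[of \<Gamma> "\<sigma> \<rightarrow> \<tau>" f g "''n''" "Eq \<tau> (f \<cdot> s) (Var (''n'', \<sigma> \<rightarrow> \<tau>) \<cdot> s)"]
    clean_App[of \<sigma> \<tau> f s] clean_typed[of "\<sigma> \<rightarrow> \<tau>" f] clean_typed[of \<sigma> s]
  by (simp add: entails_refl) blast

lemma entails_cong:
  assumes "\<Gamma> \<tturnstile> Eq (\<sigma> \<rightarrow> \<tau>) f g" "\<Gamma> \<tturnstile> Eq \<sigma> s t"
    "clean (\<sigma> \<rightarrow> \<tau>) f" "clean (\<sigma> \<rightarrow> \<tau>) g" "clean \<sigma> s" "clean \<sigma> t"
  shows "\<Gamma> \<tturnstile> Eq \<tau> (f \<cdot> s) (g \<cdot> t)"
  by (meson assms entails_cong_arg entails_cong_fun entails_trans clean_App)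

lemma entails_induct:
  assumes "wff A" and "clean NatT t" and "\<Gamma> \<tturnstile> subst (x, NatT) Zero A"
    and "\<And>\<Delta> t. \<Gamma> \<subseteq> \<Delta> \<Longrightarrow> clean NatT t \<Longrightarrow> \<Delta> \<tturnstile> subst (x, NatT) t A \<Longrightarrow> \<Delta> \<tturnstile> subst (x, NatT) (Succ t) A"
  shows "\<Gamma> \<tturnstile> subst (x, NatT) t A"
proof -
  let ?n = "(x, NatT)"
  have "\<Gamma> \<tturnstile> all ?n (A \<^bold>\<longrightarrow> subst ?n (Succ (Var ?n)) A)"
    by (rule entails_allI)
       (auto simp: subst_twice intro!: entails_ImpI wff_subst assms(1,4) clean_typed)
  moreover have "\<Gamma> \<tturnstile> subst ?n Zero A \<^bold>\<longrightarrow> all ?n (A \<^bold>\<longrightarrow> subst ?n (Succ (Var ?n)) A) \<^bold>\<longrightarrow> all ?n A"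
    by (intro entails_axiom induction assms(1)) simp
  ultimately have "\<Gamma> \<tturnstile> all ?n A" using assms(3) entails_ImpE by blast
  then show ?thesis using assms(1,2) by (rule entails_allE)
qed

text \<open>
  Bracket abstraction: induction over the term, with \<open>S K K\<close> for the abstracted variable itself, \<open>K\<close> for
  the other atoms and \<open>S\<close> for applications.
\<close>

lemma abstraction:
  assumes "typed t \<tau>" and "\<And>w. w \<in> fv_tm t \<Longrightarrow> w \<noteq> (x, \<sigma>) \<Longrightarrow> fst w \<notin> bound_names"
  shows "\<exists>g. clean (\<sigma> \<rightarrow> \<tau>) g \<and> (\<forall>s. clean \<sigma> s \<longrightarrow> ({} \<tturnstile> Eq \<tau> (g \<cdot> s) (subst_tm (x, \<sigma>) s t)))"
  using assms
proof (induction t arbitrary: \<tau>)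
  case (Var w)
  show ?case
  proof (cases "w = (x, \<sigma>)")
    case True
    with Var have [simp]: "\<tau> = \<sigma>" by simp
    let ?K1 = "Const (CK \<sigma> (\<sigma> \<rightarrow> \<sigma>))" and ?K2 = "Const (CK \<sigma> \<sigma>)"
    \<comment> \<open>The identity combinator \<open>S K K\<close>.\<close>
    let ?g = "Const (CS \<sigma> (\<sigma> \<rightarrow> \<sigma>) \<sigma>) \<cdot> ?K1 \<cdot> ?K2"
    have "{} \<tturnstile> Eq \<sigma> (?g \<cdot> s) s" if s: "clean \<sigma> s" for s
    proof (rule entails_trans)
      show "{} \<tturnstile> Eq \<sigma> (?g \<cdot> s) (?K1 \<cdot> s \<cdot> (?K2 \<cdot> s))"
        by (intro entails_axiom comb_S) (auto simp: s clean_typed)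
      show "{} \<tturnstile> Eq \<sigma> (?K1 \<cdot> s \<cdot> (?K2 \<cdot> s)) s"
        by (intro entails_axiom comb_K) (auto simp: s clean_typed)
    qed (use s in \<open>auto simp: clean_def\<close>)
    moreover have "clean (\<sigma> \<rightarrow> \<sigma>) ?g" by (auto simp: clean_def)
    ultimately show ?thesis using True by auto
  next
    case False
    with Var have w: "clean \<tau> (Var w)" by (simp add: clean_def)
    have "clean (\<sigma> \<rightarrow> \<tau>) (Const (CK \<tau> \<sigma>) \<cdot> Var w)" using w by (auto simp: clean_def)
    moreover have "{} \<tturnstile> Eq \<tau> (Const (CK \<tau> \<sigma>) \<cdot> Var w \<cdot> s) (Var w)" if "clean \<sigma> s" for s
      by (intro entails_axiom comb_K clean_typed w that)
    ultimately show ?thesis using False by auto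
  qed
next
  case (Bound i)
  then show ?case by simp
next
  case (Const c)
  then have c: "clean \<tau> (Const c)" by (simp add: clean_def)
  have "clean (\<sigma> \<rightarrow> \<tau>) (Const (CK \<tau> \<sigma>) \<cdot> Const c)" using c by (auto simp: clean_def)
  moreover have "{} \<tturnstile> Eq \<tau> (Const (CK \<tau> \<sigma>) \<cdot> Const c \<cdot> s) (Const c)" if "clean \<sigma> s" for s
    by (intro entails_axiom comb_K clean_typed c that)
  ultimately show ?case by auto
next
  case (App f u)
  then obtain \<rho> where ty: "typed f (\<rho> \<rightarrow> \<tau>)" "typed u \<rho>" by auto
  from App.IH(1)[OF ty(1)] App.prems(2) obtain g where
    g: "clean (\<sigma> \<rightarrow> \<rho> \<rightarrow> \<tau>) g" "\<And>s. clean \<sigma> s \<Longrightarrow> {} \<tturnstile> Eq (\<rho> \<rightarrow> \<tau>) (g \<cdot> s) (subst_tm (x, \<sigma>) s f)" by auto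
  from App.IH(2)[OF ty(2)] App.prems(2) obtain h where
    h: "clean (\<sigma> \<rightarrow> \<rho>) h" "\<And>s. clean \<sigma> s \<Longrightarrow> {} \<tturnstile> Eq \<rho> (h \<cdot> s) (subst_tm (x, \<sigma>) s u)" by auto
  let ?S = "Const (CS \<sigma> \<rho> \<tau>) \<cdot> g \<cdot> h"
  have S: "clean (\<sigma> \<rightarrow> \<tau>) ?S" using g(1) h(1) by (auto simp: clean_def)
  have "{} \<tturnstile> Eq \<tau> (?S \<cdot> s) (subst_tm (x, \<sigma>) s (f \<cdot> u))" if s: "clean \<sigma> s" for s
  proof (rule entails_trans)
    have clean_sub: "clean \<tau>' (subst_tm (x, \<sigma>) s r)"
      if "typed r \<tau>'" "\<And>w. w \<in> fv_tm r \<Longrightarrow> w \<noteq> (x, \<sigma>) \<Longrightarrow> fst w \<notin> bound_names" for r \<tau>'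
    proof -
      have "fv_tm (subst_tm (x, \<sigma>) s r) \<subseteq> (fv_tm r - {(x, \<sigma>)}) \<union> fv_tm s"
        by (induction r) auto
      then show ?thesis using that s by (fastforce simp: clean_def has_type_subst)
    qed
    have fu: "clean (\<rho> \<rightarrow> \<tau>) (subst_tm (x, \<sigma>) s f)" "clean \<rho> (subst_tm (x, \<sigma>) s u)"
      using clean_sub ty App.prems(2) by auto
    show "{} \<tturnstile> Eq \<tau> (?S \<cdot> s) (g \<cdot> s \<cdot> (h \<cdot> s))"
      using g(1) h(1) s by (intro entails_axiom comb_S clean_typed)
    show "{} \<tturnstile> Eq \<tau> (g \<cdot> s \<cdot> (h \<cdot> s)) (subst_tm (x, \<sigma>) s (f \<cdot> u))"
      using entails_cong[OF g(2)[OF s] h(2)[OF s]] fu clean_App[OF g(1) s] clean_App[OF h(1) s] by simp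
    show "clean \<tau> (subst_tm (x, \<sigma>) s (f \<cdot> u))" using fu clean_App by auto
    show "clean \<tau> (?S \<cdot> s)" using S s clean_App by blast
    show "clean \<tau> (g \<cdot> s \<cdot> (h \<cdot> s))" using g(1) h(1) s clean_App by blast
  qed
  with S show ?case by blast
qed

section \<open>Arithmetic of the object theory\<close>

text \<open>
  Carrying the well-formedness of both sides inside the relation makes it symmetric and transitive without
  side conditions, so that calculations can be chained.
\<close>

definition nateq :: "fm set \<Rightarrow> tm \<Rightarrow> tm \<Rightarrow> bool" where
  "nateq \<Gamma> s t \<longleftrightarrow> clean NatT s \<and> clean NatT t \<and> (\<Gamma> \<tturnstile> s \<doteq> t)"

lemma nateq_refl [simp]: "clean NatT s \<Longrightarrow> nateq \<Gamma> s s"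
  by (simp add: nateq_def entails_refl)

lemma nateq_sym: "nateq \<Gamma> s t \<Longrightarrow> nateq \<Gamma> t s"
  by (auto simp: nateq_def intro: entails_sym)

lemma nateq_trans [trans]: "nateq \<Gamma> s t \<Longrightarrow> nateq \<Gamma> t u \<Longrightarrow> nateq \<Gamma> s u"
  by (auto simp: nateq_def intro: entails_trans)

lemma nateq_mono: "nateq \<Gamma> s t \<Longrightarrow> \<Gamma> \<subseteq> \<Delta> \<Longrightarrow> nateq \<Delta> s t"
  by (auto simp: nateq_def intro: entails_mono)

lemma nateq_app: "clean (NatT \<rightarrow> NatT) f \<Longrightarrow> nateq \<Gamma> s t \<Longrightarrow> nateq \<Gamma> (f \<cdot> s) (f \<cdot> t)"
  by (auto simp: nateq_def intro: entails_cong_arg clean_App)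

lemma nateq_app2:
  assumes f: "clean (NatT \<rightarrow> NatT \<rightarrow> NatT) f" and "nateq \<Gamma> s s'" "nateq \<Gamma> t t'"
  shows "nateq \<Gamma> (f \<cdot> s \<cdot> t) (f \<cdot> s' \<cdot> t')"
  unfolding nateq_def
proof (intro conjI)
  show "\<Gamma> \<tturnstile> f \<cdot> s \<cdot> t \<doteq> f \<cdot> s' \<cdot> t'"
    by (rule entails_cong[OF entails_cong_arg]) (use assms in \<open>auto simp: nateq_def intro: clean_App\<close>)
qed (use assms in \<open>auto simp: nateq_def intro: clean_App\<close>)

lemma nateq_Succ: "nateq \<Gamma> s t \<Longrightarrow> nateq \<Gamma> (Succ s) (Succ t)"
  by (rule nateq_app) (simp_all add: clean_Const)
lemma nateq_Plus: "nateq \<Gamma> s s' \<Longrightarrow> nateq \<Gamma> t t' \<Longrightarrow> nateq \<Gamma> (s \<^bold>+ t) (s' \<^bold>+ t')"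
  by (rule nateq_app2) (simp_all add: clean_Const)
lemma nateq_Times: "nateq \<Gamma> s s' \<Longrightarrow> nateq \<Gamma> t t' \<Longrightarrow> nateq \<Gamma> (s \<^bold>* t) (s' \<^bold>* t')"
  by (rule nateq_app2) (simp_all add: clean_Const)

lemma Plus_Zero: "clean NatT s \<Longrightarrow> nateq \<Gamma> (s \<^bold>+ Zero) s"
  by (simp add: nateq_def entails_axiom plus_zero clean_typed)
lemma Plus_Succ: "clean NatT s \<Longrightarrow> clean NatT t \<Longrightarrow> nateq \<Gamma> (s \<^bold>+ Succ t) (Succ (s \<^bold>+ t))"
  by (simp add: nateq_def entails_axiom plus_succ clean_typed)
lemma Times_Zero: "clean NatT s \<Longrightarrow> nateq \<Gamma> (s \<^bold>* Zero) Zero"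
  by (simp add: nateq_def entails_axiom times_zero clean_typed)
lemma Times_Succ: "clean NatT s \<Longrightarrow> clean NatT t \<Longrightarrow> nateq \<Gamma> (s \<^bold>* Succ t) (s \<^bold>* t \<^bold>+ s)"
  by (simp add: nateq_def entails_axiom times_succ clean_typed)

abbreviation nvar :: tm where "nvar \<equiv> Var (''n'', NatT)"

text \<open>
  Object-level induction for an equation; \<open>F\<close> and \<open>G\<close> present its two sides as functions of the induction
  variable, and the assumptions on substitution say that they really are such functions.
\<close>

lemma nateq_induct:
  assumes "clean NatT t"
    and "\<And>s. subst_tm (''n'', NatT) s (F nvar) = F s" "\<And>s. subst_tm (''n'', NatT) s (G nvar) = G s"
    and "typed (F nvar) NatT" "typed (G nvar) NatT"
    and "nateq \<Gamma> (F Zero) (G Zero)" and okF: "\<And>s. clean NatT s \<Longrightarrow> clean NatT (F s)" "\<And>s. clean NatT s \<Longrightarrow> clean NatT (G s)"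
    and step: "\<And>\<Delta> s. \<Gamma> \<subseteq> \<Delta> \<Longrightarrow> clean NatT s \<Longrightarrow> nateq \<Delta> (F s) (G s) \<Longrightarrow> nateq \<Delta> (F (Succ s)) (G (Succ s))"
  shows "nateq \<Gamma> (F t) (G t)"
proof -
  have "\<Gamma> \<tturnstile> subst (''n'', NatT) t (F nvar \<doteq> G nvar)"
    by (rule entails_induct) (use assms in \<open>auto simp: nateq_def\<close>)
  then show ?thesis using assms by (simp add: nateq_def)
qed

lemma Zero_Plus: "clean NatT t \<Longrightarrow> nateq \<Gamma> (Zero \<^bold>+ t) t"
proof (rule nateq_induct[where F = "\<lambda>s. Zero \<^bold>+ s" and G = "\<lambda>s. s"])
  fix \<Delta> s assume "clean NatT s" "nateq \<Delta> (Zero \<^bold>+ s) s"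
  then show "nateq \<Delta> (Zero \<^bold>+ Succ s) (Succ s)"
    by (meson Plus_Succ nateq_Succ nateq_trans clean_nat)
qed (auto simp: clean_typed Plus_Zero)

lemma Succ_Plus:
  assumes s: "clean NatT s" and t: "clean NatT t"
  shows "nateq \<Gamma> (Succ s \<^bold>+ t) (Succ (s \<^bold>+ t))"
proof (rule nateq_induct[OF t, where F = "\<lambda>t. Succ s \<^bold>+ t" and G = "\<lambda>t. Succ (s \<^bold>+ t)"])
  fix \<Delta> t assume t: "clean NatT t" and IH: "nateq \<Delta> (Succ s \<^bold>+ t) (Succ (s \<^bold>+ t))"
  then show "nateq \<Delta> (Succ s \<^bold>+ Succ t) (Succ (s \<^bold>+ Succ t))"
    by (meson Plus_Succ nateq_Succ nateq_trans nateq_sym clean_nat s)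
next
  show "nateq \<Gamma> (Succ s \<^bold>+ Zero) (Succ (s \<^bold>+ Zero))"
    by (meson Plus_Zero nateq_Succ nateq_trans nateq_sym clean_nat s)
qed (use s in \<open>auto simp: clean_typed\<close>)

lemma Plus_comm:
  assumes s: "clean NatT s" and t: "clean NatT t"
  shows "nateq \<Gamma> (s \<^bold>+ t) (t \<^bold>+ s)"
proof (rule nateq_induct[OF t, where F = "\<lambda>t. s \<^bold>+ t" and G = "\<lambda>t. t \<^bold>+ s"])
  fix \<Delta> t assume t: "clean NatT t" and IH: "nateq \<Delta> (s \<^bold>+ t) (t \<^bold>+ s)"
  then show "nateq \<Delta> (s \<^bold>+ Succ t) (Succ t \<^bold>+ s)"
    by (meson Plus_Succ Succ_Plus nateq_Succ nateq_trans nateq_sym s)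
next
  show "nateq \<Gamma> (s \<^bold>+ Zero) (Zero \<^bold>+ s)"
    by (meson Plus_Zero Zero_Plus nateq_trans nateq_sym s)
qed (use s in \<open>auto simp: clean_typed\<close>)

lemma Plus_assoc:
  assumes s: "clean NatT s" and t: "clean NatT t" and u: "clean NatT u"
  shows "nateq \<Gamma> (s \<^bold>+ t \<^bold>+ u) (s \<^bold>+ (t \<^bold>+ u))"
proof (rule nateq_induct[OF u, where F = "\<lambda>u. s \<^bold>+ t \<^bold>+ u" and G = "\<lambda>u. s \<^bold>+ (t \<^bold>+ u)"])
  fix \<Delta> u assume u: "clean NatT u" and IH: "nateq \<Delta> (s \<^bold>+ t \<^bold>+ u) (s \<^bold>+ (t \<^bold>+ u))"
  have "nateq \<Delta> (s \<^bold>+ t \<^bold>+ Succ u) (Succ (s \<^bold>+ t \<^bold>+ u))" using s t u by (simp add: Plus_Succ)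
  also have "nateq \<Delta> \<dots> (Succ (s \<^bold>+ (t \<^bold>+ u)))" using IH by (rule nateq_Succ)
  also have "nateq \<Delta> \<dots> (s \<^bold>+ Succ (t \<^bold>+ u))" using s t u by (simp add: Plus_Succ nateq_sym)
  also have "nateq \<Delta> \<dots> (s \<^bold>+ (t \<^bold>+ Succ u))"
    using s t u by (simp add: Plus_Succ nateq_sym nateq_Plus)
  finally show "nateq \<Delta> (s \<^bold>+ t \<^bold>+ Succ u) (s \<^bold>+ (t \<^bold>+ Succ u))" .
next
  show "nateq \<Gamma> (s \<^bold>+ t \<^bold>+ Zero) (s \<^bold>+ (t \<^bold>+ Zero))"
    by (meson Plus_Zero nateq_Plus nateq_refl nateq_trans nateq_sym clean_nat s t)
qed (use s t in \<open>auto simp: clean_typed\<close>)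

lemma Plus_swap:
  assumes s: "clean NatT s" and t: "clean NatT t" and u: "clean NatT u"
  shows "nateq \<Gamma> (s \<^bold>+ t \<^bold>+ u) (s \<^bold>+ u \<^bold>+ t)"
  by (meson assms Plus_assoc Plus_comm nateq_Plus nateq_refl nateq_trans nateq_sym)

lemma Zero_Times: "clean NatT t \<Longrightarrow> nateq \<Gamma> (Zero \<^bold>* t) Zero"
proof (rule nateq_induct[where F = "\<lambda>t. Zero \<^bold>* t" and G = "\<lambda>t. Zero"])
  fix \<Delta> s assume "clean NatT s" "nateq \<Delta> (Zero \<^bold>* s) Zero"
  then show "nateq \<Delta> (Zero \<^bold>* Succ s) Zero"
    by (meson Plus_Zero Times_Succ nateq_trans clean_nat)
qed (auto simp: clean_typed Times_Zero)

lemma Succ_Times: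
  assumes s: "clean NatT s" and t: "clean NatT t"
  shows "nateq \<Gamma> (Succ s \<^bold>* t) (s \<^bold>* t \<^bold>+ t)"
proof (rule nateq_induct[OF t, where F = "\<lambda>t. Succ s \<^bold>* t" and G = "\<lambda>t. s \<^bold>* t \<^bold>+ t"])
  fix \<Delta> t assume t: "clean NatT t" and IH: "nateq \<Delta> (Succ s \<^bold>* t) (s \<^bold>* t \<^bold>+ t)"
  have "nateq \<Delta> (Succ s \<^bold>* Succ t) (Succ s \<^bold>* t \<^bold>+ Succ s)" using s t by (simp add: Times_Succ)
  also have "nateq \<Delta> \<dots> (s \<^bold>* t \<^bold>+ t \<^bold>+ Succ s)" using IH s by (simp add: nateq_Plus)
  also have "nateq \<Delta> \<dots> (Succ (s \<^bold>* t \<^bold>+ t \<^bold>+ s))" using s t by (simp add: Plus_Succ)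
  also have "nateq \<Delta> \<dots> (Succ (s \<^bold>* t \<^bold>+ s \<^bold>+ t))" using s t by (simp add: nateq_Succ Plus_swap)
  also have "nateq \<Delta> \<dots> (s \<^bold>* t \<^bold>+ s \<^bold>+ Succ t)" using s t by (simp add: Plus_Succ nateq_sym)
  also have "nateq \<Delta> \<dots> (s \<^bold>* Succ t \<^bold>+ Succ t)"
    using s t by (simp add: nateq_Plus Times_Succ nateq_sym)
  finally show "nateq \<Delta> (Succ s \<^bold>* Succ t) (s \<^bold>* Succ t \<^bold>+ Succ t)" .
next
  show "nateq \<Gamma> (Succ s \<^bold>* Zero) (s \<^bold>* Zero \<^bold>+ Zero)"
    by (meson Times_Zero Plus_Zero nateq_trans nateq_sym clean_nat s)
qed (use s in \<open>auto simp: clean_typed\<close>)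

lemma Times_comm:
  assumes s: "clean NatT s" and t: "clean NatT t"
  shows "nateq \<Gamma> (s \<^bold>* t) (t \<^bold>* s)"
proof (rule nateq_induct[OF t, where F = "\<lambda>t. s \<^bold>* t" and G = "\<lambda>t. t \<^bold>* s"])
  fix \<Delta> t assume t: "clean NatT t" and IH: "nateq \<Delta> (s \<^bold>* t) (t \<^bold>* s)"
  then show "nateq \<Delta> (s \<^bold>* Succ t) (Succ t \<^bold>* s)"
    by (meson Times_Succ Succ_Times nateq_Plus nateq_refl nateq_trans nateq_sym s)
next
  show "nateq \<Gamma> (s \<^bold>* Zero) (Zero \<^bold>* s)"
    by (meson Times_Zero Zero_Times nateq_trans nateq_sym s)
qed (use s in \<open>auto simp: clean_typed\<close>)

lemma Plus_Times:
  assumes s: "clean NatT s" and t: "clean NatT t" and u: "clean NatT u"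
  shows "nateq \<Gamma> ((s \<^bold>+ t) \<^bold>* u) (s \<^bold>* u \<^bold>+ t \<^bold>* u)"
proof (rule nateq_induct[OF u, where F = "\<lambda>u. (s \<^bold>+ t) \<^bold>* u" and G = "\<lambda>u. s \<^bold>* u \<^bold>+ t \<^bold>* u"])
  fix \<Delta> u assume u: "clean NatT u" and IH: "nateq \<Delta> ((s \<^bold>+ t) \<^bold>* u) (s \<^bold>* u \<^bold>+ t \<^bold>* u)"
  have "nateq \<Delta> ((s \<^bold>+ t) \<^bold>* Succ u) ((s \<^bold>+ t) \<^bold>* u \<^bold>+ (s \<^bold>+ t))" using s t u by (simp add: Times_Succ)
  also have "nateq \<Delta> \<dots> (s \<^bold>* u \<^bold>+ t \<^bold>* u \<^bold>+ (s \<^bold>+ t))" using IH s t by (simp add: nateq_Plus)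
  also have "nateq \<Delta> \<dots> (s \<^bold>* u \<^bold>+ t \<^bold>* u \<^bold>+ s \<^bold>+ t)" using s t u by (simp add: Plus_assoc nateq_sym)
  also have "nateq \<Delta> \<dots> (s \<^bold>* u \<^bold>+ s \<^bold>+ t \<^bold>* u \<^bold>+ t)" using s t u by (simp add: Plus_swap nateq_Plus)
  also have "nateq \<Delta> \<dots> (s \<^bold>* u \<^bold>+ s \<^bold>+ (t \<^bold>* u \<^bold>+ t))" using s t u by (simp add: Plus_assoc)
  also have "nateq \<Delta> \<dots> (s \<^bold>* Succ u \<^bold>+ t \<^bold>* Succ u)"
    using s t u by (simp add: nateq_Plus Times_Succ nateq_sym)
  finally show "nateq \<Delta> ((s \<^bold>+ t) \<^bold>* Succ u) (s \<^bold>* Succ u \<^bold>+ t \<^bold>* Succ u)" .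
next
  have "nateq \<Gamma> ((s \<^bold>+ t) \<^bold>* Zero) Zero" using s t by (simp add: Times_Zero)
  also have "nateq \<Gamma> \<dots> (Zero \<^bold>+ Zero)" by (simp add: Plus_Zero nateq_sym)
  also have "nateq \<Gamma> \<dots> (s \<^bold>* Zero \<^bold>+ t \<^bold>* Zero)"
    using s t by (simp add: nateq_Plus Times_Zero nateq_sym)
  finally show "nateq \<Gamma> ((s \<^bold>+ t) \<^bold>* Zero) (s \<^bold>* Zero \<^bold>+ t \<^bold>* Zero)" .
qed (use s t in \<open>auto simp: clean_typed\<close>)

lemma Times_assoc:
  assumes s: "clean NatT s" and t: "clean NatT t" and u: "clean NatT u"
  shows "nateq \<Gamma> (s \<^bold>* t \<^bold>* u) (s \<^bold>* (t \<^bold>* u))"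
proof (rule nateq_induct[OF s, where F = "\<lambda>s. s \<^bold>* t \<^bold>* u" and G = "\<lambda>s. s \<^bold>* (t \<^bold>* u)"])
  fix \<Delta> s assume s: "clean NatT s" and IH: "nateq \<Delta> (s \<^bold>* t \<^bold>* u) (s \<^bold>* (t \<^bold>* u))"
  have "nateq \<Delta> (Succ s \<^bold>* t \<^bold>* u) ((s \<^bold>* t \<^bold>+ t) \<^bold>* u)" using s t u by (simp add: nateq_Times Succ_Times)
  also have "nateq \<Delta> \<dots> (s \<^bold>* t \<^bold>* u \<^bold>+ t \<^bold>* u)" using s t u by (simp add: Plus_Times)
  also have "nateq \<Delta> \<dots> (s \<^bold>* (t \<^bold>* u) \<^bold>+ t \<^bold>* u)" using IH t u by (simp add: nateq_Plus)
  also have "nateq \<Delta> \<dots> (Succ s \<^bold>* (t \<^bold>* u))" using s t u by (simp add: Succ_Times nateq_sym)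
  finally show "nateq \<Delta> (Succ s \<^bold>* t \<^bold>* u) (Succ s \<^bold>* (t \<^bold>* u))" .
next
  have "nateq \<Gamma> (Zero \<^bold>* t \<^bold>* u) (Zero \<^bold>* u)" using t u by (simp add: Zero_Times nateq_Times)
  also have "nateq \<Gamma> \<dots> Zero" using u by (simp add: Zero_Times)
  also have "nateq \<Gamma> \<dots> (Zero \<^bold>* (t \<^bold>* u))" using t u by (simp add: Zero_Times nateq_sym)
  finally show "nateq \<Gamma> (Zero \<^bold>* t \<^bold>* u) (Zero \<^bold>* (t \<^bold>* u))" .
qed (use t u in \<open>auto simp: clean_typed\<close>)

lemma One_Times: "clean NatT t \<Longrightarrow> nateq \<Gamma> (One \<^bold>* t) t"
  by (meson Succ_Times Zero_Plus Zero_Times nateq_Plus nateq_refl nateq_trans clean_nat)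

lemma Succ_cancel: "nateq \<Gamma> (Succ s) (Succ t) \<Longrightarrow> clean NatT s \<Longrightarrow> clean NatT t \<Longrightarrow> nateq \<Gamma> s t"
  unfolding nateq_def
  by (blast intro: entails_ImpE[OF entails_axiom[OF succ_inject]] clean_typed)

lemma Plus_cancel:
  assumes s: "clean NatT s" and t: "clean NatT t" and u: "clean NatT u" and eq: "nateq \<Gamma> (s \<^bold>+ u) (t \<^bold>+ u)"
  shows "nateq \<Gamma> s t"
proof -
  have "\<Gamma> \<tturnstile> subst (''n'', NatT) u (s \<^bold>+ nvar \<doteq> t \<^bold>+ nvar \<^bold>\<longrightarrow> s \<doteq> t)"
  proof (rule entails_induct[OF _ u])
    show "wff (s \<^bold>+ nvar \<doteq> t \<^bold>+ nvar \<^bold>\<longrightarrow> s \<doteq> t)" using s t by (auto simp: clean_typed)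
    have "\<Gamma> \<tturnstile> s \<^bold>+ Zero \<doteq> t \<^bold>+ Zero \<^bold>\<longrightarrow> s \<doteq> t"
    proof (rule entails_ImpI)
      fix \<Delta> assume "\<Delta> \<tturnstile> s \<^bold>+ Zero \<doteq> t \<^bold>+ Zero"
      then have "nateq \<Delta> (s \<^bold>+ Zero) (t \<^bold>+ Zero)" using s t by (simp add: nateq_def)
      then have "nateq \<Delta> s t" by (meson Plus_Zero nateq_sym nateq_trans s t)
      then show "\<Delta> \<tturnstile> s \<doteq> t" by (simp add: nateq_def)
    qed (use s t in \<open>auto simp: clean_typed\<close>)
    then show "\<Gamma> \<tturnstile> subst (''n'', NatT) Zero (s \<^bold>+ nvar \<doteq> t \<^bold>+ nvar \<^bold>\<longrightarrow> s \<doteq> t)" using s t by simp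
  next
    fix \<Delta> u assume u: "clean NatT u" and "\<Delta> \<tturnstile> subst (''n'', NatT) u (s \<^bold>+ nvar \<doteq> t \<^bold>+ nvar \<^bold>\<longrightarrow> s \<doteq> t)"
    then have IH: "\<Delta> \<tturnstile> s \<^bold>+ u \<doteq> t \<^bold>+ u \<^bold>\<longrightarrow> s \<doteq> t" using s t by simp
    have "\<Delta> \<tturnstile> s \<^bold>+ Succ u \<doteq> t \<^bold>+ Succ u \<^bold>\<longrightarrow> s \<doteq> t"
    proof (rule entails_ImpI)
      fix \<Delta>' assume "\<Delta> \<subseteq> \<Delta>'" "\<Delta>' \<tturnstile> s \<^bold>+ Succ u \<doteq> t \<^bold>+ Succ u"
      then have "nateq \<Delta>' (s \<^bold>+ Succ u) (t \<^bold>+ Succ u)" using s t u by (simp add: nateq_def)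
      then have "nateq \<Delta>' (Succ (s \<^bold>+ u)) (Succ (t \<^bold>+ u))"
        by (meson Plus_Succ nateq_sym nateq_trans s t u)
      then have "nateq \<Delta>' (s \<^bold>+ u) (t \<^bold>+ u)" using s t u by (auto intro: Succ_cancel)
      then show "\<Delta>' \<tturnstile> s \<doteq> t"
        using entails_ImpE[OF entails_mono[OF IH \<open>\<Delta> \<subseteq> \<Delta>'\<close>]] by (simp add: nateq_def)
    qed (use s t u in \<open>auto simp: clean_typed\<close>)
    then show "\<Delta> \<tturnstile> subst (''n'', NatT) (Succ u) (s \<^bold>+ nvar \<doteq> t \<^bold>+ nvar \<^bold>\<longrightarrow> s \<doteq> t)" using s t by simp
  qed
  then have "\<Gamma> \<tturnstile> s \<^bold>+ u \<doteq> t \<^bold>+ u \<^bold>\<longrightarrow> s \<doteq> t" using s t by simp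
  then show ?thesis using eq entails_ImpE s t unfolding nateq_def by blast
qed

text \<open>
  The definition of \<open>nat_le\<close> binds an index directly; this restores a named binder, to which the
  quantifier rules apply.
\<close>

lemma nat_le_ex: "clean NatT s \<Longrightarrow> clean NatT t \<Longrightarrow> nat_le s t = ex (''n'', NatT) (s \<^bold>+ nvar \<doteq> t)"
  by (simp add: nat_le_def ex_def)

lemma nat_leI: "nateq \<Gamma> (s \<^bold>+ k) t \<Longrightarrow> clean NatT s \<Longrightarrow> clean NatT k \<Longrightarrow> \<Gamma> \<tturnstile> nat_le s t"
  by (subst nat_le_ex) (auto simp: nateq_def clean_typed intro!: entails_exI[where t = k])

lemma nat_leE:
  assumes "\<Gamma> \<tturnstile> nat_le s t" and s: "clean NatT s" and t: "clean NatT t"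
    and "\<And>\<Delta> k. \<Gamma> \<subseteq> \<Delta> \<Longrightarrow> clean NatT k \<Longrightarrow> nateq \<Delta> (s \<^bold>+ k) t \<Longrightarrow> \<Delta> \<tturnstile> C"
  shows "\<Gamma> \<tturnstile> C"
proof (rule entails_exE)
  show "\<Gamma> \<tturnstile> ex (''n'', NatT) (s \<^bold>+ nvar \<doteq> t)" using assms by (simp add: nat_le_ex)
qed (use assms in \<open>auto simp: clean_typed nateq_def\<close>)

lemma wff_nat_le [simp]: "typed s NatT \<Longrightarrow> typed t NatT \<Longrightarrow> wff (nat_le s t)"
  by (auto simp: nat_le_def typed_weaken)

lemma subst_nat_le [simp]: "subst v u (nat_le s t) = nat_le (subst_tm v u s) (subst_tm v u t)"
  by (simp add: nat_le_def)

lemma entails_eq_sentence: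
  "\<Gamma> \<tturnstile> Eq \<sigma> s t \<Longrightarrow> clean \<sigma> s \<Longrightarrow> clean \<sigma> t \<Longrightarrow> wff A \<Longrightarrow>
   (\<Gamma> \<tturnstile> subst (x, \<sigma>) s A) \<longleftrightarrow> (\<Gamma> \<tturnstile> subst (x, \<sigma>) t A)"
  by (meson entails_EqE entails_sym)

lemma nat_le_cong:
  assumes "nateq \<Gamma> s s'" "nateq \<Gamma> t t'"
  shows "(\<Gamma> \<tturnstile> nat_le s t) \<longleftrightarrow> (\<Gamma> \<tturnstile> nat_le s' t')"
  using assms entails_eq_sentence[of \<Gamma> NatT s s' "nat_le nvar t" "''n''"]
    entails_eq_sentence[of \<Gamma> NatT t t' "nat_le s' nvar" "''n''"]
  unfolding nateq_def by (elim conjE) (simp add: clean_typed)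

text \<open>
  Case distinction is the trivial instance of induction.  The successor case is phrased as \<open>1 \<le> t\<close>, whose
  witness is the predecessor of \<open>t\<close>.
\<close>

lemma zero_or_succ:
  assumes "clean NatT t"
  shows "\<Gamma> \<tturnstile> t \<doteq> Zero \<^bold>\<or> nat_le One t"
proof -
  have "\<Gamma> \<tturnstile> subst (''n'', NatT) t (nvar \<doteq> Zero \<^bold>\<or> nat_le One nvar)"
  proof (rule entails_induct[OF _ assms])
    fix \<Delta> t assume "clean NatT t"
    then have "\<Delta> \<tturnstile> nat_le One (Succ t)"
      by (intro nat_leI[where k = t]) (auto intro: nateq_trans[OF Succ_Plus nateq_Succ[OF Zero_Plus]])
    then show "\<Delta> \<tturnstile> subst (''n'', NatT) (Succ t) (nvar \<doteq> Zero \<^bold>\<or> nat_le One nvar)"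
      using \<open>clean NatT t\<close> by (auto simp: clean_typed intro!: entails_OrI2)
  qed (auto intro!: entails_OrI1 entails_refl)
  then show ?thesis by simp
qed

lemma zero_or_succE:
  assumes t: "clean NatT t" and 0: "\<And>\<Delta>. \<Gamma> \<subseteq> \<Delta> \<Longrightarrow> nateq \<Delta> t Zero \<Longrightarrow> \<Delta> \<tturnstile> C"
    and S: "\<And>\<Delta> k. \<Gamma> \<subseteq> \<Delta> \<Longrightarrow> clean NatT k \<Longrightarrow> nateq \<Delta> t (Succ k) \<Longrightarrow> \<Delta> \<tturnstile> C"
  shows "\<Gamma> \<tturnstile> C"
proof (rule entails_OrE[OF zero_or_succ[OF t]])
  fix \<Delta> assume "\<Gamma> \<subseteq> \<Delta>" "\<Delta> \<tturnstile> nat_le One t"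
  then show "\<Delta> \<tturnstile> C"
  proof (rule_tac nat_leE)
    fix \<Delta>' k assume "\<Delta> \<subseteq> \<Delta>'" and k: "clean NatT k" and "nateq \<Delta>' (One \<^bold>+ k) t"
    then have "nateq \<Delta>' t (Succ k)"
      by (meson Succ_Plus Zero_Plus nateq_Succ nateq_sym nateq_trans clean_nat)
    then show "\<Delta>' \<tturnstile> C" using S \<open>\<Gamma> \<subseteq> \<Delta>\<close> \<open>\<Delta> \<subseteq> \<Delta>'\<close> k by blast
  qed (use t in auto)
qed (use t 0 in \<open>auto simp: clean_typed nateq_def\<close>)

lemma nat_le_Succ: "\<Gamma> \<tturnstile> nat_le s t \<Longrightarrow> clean NatT s \<Longrightarrow> clean NatT t \<Longrightarrow> \<Gamma> \<tturnstile> nat_le s (Succ t)"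
proof (erule nat_leE)
  fix \<Delta> k assume "clean NatT s" "clean NatT k" "nateq \<Delta> (s \<^bold>+ k) t"
  then show "\<Delta> \<tturnstile> nat_le s (Succ t)"
    by (intro nat_leI[where k = "Succ k"]) (auto intro: nateq_trans[OF Plus_Succ nateq_Succ])
qed auto

lemma nat_le_refl: "nateq \<Gamma> s t \<Longrightarrow> \<Gamma> \<tturnstile> nat_le s t"
  by (rule nat_leI[where k = Zero]) (auto simp: nateq_def intro: entails_trans[OF Plus_Zero[unfolded nateq_def, THEN conjunct2, THEN conjunct2]])

text \<open>
  Decidability of the order, by induction on \<open>t\<close>: if \<open>t < s\<close>, then \<open>s = t + 1 + k\<close>, and \<open>k\<close> being zero
  or a successor settles the comparison of \<open>s\<close> with \<open>t + 1\<close>.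
\<close>

lemma nat_dichotomy:
  assumes s: "clean NatT s" and t: "clean NatT t"
  shows "\<Gamma> \<tturnstile> nat_le s t \<^bold>\<or> nat_le (Succ t) s"
proof -
  let ?A = "nat_le s nvar \<^bold>\<or> nat_le (Succ nvar) s"
  have "\<Gamma> \<tturnstile> subst (''n'', NatT) t ?A"
  proof (rule entails_induct[OF _ t])
    show "wff ?A" using s by (auto simp: clean_typed)
    have "\<Gamma> \<tturnstile> nat_le s Zero \<^bold>\<or> nat_le One s"
      by (rule entails_OrE[OF zero_or_succ[OF s]])
         (auto simp: s clean_typed nateq_def intro: entails_OrI1[OF nat_le_refl] entails_OrI2)
    then show "\<Gamma> \<tturnstile> subst (''n'', NatT) Zero ?A" using s by simp
  next
    fix \<Delta> t assume t: "clean NatT t" and "\<Delta> \<tturnstile> subst (''n'', NatT) t ?A"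
    then have "\<Delta> \<tturnstile> nat_le s t \<^bold>\<or> nat_le (Succ t) s" using s by simp
    then have "\<Delta> \<tturnstile> nat_le s (Succ t) \<^bold>\<or> nat_le (Succ (Succ t)) s"
    proof (rule entails_OrE)
      fix \<Delta>' assume "\<Delta>' \<tturnstile> nat_le (Succ t) s"
      then show "\<Delta>' \<tturnstile> nat_le s (Succ t) \<^bold>\<or> nat_le (Succ (Succ t)) s"
      proof (rule nat_leE)
        fix \<Theta> k assume k: "clean NatT k" and eq: "nateq \<Theta> (Succ t \<^bold>+ k) s"
        show "\<Theta> \<tturnstile> nat_le s (Succ t) \<^bold>\<or> nat_le (Succ (Succ t)) s"
        proof (rule zero_or_succE[OF k])
          fix \<Xi> assume "\<Theta> \<subseteq> \<Xi>" "nateq \<Xi> k Zero"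
          then have "nateq \<Xi> s (Succ t)"
            by (meson Plus_Zero eq nateq_Plus nateq_mono nateq_refl nateq_sym nateq_trans clean_nat(2) t)
          then show "\<Xi> \<tturnstile> nat_le s (Succ t) \<^bold>\<or> nat_le (Succ (Succ t)) s"
            using s t by (auto intro!: entails_OrI1 nat_le_refl simp: clean_typed)
        next
          fix \<Xi> j assume "\<Theta> \<subseteq> \<Xi>" and j: "clean NatT j" and "nateq \<Xi> k (Succ j)"
          have "nateq \<Xi> (Succ (Succ t) \<^bold>+ j) (Succ (Succ t \<^bold>+ j))" using t j by (simp add: Succ_Plus)
          also have "nateq \<Xi> \<dots> (Succ t \<^bold>+ Succ j)" using t j by (simp add: Plus_Succ nateq_sym)
          also have "nateq \<Xi> \<dots> (Succ t \<^bold>+ k)"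
            using t \<open>nateq \<Xi> k (Succ j)\<close> by (simp add: nateq_Plus nateq_sym)
          also have "nateq \<Xi> \<dots> s" using eq \<open>\<Theta> \<subseteq> \<Xi>\<close> by (rule nateq_mono)
          finally have "\<Xi> \<tturnstile> nat_le (Succ (Succ t)) s" using t j by (auto intro: nat_leI)
          then show "\<Xi> \<tturnstile> nat_le s (Succ t) \<^bold>\<or> nat_le (Succ (Succ t)) s"
            using s t by (auto intro!: entails_OrI2 simp: clean_typed)
        qed
      qed (use s t in auto)
    qed (use s t in \<open>auto simp: clean_typed intro!: entails_OrI1 nat_le_Succ\<close>)
    then show "\<Delta> \<tturnstile> subst (''n'', NatT) (Succ t) ?A" using s by simp
  qed
  then show ?thesis using s by simp
qed

lemma Succ_not_Zero: "nateq \<Gamma> (Succ t) Zero \<Longrightarrow> clean NatT t \<Longrightarrow> \<Gamma> \<tturnstile> Falsum"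
  unfolding nateq_def
  by (blast intro: entails_ImpE[OF entails_axiom[OF succ_nonzero]] clean_typed)

section \<open>Natural number terms modulo provable equality\<close>

text \<open>
  Equality in \<open>natq\<close> is provable equality without hypotheses; terms with free variables are included.  The
  semiring laws hold as proved above, but \<open>0 \<noteq> 1\<close> would express the consistency of the object
  theory, so the type is not an instance of \<open>semiring_1\<close>.
\<close>

quotient_type natq = tm / partial: "nateq {}"
  by (rule part_equivpI) (auto simp: symp_def transp_def intro: nateq_sym nateq_trans exI[of _ Zero])

abbreviation nq :: "tm \<Rightarrow> natq" where "nq \<equiv> abs_natq"

lemma natq_cases: obtains s where "clean NatT s" "x = nq s"
  using Quotient_abs_rep[OF Quotient_natq, of x] Quotient_rep_reflp[OF Quotient_natq, of x]
  by (metis nateq_def)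

lemma nq_eq_iff: "clean NatT s \<Longrightarrow> clean NatT t \<Longrightarrow> nq s = nq t \<longleftrightarrow> nateq {} s t"
  using Quotient_rel[OF Quotient_natq, of s t] by simp

instantiation natq :: "{comm_semiring_0, comm_monoid_mult, cancel_semigroup_add}"
begin

lift_definition zero_natq :: natq is Zero by simp
lift_definition one_natq :: natq is One by simp
lift_definition plus_natq :: "natq \<Rightarrow> natq \<Rightarrow> natq" is "\<lambda>s t. s \<^bold>+ t" by (rule nateq_Plus)
lift_definition times_natq :: "natq \<Rightarrow> natq \<Rightarrow> natq" is "\<lambda>s t. s \<^bold>* t" by (rule nateq_Times)

instance
proof
  fix a b c :: natq
  show "a + b + c = a + (b + c)" by transfer (simp add: nateq_def[of "{}"] Plus_assoc[unfolded nateq_def])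
  show comm: "a + b = b + a" for a b :: natq
    by transfer (simp add: nateq_def[of "{}"] Plus_comm[unfolded nateq_def])
  show "0 + a = a" by transfer (simp add: nateq_def[of "{}"] Zero_Plus[unfolded nateq_def])
  show "a * b * c = a * (b * c)"
    by transfer (simp add: nateq_def[of "{}"] Times_assoc[unfolded nateq_def])
  show mult_comm: "a * b = b * a" for a b :: natq
    by transfer (simp add: nateq_def[of "{}"] Times_comm[unfolded nateq_def])
  show "1 * a = a" by transfer (simp add: nateq_def[of "{}"] One_Times[unfolded nateq_def])
  show zero: "0 * a = 0" for a :: natq
    by transfer (simp add: nateq_def[of "{}"] Zero_Times[unfolded nateq_def])
  show "a * 0 = 0" using zero[of a] mult_comm[of a 0] by simp
  show "(a + b) * c = a * c + b * c"
    by transfer (simp add: nateq_def[of "{}"] Plus_Times[unfolded nateq_def])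
  have cancel: "b + a = c + a \<Longrightarrow> b = c" for a b c :: natq
    by transfer (meson Plus_cancel nateq_def)
  show "b + a = c + a \<Longrightarrow> b = c" by (rule cancel)
  show "a + b = a + c \<Longrightarrow> b = c" using cancel[of b a c] by (simp add: comm)
qed

end

lift_definition eqN :: "fm set \<Rightarrow> natq \<Rightarrow> natq \<Rightarrow> bool" is nateq
  by (meson nateq_mono nateq_sym nateq_trans empty_subsetI)

lift_definition leN :: "fm set \<Rightarrow> natq \<Rightarrow> natq \<Rightarrow> bool" is "\<lambda>\<Gamma> s t. \<Gamma> \<tturnstile> nat_le s t"
  by (meson nat_le_cong nateq_mono empty_subsetI)

lemma nq_simps:
  "nq Zero = 0"
  "clean NatT s \<Longrightarrow> nq (Succ s) = nq s + 1"
  "clean NatT s \<Longrightarrow> clean NatT t \<Longrightarrow> nq (s \<^bold>+ t) = nq s + nq t"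
  "clean NatT s \<Longrightarrow> clean NatT t \<Longrightarrow> nq (s \<^bold>* t) = nq s * nq t"
proof -
  show "nq Zero = 0" by (simp add: zero_natq_def)
  show plus: "nq (s \<^bold>+ t) = nq s + nq t" if "clean NatT s" "clean NatT t" for s t
    using that by (simp add: plus_natq.abs_eq)
  show "nq (s \<^bold>* t) = nq s * nq t" if "clean NatT s" "clean NatT t"
    using that by (simp add: times_natq.abs_eq)
  assume s: "clean NatT s"
  have "nateq {} (s \<^bold>+ One) (Succ (s \<^bold>+ Zero))" using s by (simp add: Plus_Succ)
  also have "nateq {} \<dots> (Succ s)" using s by (simp add: nateq_Succ Plus_Zero)
  finally have "nq (s \<^bold>+ One) = nq (Succ s)" using s by (simp add: nq_eq_iff)
  then show "nq (Succ s) = nq s + 1" using plus[OF s, of One] by (simp add: one_natq_def)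
qed

lemma eqN_nq: "clean NatT s \<Longrightarrow> clean NatT t \<Longrightarrow> eqN \<Gamma> (nq s) (nq t) \<longleftrightarrow> (\<Gamma> \<tturnstile> s \<doteq> t)"
  by (simp add: eqN.abs_eq nateq_def entails_refl)

lemma leN_nq: "clean NatT s \<Longrightarrow> clean NatT t \<Longrightarrow> leN \<Gamma> (nq s) (nq t) \<longleftrightarrow> (\<Gamma> \<tturnstile> nat_le s t)"
  by (simp add: leN.abs_eq)

text \<open>
  The properties of contexts that a formula expresses.  They are the admissible conclusions of the
  elimination rules below, which would otherwise have to name the formula.
\<close>

definition sentence :: "(fm set \<Rightarrow> bool) \<Rightarrow> bool" where
  "sentence P \<longleftrightarrow> (\<exists>C. wff C \<and> (\<forall>\<Gamma>. P \<Gamma> \<longleftrightarrow> (\<Gamma> \<tturnstile> C)))"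

lemma sentence_entails: "wff C \<Longrightarrow> sentence (\<lambda>\<Gamma>. \<Gamma> \<tturnstile> C)"
  by (auto simp: sentence_def)

lemma sentence_mono: "sentence P \<Longrightarrow> P \<Gamma> \<Longrightarrow> \<Gamma> \<subseteq> \<Delta> \<Longrightarrow> P \<Delta>"
  by (auto simp: sentence_def intro: entails_mono)

lemma sentence_absurd: "\<Gamma> \<tturnstile> Falsum \<Longrightarrow> sentence P \<Longrightarrow> P \<Gamma>"
  by (auto simp: sentence_def intro: entails_FalsumE)

lemma sentence_eqN: "sentence (\<lambda>\<Gamma>. eqN \<Gamma> x y)"
proof -
  obtain s where s: "clean NatT s" "x = nq s" by (rule natq_cases)
  obtain t where t: "clean NatT t" "y = nq t" by (rule natq_cases)
  show ?thesis unfolding sentence_def using s t by (intro exI[of _ "s \<doteq> t"]) (simp add: eqN_nq clean_typed)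
qed

lemma sentence_leN: "sentence (\<lambda>\<Gamma>. leN \<Gamma> x y)"
proof -
  obtain s where s: "clean NatT s" "x = nq s" by (rule natq_cases)
  obtain t where t: "clean NatT t" "y = nq t" by (rule natq_cases)
  show ?thesis unfolding sentence_def using s t
    by (intro exI[of _ "nat_le s t"]) (simp add: leN_nq clean_typed)
qed

lemmas eqN_mono = sentence_mono[OF sentence_eqN]
lemmas leN_mono = sentence_mono[OF sentence_leN]

lemma eqN_refl [simp]: "eqN \<Gamma> x x"
  by transfer (meson empty_subsetI nateq_mono)
lemma eqN_sym: "eqN \<Gamma> x y \<Longrightarrow> eqN \<Gamma> y x"
  by transfer (rule nateq_sym)
lemma eqN_trans [trans]: "eqN \<Gamma> x y \<Longrightarrow> eqN \<Gamma> y z \<Longrightarrow> eqN \<Gamma> x z"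
  by transfer (rule nateq_trans)
lemma eqN_plus: "eqN \<Gamma> x x' \<Longrightarrow> eqN \<Gamma> y y' \<Longrightarrow> eqN \<Gamma> (x + y) (x' + y')"
  by transfer (rule nateq_Plus)
lemma eqN_times: "eqN \<Gamma> x x' \<Longrightarrow> eqN \<Gamma> y y' \<Longrightarrow> eqN \<Gamma> (x * y) (x' * y')"
  by transfer (rule nateq_Times)
lemma eqN_cancel: "eqN \<Gamma> (x + z) (y + z) \<Longrightarrow> eqN \<Gamma> x y"
  by transfer (meson Plus_cancel nateq_def)
lemma eqN_one_zero:
  assumes "eqN \<Gamma> (x + 1) 0" shows "\<Gamma> \<tturnstile> Falsum"
proof -
  obtain s where "clean NatT s" "x = nq s" by (rule natq_cases)
  with assms have "\<Gamma> \<tturnstile> Succ s \<doteq> Zero" by (simp flip: nq_simps add: eqN_nq)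
  then show ?thesis using \<open>clean NatT s\<close> Succ_not_Zero[of \<Gamma> s] by (simp add: nateq_def)
qed

lemma leN_I: "eqN \<Gamma> (x + k) y \<Longrightarrow> leN \<Gamma> x y"
  by transfer (metis nat_leI nateq_def)

lemma leN_E:
  assumes "leN \<Gamma> x y" and P: "sentence P" and step: "\<And>\<Delta> k. \<Gamma> \<subseteq> \<Delta> \<Longrightarrow> eqN \<Delta> (x + k) y \<Longrightarrow> P \<Delta>"
  shows "P \<Gamma>"
proof -
  obtain s where s: "clean NatT s" "x = nq s" by (rule natq_cases)
  obtain t where t: "clean NatT t" "y = nq t" by (rule natq_cases)
  obtain C where C: "\<And>\<Gamma>. P \<Gamma> \<longleftrightarrow> (\<Gamma> \<tturnstile> C)" using P by (auto simp: sentence_def)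
  have "\<Gamma> \<tturnstile> nat_le s t" using assms(1) s t by (simp add: leN_nq)
  then have "\<Gamma> \<tturnstile> C"
  proof (rule nat_leE[OF _ s(1) t(1)])
    fix \<Delta> k assume "\<Gamma> \<subseteq> \<Delta>" "clean NatT k" "nateq \<Delta> (s \<^bold>+ k) t"
    then show "\<Delta> \<tturnstile> C"
      using step[of \<Delta> "nq k"] s t by (simp add: C nateq_def eqN_nq flip: nq_simps(3))
  qed
  then show ?thesis by (simp add: C)
qed

lemma leN_eqN: "eqN \<Gamma> x y \<Longrightarrow> leN \<Gamma> x y"
  by (rule leN_I[of _ _ 0]) simp

lemma leN_refl [simp]: "leN \<Gamma> x x"
  by (simp add: leN_eqN)

lemma leN_zero [simp]: "leN \<Gamma> 0 x"
  by (rule leN_I[of _ _ x]) simp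

lemma leN_trans [trans]: "leN \<Gamma> x y \<Longrightarrow> leN \<Gamma> y z \<Longrightarrow> leN \<Gamma> x z"
proof (erule leN_E[OF _ sentence_leN])
  fix \<Delta> k assume *: "leN \<Gamma> y z" "\<Gamma> \<subseteq> \<Delta>" and k: "eqN \<Delta> (x + k) y"
  then have "leN \<Delta> y z" by (auto intro: leN_mono)
  then show "leN \<Delta> x z"
  proof (rule leN_E[OF _ sentence_leN])
    fix \<Delta>' j assume "\<Delta> \<subseteq> \<Delta>'" and j: "eqN \<Delta>' (y + j) z"
    have "eqN \<Delta>' (x + (k + j)) (y + j)"
      using eqN_plus[OF eqN_mono[OF k \<open>\<Delta> \<subseteq> \<Delta>'\<close>], of j j] by (simp add: add.assoc)
    then show "leN \<Delta>' x z" using j by (auto intro: leN_I eqN_trans)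
  qed
qed

lemma leN_add_right: "leN \<Gamma> x y \<Longrightarrow> leN \<Gamma> (x + z) (y + z)"
proof (erule leN_E[OF _ sentence_leN])
  fix \<Delta> k assume "eqN \<Delta> (x + k) y"
  then have "eqN \<Delta> (x + z + k) (y + z)" using eqN_plus[of \<Delta> "x + k" y z z] by (simp add: ac_simps)
  then show "leN \<Delta> (x + z) (y + z)" by (rule leN_I)
qed

lemma leN_add: "leN \<Gamma> x y \<Longrightarrow> leN \<Gamma> u v \<Longrightarrow> leN \<Gamma> (x + u) (y + v)"
  using leN_trans[OF leN_add_right[of \<Gamma> x y u], of "y + v"] leN_add_right[of \<Gamma> u v y]
  by (simp add: add.commute)

lemma leN_mult_right: "leN \<Gamma> x y \<Longrightarrow> leN \<Gamma> (x * z) (y * z)"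
proof (erule leN_E[OF _ sentence_leN])
  fix \<Delta> k assume "eqN \<Delta> (x + k) y"
  then have "eqN \<Delta> (x * z + k * z) (y * z)" using eqN_times[of \<Delta> "x + k" y z z] by (simp add: distrib_right)
  then show "leN \<Delta> (x * z) (y * z)" by (rule leN_I)
qed

lemma leN_add_cancel: "leN \<Gamma> (x + z) (y + z) \<Longrightarrow> leN \<Gamma> x y"
proof (erule leN_E[OF _ sentence_leN])
  fix \<Delta> k assume "eqN \<Delta> (x + z + k) (y + z)"
  then have "eqN \<Delta> (x + k + z) (y + z)" by (simp add: ac_simps)
  then show "leN \<Delta> x y" by (auto intro: leN_I eqN_cancel)
qed

lemma leN_cases:
  assumes P: "sentence P" and 1: "\<And>\<Delta>. \<Gamma> \<subseteq> \<Delta> \<Longrightarrow> leN \<Delta> x y \<Longrightarrow> P \<Delta>"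
    and 2: "\<And>\<Delta>. \<Gamma> \<subseteq> \<Delta> \<Longrightarrow> leN \<Delta> (y + 1) x \<Longrightarrow> P \<Delta>"
  shows "P \<Gamma>"
proof -
  obtain s where s: "clean NatT s" "x = nq s" by (rule natq_cases)
  obtain t where t: "clean NatT t" "y = nq t" by (rule natq_cases)
  obtain C where C: "\<And>\<Gamma>. P \<Gamma> \<longleftrightarrow> (\<Gamma> \<tturnstile> C)" using P by (auto simp: sentence_def)
  have "\<Gamma> \<tturnstile> C"
  proof (rule entails_OrE[OF nat_dichotomy[OF s(1) t(1)]])
    fix \<Delta> assume "\<Gamma> \<subseteq> \<Delta>" "\<Delta> \<tturnstile> nat_le s t"
    then show "\<Delta> \<tturnstile> C" using 1[of \<Delta>] s t by (simp add: C leN_nq)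
  next
    fix \<Delta> assume "\<Gamma> \<subseteq> \<Delta>" "\<Delta> \<tturnstile> nat_le (Succ t) s"
    then show "\<Delta> \<tturnstile> C" using 2[of \<Delta>] s t by (simp add: C leN_nq flip: nq_simps(2))
  qed (use s t in \<open>auto simp: clean_typed\<close>)
  then show ?thesis by (simp add: C)
qed

lemma leN_one_zero: "leN \<Gamma> (x + 1) 0 \<Longrightarrow> \<Gamma> \<tturnstile> Falsum"
proof (erule leN_E[OF _ sentence_entails])
  fix \<Delta> k assume "eqN \<Delta> (x + 1 + k) 0"
  then show "\<Delta> \<tturnstile> Falsum" using eqN_one_zero[of \<Delta> "x + k"] by (simp add: ac_simps)
qed simp

lemma leN_irrefl: "leN \<Gamma> (x + 1) x \<Longrightarrow> \<Gamma> \<tturnstile> Falsum"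
  using leN_add_cancel[of \<Gamma> 1 x 0] leN_one_zero[of \<Gamma> 0] by (simp add: add.commute)

definition positive :: "natq \<Rightarrow> bool" where "positive d \<longleftrightarrow> (\<exists>e. d = e + 1)"

lemma positive_Suc [simp]: "positive (e + 1)" "positive (1 + e)" by (auto simp: positive_def add.commute)
lemma positive_one [simp]: "positive 1" using positive_Suc[of 0] by simp

lemma positive_mult [simp]: "positive d \<Longrightarrow> positive e \<Longrightarrow> positive (d * e)"
proof -
  assume "positive d" "positive e"
  then obtain a b where "d = a + 1" "e = b + 1" by (auto simp: positive_def)
  then have "d * e = (a * b + a + b) + 1" by (simp add: algebra_simps)
  then show ?thesis by (auto simp: positive_def)
qed

lemma positive_add [simp]: "positive d \<Longrightarrow> positive (d + e)"
proof -
  assume "positive d"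
  then obtain a where "d = a + 1" by (auto simp: positive_def)
  then have "d + e = (a + e) + 1" by (simp add: algebra_simps)
  then show ?thesis by (auto simp: positive_def)
qed

text \<open>
  By decidability: \<open>y < x\<close> would give \<open>(y + 1) d \<le> y d\<close>, which is absurd for positive \<open>d\<close>.
\<close>

lemma leN_mult_cancel:
  assumes "leN \<Gamma> (x * d) (y * d)" and "positive d"
  shows "leN \<Gamma> x y"
proof (rule leN_cases[OF sentence_leN, of _ x y])
  obtain e where d: "d = e + 1" using \<open>positive d\<close> by (auto simp: positive_def)
  fix \<Delta> assume "\<Gamma> \<subseteq> \<Delta>" "leN \<Delta> (y + 1) x"
  then have "leN \<Delta> ((y + 1) * d) (x * d)" by (intro leN_mult_right)
  also have "leN \<Delta> (x * d) (y * d)" using assms(1) \<open>\<Gamma> \<subseteq> \<Delta>\<close> by (rule leN_mono)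
  finally have "leN \<Delta> (e + 1 + y * d) (0 + y * d)" by (simp add: d algebra_simps)
  then have "\<Delta> \<tturnstile> Falsum" by (blast intro: leN_one_zero leN_add_cancel)
  then show "leN \<Delta> x y" using sentence_leN by (rule sentence_absurd)
qed

lemma natq_zero_cases:
  assumes P: "sentence P" and 0: "\<And>\<Delta>. \<Gamma> \<subseteq> \<Delta> \<Longrightarrow> eqN \<Delta> x 0 \<Longrightarrow> P \<Delta>"
    and S: "\<And>\<Delta> k. \<Gamma> \<subseteq> \<Delta> \<Longrightarrow> eqN \<Delta> x (k + 1) \<Longrightarrow> P \<Delta>"
  shows "P \<Gamma>"
proof -
  obtain s where s: "clean NatT s" "x = nq s" by (rule natq_cases)
  obtain C where C: "\<And>\<Gamma>. P \<Gamma> \<longleftrightarrow> (\<Gamma> \<tturnstile> C)" using P by (auto simp: sentence_def)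
  have "\<Gamma> \<tturnstile> C"
  proof (rule zero_or_succE[OF s(1)])
    fix \<Delta> assume "\<Gamma> \<subseteq> \<Delta>" "nateq \<Delta> s Zero"
    then show "\<Delta> \<tturnstile> C" using 0[of \<Delta>] s by (simp add: C nateq_def flip: nq_simps(1)) (simp add: eqN_nq)
  next
    fix \<Delta> k assume "\<Gamma> \<subseteq> \<Delta>" "clean NatT k" "nateq \<Delta> s (Succ k)"
    then show "\<Delta> \<tturnstile> C" using S[of \<Delta> "nq k"] s by (simp add: C nateq_def eqN_nq flip: nq_simps(2))
  qed
  then show ?thesis by (simp add: C)
qed

lemma leN_antisym:
  assumes "leN \<Gamma> x y" "leN \<Gamma> y x" shows "eqN \<Gamma> x y"
proof (rule leN_E[OF assms(1) sentence_eqN])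
  fix \<Delta> k assume "\<Gamma> \<subseteq> \<Delta>" and k: "eqN \<Delta> (x + k) y"
  show "eqN \<Delta> x y"
  proof (rule natq_zero_cases[OF sentence_eqN, of _ k])
    fix \<Theta> assume "\<Delta> \<subseteq> \<Theta>" "eqN \<Theta> k 0"
    then have "eqN \<Theta> (x + 0) (x + k)" by (intro eqN_plus) (auto intro: eqN_sym)
    also have "eqN \<Theta> \<dots> y" using k \<open>\<Delta> \<subseteq> \<Theta>\<close> by (rule eqN_mono)
    finally show "eqN \<Theta> x y" by simp
  next
    fix \<Theta> j assume \<Theta>: "\<Delta> \<subseteq> \<Theta>" and j: "eqN \<Theta> k (j + 1)"
    have "eqN \<Theta> (x + (j + 1)) (x + k)" using eqN_sym[OF j] by (intro eqN_plus) auto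
    also have "eqN \<Theta> \<dots> y" using k \<Theta> by (rule eqN_mono)
    finally have "leN \<Theta> (x + (j + 1)) y" by (rule leN_eqN)
    also have "leN \<Theta> y x" using assms(2) \<open>\<Gamma> \<subseteq> \<Delta>\<close> \<Theta> by (blast intro: leN_mono)
    finally have "leN \<Theta> (j + 1 + x) (0 + x)" by (simp add: add.commute)
    then show "eqN \<Theta> x y" by (rule sentence_absurd[OF leN_one_zero[OF leN_add_cancel] sentence_eqN])
  qed
qed

text \<open>
  This turns derivations without hypotheses into equations in \<open>natq\<close>; together with antisymmetry, it
  transfers the cancellation of positive factors from \<open>\<le>\<close> to equality.
\<close>

lemma eqN_empty_iff: "eqN {} x y \<longleftrightarrow> x = y"
proof -
  obtain s where s: "clean NatT s" "x = nq s" by (rule natq_cases)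
  obtain t where t: "clean NatT t" "y = nq t" by (rule natq_cases)
  show ?thesis using s t by (simp add: eqN_nq nq_eq_iff nateq_def)
qed

lemma positive_mult_cancel: "x * d = y * d \<Longrightarrow> positive d \<Longrightarrow> x = y"
  using leN_antisym[OF leN_mult_cancel leN_mult_cancel, of "{}" x d y d] by (simp add: eqN_empty_iff)

section \<open>Formal fractions\<close>

text \<open>
  The triple \<open>(p, q, d)\<close> stands for \<open>(p - q) / d\<close>.
\<close>

fun ratrel :: "natq \<times> natq \<times> natq \<Rightarrow> natq \<times> natq \<times> natq \<Rightarrow> bool" where
  "ratrel (p, q, d) (p', q', d') \<longleftrightarrow> positive d \<and> positive d' \<and> p * d' + q' * d = p' * d + q * d'"

text \<open>
  The usual argument for fractions: multiply the two equations by the outer denominators and cancel \<open>d2\<close>.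
\<close>

lemma ratrel_trans:
  assumes "ratrel (p1, q1, d1) (p2, q2, d2)" "ratrel (p2, q2, d2) (p3, q3, d3)"
  shows "ratrel (p1, q1, d1) (p3, q3, d3)"
proof -
  from assms have positive: "positive d1" "positive d2" "positive d3"
    and 1: "p1 * d2 + q2 * d1 = p2 * d1 + q1 * d2" and 2: "p2 * d3 + q3 * d2 = p3 * d2 + q2 * d3" by auto
  have "(p1 * d3 + q3 * d1) * d2 + (q2 * d1 * d3 + p2 * d1 * d3) = (p1 * d2 + q2 * d1) * d3 + (p2 * d3 + q3 * d2) * d1"
    by (simp add: algebra_simps)
  also have "\<dots> = (p2 * d1 + q1 * d2) * d3 + (p3 * d2 + q2 * d3) * d1" by (simp only: 1 2)
  also have "\<dots> = (p3 * d1 + q1 * d3) * d2 + (q2 * d1 * d3 + p2 * d1 * d3)"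
    by (simp add: algebra_simps)
  finally have "(p1 * d3 + q3 * d1) * d2 = (p3 * d1 + q1 * d3) * d2" by (simp only: add_right_cancel)
  then show ?thesis using positive positive_mult_cancel by auto
qed

quotient_type ratq = "natq \<times> natq \<times> natq" / partial: ratrel
proof (rule part_equivpI)
  show "\<exists>x. ratrel x x" by (rule exI[of _ "(0, 0, 1)"]) simp
  show "symp ratrel" by (auto simp: symp_def)
  show "transp ratrel" unfolding transp_def by (metis ratrel_trans prod_cases3)
qed

definition fraction :: "natq \<Rightarrow> natq \<Rightarrow> natq \<Rightarrow> ratq" where "fraction p q d = abs_ratq (p, q, d)"

lemma ratq_cases: obtains p q d where "positive d" "x = fraction p q d"
proof -
  obtain p q d where *: "rep_ratq x = (p, q, d)" by (rule prod_cases3)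
  then have "ratrel (p, q, d) (p, q, d)" using Quotient_rep_reflp[OF Quotient_ratq, of x] by simp
  moreover have "x = fraction p q d" unfolding fraction_def
    by (metis * Quotient_abs_rep Quotient_ratq)
  ultimately show ?thesis using that by simp
qed

lemma fraction_eq_iff: "positive d \<Longrightarrow> positive d' \<Longrightarrow> fraction p q d = fraction p' q' d' \<longleftrightarrow> p * d' + q' * d = p' * d + q * d'"
  using Quotient_rel[OF Quotient_ratq, of "(p, q, d)" "(p', q', d')"] by (auto simp: fraction_def)

instantiation ratq :: ab_group_add
begin

lift_definition zero_ratq :: ratq is "(0, 0, 1)" by simp

lift_definition plus_ratq :: "ratq \<Rightarrow> ratq \<Rightarrow> ratq" is
  "\<lambda>(p, q, d) (p', q', d'). (p * d' + p' * d, q * d' + q' * d, d * d')"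
proof -
  have "ratrel (p1 * e1 + r1 * d1, q1 * e1 + s1 * d1, d1 * e1) (p2 * e2 + r2 * d2, q2 * e2 + s2 * d2, d2 * e2)"
    if "ratrel (p1, q1, d1) (p2, q2, d2)" "ratrel (r1, s1, e1) (r2, s2, e2)" for p1 q1 d1 p2 q2 d2 r1 s1 e1 r2 s2 e2
  proof -
    from that have 1: "p1 * d2 + q2 * d1 = p2 * d1 + q1 * d2" and 2: "r1 * e2 + s2 * e1 = r2 * e1 + s1 * e2"
      by auto
    have "(p1 * e1 + r1 * d1) * (d2 * e2) + (q2 * e2 + s2 * d2) * (d1 * e1) =
       (p1 * d2 + q2 * d1) * (e1 * e2) + (r1 * e2 + s2 * e1) * (d1 * d2)" by (simp add: algebra_simps)
    also have "\<dots> = (p2 * d1 + q1 * d2) * (e1 * e2) + (r2 * e1 + s1 * e2) * (d1 * d2)" by (simp only: 1 2)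
    also have "\<dots> = (p2 * e2 + r2 * d2) * (d1 * e1) + (q1 * e1 + s1 * d1) * (d2 * e2)"
      by (simp add: algebra_simps)
    finally show ?thesis using that by simp
  qed
  then show "\<And>x x' y y'. ratrel x x' \<Longrightarrow> ratrel y y' \<Longrightarrow>
    ratrel ((\<lambda>(p, q, d) (p', q', d'). (p * d' + p' * d, q * d' + q' * d, d * d')) x y)
      ((\<lambda>(p, q, d) (p', q', d'). (p * d' + p' * d, q * d' + q' * d, d * d')) x' y')"
    by (clarsimp simp del: ratrel.simps)
qed

lift_definition uminus_ratq :: "ratq \<Rightarrow> ratq" is "\<lambda>(p, q, d). (q, p, d)"
  by (auto simp: ac_simps)

definition minus_ratq :: "ratq \<Rightarrow> ratq \<Rightarrow> ratq" where "minus_ratq x y = x + - y"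

lemma fraction_add: "positive d \<Longrightarrow> positive d' \<Longrightarrow> fraction p q d + fraction p' q' d' = fraction (p * d' + p' * d) (q * d' + q' * d) (d * d')"
  by (simp add: fraction_def plus_ratq.abs_eq)

lemma fraction_uminus: "positive d \<Longrightarrow> - fraction p q d = fraction q p d"
  by (simp add: fraction_def uminus_ratq.abs_eq)

lemma fraction_zero: "0 = fraction 0 0 1" by (simp add: fraction_def zero_ratq_def)

instance
proof
  fix a b c :: ratq
  obtain p q d where a: "positive d" "a = fraction p q d" by (rule ratq_cases)
  obtain p' q' d' where b: "positive d'" "b = fraction p' q' d'" by (rule ratq_cases)
  obtain p'' q'' d'' where c: "positive d''" "c = fraction p'' q'' d''" by (rule ratq_cases)
  show "a + b + c = a + (b + c)" using a b c by (simp add: fraction_add fraction_eq_iff algebra_simps)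
  show "a + b = b + a" using a b by (simp add: fraction_add fraction_eq_iff algebra_simps)
  show "0 + a = a" using a by (simp add: fraction_add fraction_eq_iff fraction_zero)
  show "- a + a = 0" using a by (simp add: fraction_add fraction_uminus fraction_eq_iff fraction_zero algebra_simps)
  show "a - b = a + - b" by (simp add: minus_ratq_def)
qed

end

text \<open>
  The sign of \<open>(p - q) / d\<close> under the hypotheses \<open>\<Gamma>\<close>.  It does not depend on the representation, because
  positive factors can be cancelled in inequalities.
\<close>

lift_definition nonneg :: "fm set \<Rightarrow> ratq \<Rightarrow> bool" is "\<lambda>\<Gamma> (p, q, d). leN \<Gamma> q p"
proof -
  have "leN \<Gamma> q' p'" if rel: "ratrel (p, q, d) (p', q', d')" and "leN \<Gamma> q p" for \<Gamma> p q d p' q' d'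
  proof -
    from rel have d: "positive d" and eq: "p * d' + q' * d = p' * d + q * d'" by auto
    have "leN \<Gamma> (p' * d + q * d') (p' * d + p * d')"
      using \<open>leN \<Gamma> q p\<close> by (intro leN_add leN_refl leN_mult_right)
    then have "leN \<Gamma> (q' * d + p * d') (p' * d + p * d')" by (simp flip: eq add: add.commute)
    then show ?thesis using d by (blast dest: leN_add_cancel intro: leN_mult_cancel)
  qed
  moreover have "ratrel y x" if "ratrel x y" for x y
    using that by (cases x; cases y) auto
  ultimately show "\<And>\<Gamma> x y. ratrel x y \<Longrightarrow>
    (case x of (p, q, d) \<Rightarrow> leN \<Gamma> q p) = (case y of (p, q, d) \<Rightarrow> leN \<Gamma> q p)"
    by (clarsimp simp del: ratrel.simps) metis
qed

lemma nonneg_frc: "positive d \<Longrightarrow> nonneg \<Gamma> (fraction p q d) \<longleftrightarrow> leN \<Gamma> q p"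
  by (simp add: fraction_def nonneg.abs_eq)

lemma sentence_nonneg: "sentence (\<lambda>\<Gamma>. nonneg \<Gamma> x)"
  by (rule ratq_cases[of x]) (simp add: nonneg_frc sentence_leN)

lemmas nonneg_mono = sentence_mono[OF sentence_nonneg]

lemma nonneg_zero [simp]: "nonneg \<Gamma> 0"
  by (simp add: fraction_zero nonneg_frc)

lemma nonneg_add: "nonneg \<Gamma> x \<Longrightarrow> nonneg \<Gamma> y \<Longrightarrow> nonneg \<Gamma> (x + y)"
  by (rule ratq_cases[of x], rule ratq_cases[of y])
     (simp add: fraction_add nonneg_frc leN_add leN_mult_right)

definition recip :: "natq \<Rightarrow> ratq" where "recip d = fraction 1 0 d"

lemma nonneg_recip [simp]: "positive d \<Longrightarrow> nonneg \<Gamma> (recip d)"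
  by (simp add: recip_def nonneg_frc)

lemma fraction_split: "positive d \<Longrightarrow> fraction (p + p') 0 d = fraction p 0 d + fraction p' 0 d"
  by (simp add: fraction_add fraction_eq_iff algebra_simps)

lemma recip_expand: "positive d \<Longrightarrow> positive k \<Longrightarrow> recip d = fraction k 0 (k * d)"
  by (simp add: recip_def fraction_eq_iff)

lemma recip_double: "positive d \<Longrightarrow> recip d = recip (d + d) + recip (d + d)"
  using recip_expand[of d "1 + 1"] by (simp add: fraction_split distrib_right recip_def)

lemma recip_triple: "positive d \<Longrightarrow> recip d = recip (d + d + d) + recip (d + d + d) + recip (d + d + d)"
  using recip_expand[of d "1 + 1 + 1"] by (simp add: fraction_split distrib_right recip_def)

lemma recip_quintuple:
  "positive d \<Longrightarrow> recip d = recip (d + d + d + d + d) + recip (d + d + d + d + d) + recip (d + d + d + d + d)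
     + recip (d + d + d + d + d) + recip (d + d + d + d + d)"
  using recip_expand[of d "1 + 1 + 1 + 1 + 1"] by (simp add: fraction_split distrib_right recip_def)

lemma recip_nonpos_absurd: "positive d \<Longrightarrow> nonneg \<Gamma> (- recip d) \<Longrightarrow> \<Gamma> \<tturnstile> Falsum"
  using leN_one_zero[of \<Gamma> 0] by (simp add: recip_def fraction_uminus nonneg_frc)

text \<open>
  Where the denominator of \<open>x\<close> is \<open>d\<close>, the single instance \<open>n = d + 1\<close> is sufficient.  Estimates with an
  error that tends to zero end with this step.
\<close>

lemma archimedean:
  assumes "\<And>n. positive n \<Longrightarrow> nonneg \<Gamma> (x + recip n)" shows "nonneg \<Gamma> x"
proof -
  obtain p q d where d: "positive d" and x: "x = fraction p q d" by (rule ratq_cases)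
  show ?thesis unfolding x nonneg_frc[OF d]
  proof (rule leN_cases[OF sentence_leN, of _ q p])
    fix \<Delta> assume \<Delta>: "\<Gamma> \<subseteq> \<Delta>" and "leN \<Delta> (p + 1) q"
    \<comment> \<open>If \<open>p - q\<close> were at most \<open>-1\<close>, then \<open>x + 1/n \<ge> 0\<close> would force \<open>n \<le> d\<close>.\<close>
    let ?n = "d + 1"
    have "leN \<Delta> ((p + 1) * ?n) (q * ?n)" using \<open>leN \<Delta> (p + 1) q\<close> by (rule leN_mult_right)
    also have "nonneg \<Gamma> (x + recip ?n)" by (rule assms) simp
    then have "leN \<Delta> (q * ?n) (p * ?n + d)"
      using d \<Delta> by (auto simp: x recip_def fraction_add nonneg_frc intro: leN_mono)
    finally have "leN \<Delta> (d + 1 + p * ?n) (d + p * ?n)" by (simp add: algebra_simps)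
    then have "leN \<Delta> (d + 1) d" by (rule leN_add_cancel)
    then show "leN \<Delta> q p" by (rule sentence_absurd[OF leN_irrefl sentence_leN])
  qed
qed

lemma fraction_mono:
  assumes "leN \<Gamma> p p'" "positive d" shows "nonneg \<Gamma> (fraction p' 0 d - fraction p 0 d)"
  using assms by (simp add: minus_ratq_def fraction_uminus fraction_add nonneg_frc leN_mult_right)

lemma recip_antimono:
  assumes "leN \<Gamma> d e" "positive d" "positive e" shows "nonneg \<Gamma> (recip d - recip e)"
  using assms by (simp add: recip_def minus_ratq_def fraction_uminus fraction_add nonneg_frc)

text \<open>
  The source of the weights of the series \<open>z\<close>.
\<close>

lemma recip_telescope:
  assumes "positive d" shows "recip d - recip (d + 1) = recip (d * (d + 1))"
  using assms by (simp add: recip_def minus_ratq_def fraction_uminus fraction_add fraction_eq_iff algebra_simps)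

declare clean_has_type [simp]

section \<open>Rational terms of the object theory\<close>

definition rpos :: "tm \<Rightarrow> tm" where "rpos t = Const (CFst NatT (ProdT NatT NatT)) \<cdot> t"
definition rneg :: "tm \<Rightarrow> tm" where "rneg t = Const (CFst NatT NatT) \<cdot> (Const (CSnd NatT (ProdT NatT NatT)) \<cdot> t)"
definition rden :: "tm \<Rightarrow> tm" where "rden t = Const (CSnd NatT NatT) \<cdot> (Const (CSnd NatT (ProdT NatT NatT)) \<cdot> t)"

lemma rat_of_parts: "rat_of t = (rpos t, rneg t, Succ (rden t))"
  by (simp add: rat_of_def rpos_def rneg_def rden_def Let_def)

lemma clean_parts [simp]:
  assumes "clean RatT t" shows "clean NatT (rpos t)" "clean NatT (rneg t)" "clean NatT (rden t)"
  using assms by (auto simp: rpos_def rneg_def rden_def clean_def simp del: clean_has_type)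

lemma typed_parts [simp]:
  assumes "typed t RatT" shows "typed (rpos t) NatT" "typed (rneg t) NatT" "typed (rden t) NatT"
  using assms by (auto simp: rpos_def rneg_def rden_def)

lemma subst_parts [simp]:
  "subst_tm v u (rpos t) = rpos (subst_tm v u t)" "subst_tm v u (rneg t) = rneg (subst_tm v u t)"
  "subst_tm v u (rden t) = rden (subst_tm v u t)"
  by (simp_all add: rpos_def rneg_def rden_def)

fun subst_rat :: "var \<Rightarrow> tm \<Rightarrow> rat_tm \<Rightarrow> rat_tm" where
  "subst_rat v u (p, q, d) = (subst_tm v u p, subst_tm v u q, subst_tm v u d)"

fun typed_rat :: "rat_tm \<Rightarrow> bool" where
  "typed_rat (p, q, d) \<longleftrightarrow> typed p NatT \<and> typed q NatT \<and> typed d NatT"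

lemma subst_rat_simps [simp]:
  "subst_rat v u (rat_of t) = rat_of (subst_tm v u t)"
  "subst_rat v u (frac k t) = frac (subst_tm v u k) (subst_tm v u t)"
  "subst_rat v u (rat_neg r) = rat_neg (subst_rat v u r)"
  "subst_rat v u (rat_add r s) = rat_add (subst_rat v u r) (subst_rat v u s)"
  "subst_rat v u (rat_diff r s) = rat_diff (subst_rat v u r) (subst_rat v u s)"
  by (cases r; cases s; simp add: rat_of_parts frac_def rat_diff_def)+

lemma subst_rat_fm [simp]:
  "subst v u (rat_le r s) = rat_le (subst_rat v u r) (subst_rat v u s)"
  "subst v u (rat_less r s) = rat_less (subst_rat v u r) (subst_rat v u s)"
  "subst v u (rat_abs_le r s) = rat_abs_le (subst_rat v u r) (subst_rat v u s)"
  by (cases r; cases s; simp add: nat_less_def rat_abs_le_def)+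

lemma typed_rat_simps [simp]:
  "typed t RatT \<Longrightarrow> typed_rat (rat_of t)"
  "typed k NatT \<Longrightarrow> typed n NatT \<Longrightarrow> typed_rat (frac k n)"
  "typed_rat r \<Longrightarrow> typed_rat (rat_neg r)"
  "typed_rat r \<Longrightarrow> typed_rat s \<Longrightarrow> typed_rat (rat_add r s)"
  "typed_rat r \<Longrightarrow> typed_rat s \<Longrightarrow> typed_rat (rat_diff r s)"
  by (cases r; cases s; auto simp: rat_of_parts frac_def rat_diff_def)+

lemma wff_rat [simp]:
  "typed_rat r \<Longrightarrow> typed_rat s \<Longrightarrow> wff (rat_le r s)"
  "typed_rat r \<Longrightarrow> typed_rat s \<Longrightarrow> wff (rat_less r s)"
  "typed_rat r \<Longrightarrow> typed_rat s \<Longrightarrow> wff (rat_abs_le r s)"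
  by (cases r; cases s; auto simp: nat_less_def rat_abs_le_def)+

text \<open>
  The triples that denote an element of \<open>ratq\<close>: positivity of the denominator must be provable outright.
\<close>

fun proper_rat :: "rat_tm \<Rightarrow> bool" where
  "proper_rat (p, q, d) \<longleftrightarrow> clean NatT p \<and> clean NatT q \<and> clean NatT d \<and> positive (nq d)"

fun rat_val :: "rat_tm \<Rightarrow> ratq" where "rat_val (p, q, d) = fraction (nq p) (nq q) (nq d)"

lemma positive_Succ [simp]: "clean NatT t \<Longrightarrow> positive (nq (Succ t))" by (simp add: nq_simps)

lemma proper_rat_simps [simp]:
  "clean RatT t \<Longrightarrow> proper_rat (rat_of t)"
  "clean NatT k \<Longrightarrow> clean NatT n \<Longrightarrow> positive (nq n) \<Longrightarrow> proper_rat (frac k n)"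
  "proper_rat r \<Longrightarrow> proper_rat (rat_neg r)"
  "proper_rat r \<Longrightarrow> proper_rat s \<Longrightarrow> proper_rat (rat_add r s)"
  "proper_rat r \<Longrightarrow> proper_rat s \<Longrightarrow> proper_rat (rat_diff r s)"
  by (cases r; cases s; simp add: rat_of_parts frac_def rat_diff_def nq_simps(3-))+

lemma rat_val_neg: "proper_rat r \<Longrightarrow> rat_val (rat_neg r) = - rat_val r"
  by (cases r) (simp add: fraction_uminus)
lemma rat_val_add: "proper_rat r \<Longrightarrow> proper_rat s \<Longrightarrow> rat_val (rat_add r s) = rat_val r + rat_val s"
  by (cases r; cases s) (simp add: fraction_add nq_simps)
lemma rat_val_diff: "proper_rat r \<Longrightarrow> proper_rat s \<Longrightarrow> rat_val (rat_diff r s) = rat_val r - rat_val s"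
  by (simp add: rat_diff_def rat_val_add rat_val_neg)
lemma rat_val_One: "clean NatT t \<Longrightarrow> rat_val (frac One t) = recip (nq t)"
  by (simp add: frac_def recip_def nq_simps)
lemma rat_val_Two: "clean NatT t \<Longrightarrow> positive (nq t) \<Longrightarrow> rat_val (frac Two t) = recip (nq t) + recip (nq t)"
  by (simp add: frac_def recip_def nq_simps fraction_split)
lemmas rat_val_simps = rat_val_neg rat_val_add rat_val_diff rat_val_One rat_val_Two

lemma entails_rat_le: "proper_rat r \<Longrightarrow> proper_rat s \<Longrightarrow> (\<Gamma> \<tturnstile> rat_le r s) \<longleftrightarrow> nonneg \<Gamma> (rat_val s - rat_val r)"
  by (cases r; cases s)
     (simp add: minus_ratq_def fraction_uminus fraction_add nonneg_frc leN_nq[symmetric] nq_simps algebra_simps)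

lemma entails_rat_abs_le:
  "proper_rat r \<Longrightarrow> proper_rat s \<Longrightarrow>
   (\<Gamma> \<tturnstile> rat_abs_le r s) \<longleftrightarrow> nonneg \<Gamma> (rat_val s - rat_val r) \<and> nonneg \<Gamma> (rat_val s + rat_val r)"
  by (simp add: rat_abs_le_def entails_And_iff entails_rat_le rat_val_neg)

text \<open>
  A strict inequality holds iff every extension that proves the opposite weak inequality is inconsistent.
  The direction from right to left is where decidability enters.  It confines strict inequalities to this
  lemma: all later estimates are about \<open>nonneg\<close>.
\<close>

lemma entails_rat_less:
  assumes r: "proper_rat r" and s: "proper_rat s"
  shows "(\<Gamma> \<tturnstile> rat_less r s) \<longleftrightarrow> (\<forall>\<Delta>. \<Gamma> \<subseteq> \<Delta> \<longrightarrow> nonneg \<Delta> (rat_val r - rat_val s) \<longrightarrow> (\<Delta> \<tturnstile> Falsum))"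
proof -
  obtain p q d where pq: "r = (p, q, d)" by (rule prod_cases3)
  obtain p' q' d' where pq': "s = (p', q', d')" by (rule prod_cases3)
  define x where "x = nq (p \<^bold>* d' \<^bold>+ q' \<^bold>* d)"
  define y where "y = nq (p' \<^bold>* d \<^bold>+ q \<^bold>* d')"
  have less: "(\<Gamma> \<tturnstile> rat_less r s) \<longleftrightarrow> leN \<Gamma> (x + 1) y" for \<Gamma>
    using r s by (simp add: pq pq' nat_less_def x_def y_def leN_nq flip: nq_simps(2))
  have le: "nonneg \<Delta> (rat_val r - rat_val s) \<longleftrightarrow> leN \<Delta> y x" for \<Delta>
    using r s unfolding entails_rat_le[OF s r, symmetric] by (simp add: pq pq' x_def y_def leN_nq)
  show ?thesis unfolding less le
  proof (intro iffI allI impI)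
    fix \<Delta> assume "leN \<Gamma> (x + 1) y" "\<Gamma> \<subseteq> \<Delta>" "leN \<Delta> y x"
    then show "\<Delta> \<tturnstile> Falsum" by (blast intro: leN_irrefl leN_trans leN_mono)
  next
    assume *: "\<forall>\<Delta>. \<Gamma> \<subseteq> \<Delta> \<longrightarrow> leN \<Delta> y x \<longrightarrow> (\<Delta> \<tturnstile> Falsum)"
    show "leN \<Gamma> (x + 1) y"
    proof (rule leN_cases[OF sentence_leN, of _ y x])
      fix \<Delta> assume "\<Gamma> \<subseteq> \<Delta>" "leN \<Delta> y x"
      with * have "\<Delta> \<tturnstile> Falsum" by blast
      then show "leN \<Delta> (x + 1) y" by (rule sentence_absurd[OF _ sentence_leN])
    qed
  qed
qed

lemma clean_seq_app [simp]: "clean RatSeqT x \<Longrightarrow> clean NatT t \<Longrightarrow> clean RatT (x \<cdot> t)" by (rule clean_App)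

lemma typed_seq_app [simp]: "clean RatSeqT x \<Longrightarrow> typed t NatT \<Longrightarrow> typed (x \<cdot> t) RatT"
  using clean_typed by fastforce

text \<open>
  Congruence for each of the three components, obtained by substitution into a variable of type \<open>RatT\<close>.
\<close>

lemma rat_val_cong:
  assumes eq: "{} \<tturnstile> Eq RatT s t" and s: "clean RatT s" and t: "clean RatT t"
  shows "nq (rpos s) = nq (rpos t)" "nq (rneg s) = nq (rneg t)" "nq (rden s) = nq (rden t)"
    "rat_val (rat_of s) = rat_val (rat_of t)"
proof -
  have *: "nateq {} (subst_tm (''n'', RatT) s F) (subst_tm (''n'', RatT) t F)"
    if "typed F NatT" "clean NatT (subst_tm (''n'', RatT) s F)" "clean NatT (subst_tm (''n'', RatT) t F)" for F
    using entails_EqE[OF eq, of "''n''" "subst_tm (''n'', RatT) s F \<doteq> F"] that s t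
    by (simp add: nateq_def entails_refl clean_typed)
  show n: "nq (rpos s) = nq (rpos t)" and p: "nq (rneg s) = nq (rneg t)" and d: "nq (rden s) = nq (rden t)"
    using *[of "rpos (Var (''n'', RatT))"] *[of "rneg (Var (''n'', RatT))"] *[of "rden (Var (''n'', RatT))"] s t
    by (simp_all add: nq_eq_iff)
  show "rat_val (rat_of s) = rat_val (rat_of t)" using n p d s t by (simp add: rat_of_parts nq_simps)
qed

text \<open>
  The rational \<open>x n\<close> as a function on \<open>natq\<close>; the choice of the representing term is immaterial by \<open>seq_val_nq\<close>.
\<close>

definition seq_val :: "tm \<Rightarrow> natq \<Rightarrow> ratq" where "seq_val x n = rat_val (rat_of (x \<cdot> (SOME t. clean NatT t \<and> nq t = n)))"

lemma seq_val_nq: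
  assumes x: "clean RatSeqT x" and t: "clean NatT t"
  shows "seq_val x (nq t) = rat_val (rat_of (x \<cdot> t))"
proof -
  let ?s = "SOME s. clean NatT s \<and> nq s = nq t"
  have s: "clean NatT ?s" "nq ?s = nq t" using someI[of "\<lambda>s. clean NatT s \<and> nq s = nq t" t] t by auto
  then have "{} \<tturnstile> ?s \<doteq> t" using t by (simp add: nq_eq_iff nateq_def)
  then have "{} \<tturnstile> Eq RatT (x \<cdot> ?s) (x \<cdot> t)" using x s(1) t by (rule entails_cong_arg)
  then show ?thesis unfolding seq_val_def by (rule rat_val_cong) (use x s t in simp_all)
qed

text \<open>
  If \<open>m = n\<close> holds only under the hypotheses \<open>\<Gamma>\<close>, then \<open>m\<close> and \<open>n\<close> are different elements of \<open>natq\<close> and the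
  values of \<open>x\<close> there need not be the same element of \<open>ratq\<close>.  The inequality is what remains.
\<close>

lemma seq_val_cong:
  assumes x: "clean RatSeqT x" and "eqN \<Gamma> m n" shows "nonneg \<Gamma> (seq_val x m - seq_val x n)"
proof -
  obtain s where s: "clean NatT s" "m = nq s" by (rule natq_cases)
  obtain t where t: "clean NatT t" "n = nq t" by (rule natq_cases)
  have "\<Gamma> \<tturnstile> t \<doteq> s" using assms(2) s t by (simp add: eqN_nq entails_sym)
  then have "\<Gamma> \<tturnstile> subst (''n'', NatT) s (rat_le (rat_of (x \<cdot> t)) (rat_of (x \<cdot> nvar)))"
    by (rule entails_EqE)
       (use s t x typed_seq_app[OF x clean_typed[OF t(1)]] in \<open>simp_all add: entails_rat_le\<close>)
  then show ?thesis using s t x by (simp add: entails_rat_le seq_val_nq)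
qed

lemma positive_nq: "positive e \<longleftrightarrow> (\<exists>t. clean NatT t \<and> e = nq (Succ t))"
  unfolding positive_def by (metis natq_cases nq_simps(2))

text \<open>
  Object-level quantification over positive integers is quantification over clean terms; the assumption on
  substitution says that \<open>F\<close> treats its argument as a parameter.
\<close>

lemma all_pos_iff:
  assumes "wff (F (Succ (Var (s, NatT))))"
    and F: "\<And>t. clean NatT t \<Longrightarrow> subst (s, NatT) t (F (Succ (Var (s, NatT)))) = F (Succ t)"
  shows "(\<Gamma> \<tturnstile> all_pos s F) \<longleftrightarrow> (\<forall>t. clean NatT t \<longrightarrow> (\<Gamma> \<tturnstile> F (Succ t)))"
  unfolding all_pos_def using assms entails_allE entails_allI by (metis (no_types, lifting))

lemma ex_posI:
  assumes "wff (F (Succ (Var (s, NatT))))"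
    and F: "\<And>t. clean NatT t \<Longrightarrow> subst (s, NatT) t (F (Succ (Var (s, NatT)))) = F (Succ t)"
    and "clean NatT t" "\<Gamma> \<tturnstile> F (Succ t)"
  shows "\<Gamma> \<tturnstile> ex_pos s F"
  unfolding ex_pos_def by (rule entails_exI[where t = t]) (use assms in simp_all)

lemma ex_posE:
  assumes "\<Gamma> \<tturnstile> ex_pos s F" and "wff (F (Succ (Var (s, NatT))))"
    and F: "\<And>t. clean NatT t \<Longrightarrow> subst (s, NatT) t (F (Succ (Var (s, NatT)))) = F (Succ t)"
    and "\<And>\<Delta> t. \<Gamma> \<subseteq> \<Delta> \<Longrightarrow> clean NatT t \<Longrightarrow> \<Delta> \<tturnstile> F (Succ t) \<Longrightarrow> \<Delta> \<tturnstile> C"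
  shows "\<Gamma> \<tturnstile> C"
  by (rule entails_exE[OF assms(1)[unfolded ex_pos_def]]) (use assms in simp_all)

lemma wff_all_pos [simp]: "wff (F (Succ (Var (s, NatT)))) \<Longrightarrow> wff (all_pos s F)"
  by (simp add: all_pos_def wff_all)
lemma wff_ex_pos [simp]: "wff (F (Succ (Var (s, NatT)))) \<Longrightarrow> wff (ex_pos s F)"
  by (simp add: ex_pos_def wff_ex)

lemma subst_all_pos [simp]:
  "v \<noteq> (s, NatT) \<Longrightarrow> clean \<tau> t \<Longrightarrow> s \<in> bound_names \<Longrightarrow>
   subst v t (all_pos s F) = all (s, NatT) (subst v t (F (Succ (Var (s, NatT)))))"
  by (simp add: all_pos_def subst_all)
lemma nq_Two_Times: "clean NatT t \<Longrightarrow> nq (Two \<^bold>* t) = nq t + nq t"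
  by (simp add: nq_simps distrib_right)
lemma typed_Succ [simp]: "typed t NatT \<Longrightarrow> typed (Succ t) NatT" by auto

section \<open>Real numbers of the object theory\<close>

text \<open>
  From here on statements about object-level reals are read as families of inequalities in \<open>ratq\<close>,
  with indices in \<open>natq\<close>.
\<close>

lemma is_real_iff:
  assumes x: "clean RatSeqT x"
  shows "(\<Gamma> \<tturnstile> is_real x) \<longleftrightarrow> (\<forall>m n. positive m \<longrightarrow> positive n \<longrightarrow>
     nonneg \<Gamma> (recip m + recip n - (seq_val x m - seq_val x n)) \<and> nonneg \<Gamma> (recip m + recip n + (seq_val x m - seq_val x n)))"
proof -
  let ?F = "\<lambda>m n. rat_abs_le (rat_diff (rat_of (x \<cdot> m)) (rat_of (x \<cdot> n))) (rat_add (frac One m) (frac One n))"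
  have "(\<Gamma> \<tturnstile> is_real x) \<longleftrightarrow> (\<forall>s. clean NatT s \<longrightarrow> (\<Gamma> \<tturnstile> all_pos ''n'' (?F (Succ s))))"
    unfolding is_real_def
  proof (rule all_pos_iff)
    show "subst (''m'', NatT) t (all_pos ''n'' (?F (Succ (Var (''m'', NatT))))) = all_pos ''n'' (?F (Succ t))"
      if "clean NatT t" for t using that x by (simp add: all_pos_def[of _ "?F (Succ t)"])
  qed (use x in simp)
  also have "\<dots> \<longleftrightarrow> (\<forall>s. clean NatT s \<longrightarrow> (\<forall>t. clean NatT t \<longrightarrow> (\<Gamma> \<tturnstile> ?F (Succ s) (Succ t))))"
  proof (intro all_cong1 imp_cong refl)
    fix s assume s: "clean NatT s"
    show "(\<Gamma> \<tturnstile> all_pos ''n'' (?F (Succ s))) \<longleftrightarrow> (\<forall>t. clean NatT t \<longrightarrow> (\<Gamma> \<tturnstile> ?F (Succ s) (Succ t)))"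
      using x s by (subst all_pos_iff) simp_all
  qed
  also have "\<dots> \<longleftrightarrow> (\<forall>s. clean NatT s \<longrightarrow> (\<forall>t. clean NatT t \<longrightarrow> (let m = nq (Succ s); n = nq (Succ t) in
     nonneg \<Gamma> (recip m + recip n - (seq_val x m - seq_val x n)) \<and> nonneg \<Gamma> (recip m + recip n + (seq_val x m - seq_val x n)))))"
    using x by (simp add: entails_rat_abs_le rat_val_simps seq_val_nq Let_def)
  finally show ?thesis by (auto simp: positive_nq Let_def)
qed

lemma real_eq_iff:
  assumes x: "clean RatSeqT x" and y: "clean RatSeqT y"
  shows "(\<Gamma> \<tturnstile> x =\<^sub>R y) \<longleftrightarrow> (\<forall>n. positive n \<longrightarrow>
     nonneg \<Gamma> (recip n + recip n - (seq_val x n - seq_val y n)) \<and> nonneg \<Gamma> (recip n + recip n + (seq_val x n - seq_val y n)))"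
proof -
  have "(\<Gamma> \<tturnstile> x =\<^sub>R y) \<longleftrightarrow> (\<forall>t. clean NatT t \<longrightarrow> (\<Gamma> \<tturnstile>
     rat_abs_le (rat_diff (rat_of (x \<cdot> Succ t)) (rat_of (y \<cdot> Succ t))) (frac Two (Succ t))))"
    unfolding real_eq_def using x y by (subst all_pos_iff) simp_all
  also have "\<dots> \<longleftrightarrow> (\<forall>t. clean NatT t \<longrightarrow> (let n = nq (Succ t) in
     nonneg \<Gamma> (recip n + recip n - (seq_val x n - seq_val y n)) \<and> nonneg \<Gamma> (recip n + recip n + (seq_val x n - seq_val y n))))"
    using x y by (simp add: entails_rat_abs_le rat_val_simps seq_val_nq Let_def)
  finally show ?thesis by (auto simp: positive_nq Let_def)
qed

lemma real_le_iff:
  assumes x: "clean RatSeqT x" and y: "clean RatSeqT y"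
  shows "(\<Gamma> \<tturnstile> x \<le>\<^sub>R y) \<longleftrightarrow> (\<forall>n. positive n \<longrightarrow> nonneg \<Gamma> (seq_val y (n + n) - seq_val x (n + n) + recip n))"
proof -
  have "(\<Gamma> \<tturnstile> x \<le>\<^sub>R y) \<longleftrightarrow> (\<forall>t. clean NatT t \<longrightarrow> (\<Gamma> \<tturnstile>
     rat_le (rat_neg (frac One (Succ t))) (rat_diff (rat_of (y \<cdot> (Two \<^bold>* Succ t))) (rat_of (x \<cdot> (Two \<^bold>* Succ t))))))"
    unfolding real_le_def using x y by (subst all_pos_iff) simp_all
  also have "\<dots> \<longleftrightarrow> (\<forall>t. clean NatT t \<longrightarrow> nonneg \<Gamma> (seq_val y (nq (Two \<^bold>* Succ t)) - seq_val x (nq (Two \<^bold>* Succ t)) + recip (nq (Succ t))))"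
    using x y by (simp add: entails_rat_le rat_val_simps seq_val_nq)
  also have "\<dots> \<longleftrightarrow> (\<forall>n. positive n \<longrightarrow> nonneg \<Gamma> (seq_val y (n + n) - seq_val x (n + n) + recip n))"
    by (auto simp: positive_nq nq_Two_Times)
  finally show ?thesis .
qed

lemma entails_gap:
  assumes x: "clean RatSeqT x" and y: "clean RatSeqT y" and t: "clean NatT t"
  shows "(\<Gamma> \<tturnstile> rat_less (frac One (Succ t)) (rat_diff (rat_of (y \<cdot> (Two \<^bold>* Succ t))) (rat_of (x \<cdot> (Two \<^bold>* Succ t))))) \<longleftrightarrow>
    (\<forall>\<Delta>. \<Gamma> \<subseteq> \<Delta> \<longrightarrow> nonneg \<Delta> (recip (nq (Succ t)) - (seq_val y (nq (Succ t) + nq (Succ t)) - seq_val x (nq (Succ t) + nq (Succ t)))) \<longrightarrow> (\<Delta> \<tturnstile> Falsum))"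
  using x y t unfolding nq_Two_Times[of "Succ t", OF clean_nat(2)[OF t], symmetric]
  by (simp add: entails_rat_less rat_val_simps seq_val_nq)

lemma real_lessI:
  assumes x: "clean RatSeqT x" and y: "clean RatSeqT y" and n: "positive n"
    and *: "\<And>\<Delta>. \<Gamma> \<subseteq> \<Delta> \<Longrightarrow> nonneg \<Delta> (recip n - (seq_val y (n + n) - seq_val x (n + n))) \<Longrightarrow> \<Delta> \<tturnstile> Falsum"
  shows "\<Gamma> \<tturnstile> x <\<^sub>R y"
proof -
  obtain t where t: "clean NatT t" "n = nq (Succ t)" using n by (auto simp: positive_nq)
  show ?thesis unfolding real_less_def
    by (rule ex_posI[where t = t]) (use x y t * in \<open>auto simp: entails_gap\<close>)
qed

lemma real_lessE:
  assumes "\<Gamma> \<tturnstile> x <\<^sub>R y" and x: "clean RatSeqT x" and y: "clean RatSeqT y"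
    and *: "\<And>\<Delta> n. \<Gamma> \<subseteq> \<Delta> \<Longrightarrow> positive n \<Longrightarrow>
        (\<And>\<Theta>. \<Delta> \<subseteq> \<Theta> \<Longrightarrow> nonneg \<Theta> (recip n - (seq_val y (n + n) - seq_val x (n + n))) \<Longrightarrow> \<Theta> \<tturnstile> Falsum) \<Longrightarrow> \<Delta> \<tturnstile> C"
  shows "\<Gamma> \<tturnstile> C"
  by (rule ex_posE[OF assms(1)[unfolded real_less_def]])
     (use x y in \<open>auto simp: entails_gap intro!: *\<close>)

section \<open>Explicit sequences of rationals\<close>

definition mkrat :: "tm \<Rightarrow> tm \<Rightarrow> tm \<Rightarrow> tm" where
  "mkrat p q r = Const (CPair NatT (ProdT NatT NatT)) \<cdot> p \<cdot> (Const (CPair NatT NatT) \<cdot> q \<cdot> r)"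

definition neg_tm :: "tm \<Rightarrow> tm" where "neg_tm s = mkrat (rneg s) (rpos s) (rden s)"

text \<open>
  Addition of fractions.  The last component is the predecessor of the product of the denominators, as the
  denominator of a \<open>RatT\<close> object is the successor of its last component:
  \<open>(r + 1) (r' + 1) = ((r + 1) r' + r) + 1\<close>.
\<close>

definition add_tm :: "tm \<Rightarrow> tm \<Rightarrow> tm" where
  "add_tm s t = mkrat (rpos s \<^bold>* Succ (rden t) \<^bold>+ rpos t \<^bold>* Succ (rden s))
     (rneg s \<^bold>* Succ (rden t) \<^bold>+ rneg t \<^bold>* Succ (rden s)) (Succ (rden s) \<^bold>* rden t \<^bold>+ rden s)"

lemma clean_mkrat [simp]: "clean NatT p \<Longrightarrow> clean NatT q \<Longrightarrow> clean NatT r \<Longrightarrow> clean RatT (mkrat p q r)"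
  by (auto simp: mkrat_def clean_def simp del: clean_has_type)
lemma typed_mkrat [simp]: "typed p NatT \<Longrightarrow> typed q NatT \<Longrightarrow> typed r NatT \<Longrightarrow> typed (mkrat p q r) RatT"
  by (auto simp: mkrat_def)
lemma clean_rat_ops [simp]:
  "clean RatT s \<Longrightarrow> clean RatT (neg_tm s)" "clean RatT s \<Longrightarrow> clean RatT t \<Longrightarrow> clean RatT (add_tm s t)"
  by (simp_all add: neg_tm_def add_tm_def)
lemma typed_nat_ops [simp]:
  "typed s NatT \<Longrightarrow> typed t NatT \<Longrightarrow> typed (s \<^bold>+ t) NatT"
  "typed s NatT \<Longrightarrow> typed t NatT \<Longrightarrow> typed (s \<^bold>* t) NatT" by auto
lemma typed_rat_ops [simp]:
  "typed s RatT \<Longrightarrow> typed (neg_tm s) RatT" "typed s RatT \<Longrightarrow> typed t RatT \<Longrightarrow> typed (add_tm s t) RatT"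
  by (simp_all del: has_type_simps add: neg_tm_def add_tm_def)
lemma subst_rat_ops [simp]:
  "subst_tm v u (mkrat p q r) = mkrat (subst_tm v u p) (subst_tm v u q) (subst_tm v u r)"
  "subst_tm v u (neg_tm s) = neg_tm (subst_tm v u s)"
  "subst_tm v u (add_tm s t) = add_tm (subst_tm v u s) (subst_tm v u t)"
  by (simp_all add: neg_tm_def add_tm_def mkrat_def)
lemma fv_rat_ops [simp]:
  "fv_tm (rpos s) = fv_tm s" "fv_tm (rneg s) = fv_tm s" "fv_tm (rden s) = fv_tm s"
  "fv_tm (mkrat p q r) = fv_tm p \<union> fv_tm q \<union> fv_tm r"
  "fv_tm (neg_tm s) = fv_tm s" "fv_tm (add_tm s t) = fv_tm s \<union> fv_tm t"
  by (auto simp: neg_tm_def add_tm_def mkrat_def rpos_def rneg_def rden_def)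

lemma rat_val_mkrat:
  assumes p: "clean NatT p" and q: "clean NatT q" and r: "clean NatT r"
  shows "rat_val (rat_of (mkrat p q r)) = fraction (nq p) (nq q) (nq r + 1)"
proof -
  let ?R = "ProdT NatT NatT"
  let ?qr = "Const (CPair NatT NatT) \<cdot> q \<cdot> r"
  have qr: "clean ?R ?qr" using q r by (auto simp: clean_def simp del: clean_has_type)
  let ?t = "Const (CPair NatT ?R) \<cdot> p \<cdot> ?qr"
  have t: "clean RatT ?t" using p qr by (auto simp: clean_def simp del: clean_has_type)
  have okS: "clean ?R (Const (CSnd NatT ?R) \<cdot> ?t)" using t by (auto simp: clean_def simp del: clean_has_type)
  have S: "{} \<tturnstile> Eq ?R (Const (CSnd NatT ?R) \<cdot> ?t) ?qr"
    by (intro entails_axiom snd_pair clean_typed p qr)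
  have "{} \<tturnstile> rpos ?t \<doteq> p" unfolding rpos_def
    by (intro entails_axiom fst_pair clean_typed p qr)
  moreover have "{} \<tturnstile> rneg ?t \<doteq> q" unfolding rneg_def
  proof (rule entails_trans)
    show "{} \<tturnstile> Const (CFst NatT NatT) \<cdot> (Const (CSnd NatT ?R) \<cdot> ?t) \<doteq> Const (CFst NatT NatT) \<cdot> ?qr"
      by (rule entails_cong_arg[OF S]) (use okS qr in \<open>simp_all add: clean_Const\<close>)
    show "{} \<tturnstile> Const (CFst NatT NatT) \<cdot> ?qr \<doteq> q"
      by (intro entails_axiom fst_pair clean_typed q r)
  qed (use okS qr q in \<open>auto simp: clean_def simp del: clean_has_type\<close>)
  moreover have "{} \<tturnstile> rden ?t \<doteq> r" unfolding rden_def
  proof (rule entails_trans)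
    show "{} \<tturnstile> Const (CSnd NatT NatT) \<cdot> (Const (CSnd NatT ?R) \<cdot> ?t) \<doteq> Const (CSnd NatT NatT) \<cdot> ?qr"
      by (rule entails_cong_arg[OF S]) (use okS qr in \<open>simp_all add: clean_Const\<close>)
    show "{} \<tturnstile> Const (CSnd NatT NatT) \<cdot> ?qr \<doteq> r"
      by (intro entails_axiom snd_pair clean_typed q r)
  qed (use okS qr r in \<open>auto simp: clean_def simp del: clean_has_type\<close>)
  ultimately have "nq (rpos ?t) = nq p" "nq (rneg ?t) = nq q" "nq (rden ?t) = nq r"
    using t p q r by (simp_all add: nq_eq_iff nateq_def)
  then show ?thesis using t by (simp add: mkrat_def rat_of_parts nq_simps)
qed

lemma rat_val_neg_tm: "clean RatT s \<Longrightarrow> rat_val (rat_of (neg_tm s)) = - rat_val (rat_of s)"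
  by (simp add: neg_tm_def rat_val_mkrat) (simp add: rat_of_parts nq_simps fraction_uminus)

lemma rat_val_add_tm: "clean RatT s \<Longrightarrow> clean RatT t \<Longrightarrow> rat_val (rat_of (add_tm s t)) = rat_val (rat_of s) + rat_val (rat_of t)"
  by (simp add: add_tm_def rat_val_mkrat) (simp add: rat_of_parts nq_simps fraction_add algebra_simps)

text \<open>
  Every term of type \<open>RatT\<close> in one free variable of type \<open>NatT\<close> is the general term of a sequence.
\<close>

lemma sequence_exists:
  assumes "typed t RatT" and "\<And>w. w \<in> fv_tm t \<Longrightarrow> w \<noteq> (''n'', NatT) \<Longrightarrow> fst w \<notin> bound_names"
    and okt: "\<And>s. clean NatT s \<Longrightarrow> clean RatT (subst_tm (''n'', NatT) s t)"
  obtains x where "clean RatSeqT x" "\<And>s. clean NatT s \<Longrightarrow> seq_val x (nq s) = rat_val (rat_of (subst_tm (''n'', NatT) s t))"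
proof -
  from abstraction[OF assms(1,2)] obtain x where x: "clean RatSeqT x"
    "\<And>s. clean NatT s \<Longrightarrow> {} \<tturnstile> Eq RatT (x \<cdot> s) (subst_tm (''n'', NatT) s t)" by blast
  have "seq_val x (nq s) = rat_val (rat_of (subst_tm (''n'', NatT) s t))" if s: "clean NatT s" for s
    using rat_val_cong(4)[OF x(2)[OF s]] okt[OF s] x(1) s by (simp add: seq_val_nq)
  with x(1) show ?thesis by (rule that)
qed

lemma clean_fv: "clean \<tau> t \<Longrightarrow> w \<in> fv_tm t \<Longrightarrow> fst w \<notin> bound_names" by (simp add: clean_def del: clean_has_type)

section \<open>Reflection in b\<close>

text \<open>
  The terms of \<open>2b - a\<close> are taken at index \<open>5n\<close>.  Index \<open>3n\<close> would make the sequence regular; with \<open>5n\<close>, a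
  witness \<open>n\<close> of \<open>a < 2b - a\<close> also makes \<open>5n\<close> a witness of \<open>a < b\<close>.
\<close>

definition quint :: "natq \<Rightarrow> natq" where "quint n = n + n + n + n + n"

lemma quint_double: "quint (n + n) = quint n + quint n"
  by (simp add: quint_def ac_simps)

lemma positive_quint [simp]: "positive n \<Longrightarrow> positive (quint n)"
  by (simp add: quint_def)

lemma recip_quint:
  "positive d \<Longrightarrow> recip d = recip (quint d) + recip (quint d) + recip (quint d) + recip (quint d) + recip (quint d)"
  unfolding quint_def by (rule recip_quintuple)

lemma reflection_exists:
  assumes a: "clean RatSeqT a" and b: "clean RatSeqT b"
  obtains x where "clean RatSeqT x"
    "\<And>n. seq_val x n = seq_val b (quint n) + seq_val b (quint n) - seq_val a (quint n)"
proof -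
  let ?i = "\<lambda>n. n \<^bold>+ n \<^bold>+ n \<^bold>+ n \<^bold>+ n"
  let ?t = "\<lambda>n. add_tm (add_tm (b \<cdot> ?i n) (b \<cdot> ?i n)) (neg_tm (a \<cdot> ?i n))"
  obtain x where x: "clean RatSeqT x"
    "\<And>s. clean NatT s \<Longrightarrow> seq_val x (nq s) = rat_val (rat_of (subst_tm (''n'', NatT) s (?t nvar)))"
    by (rule sequence_exists[of "?t nvar"]) (use a b in \<open>auto simp: clean_fv\<close>)
  have "seq_val x n = seq_val b (quint n) + seq_val b (quint n) - seq_val a (quint n)" for n
  proof -
    obtain s where s: "clean NatT s" "n = nq s" by (rule natq_cases)
    have i: "nq (?i s) = quint n" "clean NatT (?i s)" using s by (simp_all add: quint_def nq_simps)
    show ?thesis using x(2)[OF s(1)] s(1) a b i(2) seq_val_nq[OF a i(2)] seq_val_nq[OF b i(2)]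
      by (simp add: rat_val_add_tm rat_val_neg_tm i(1) flip: s(2))
  qed
  with x(1) show ?thesis by (rule that)
qed

lemma is_realD:
  assumes "\<Gamma> \<tturnstile> is_real x" "clean RatSeqT x" "positive m" "positive n"
  shows "nonneg \<Gamma> (recip m + recip n - (seq_val x m - seq_val x n))" "nonneg \<Gamma> (recip m + recip n + (seq_val x m - seq_val x n))"
  using assms by (simp_all add: is_real_iff)

text \<open>
  Two copies of \<open>b\<close> and one of \<open>a\<close> contribute three errors \<open>1/(5m) + 1/(5n)\<close>, within the allowed five.
\<close>

lemma reflection_real:
  assumes a: "clean RatSeqT a" and b: "clean RatSeqT b" and ra: "\<Gamma> \<tturnstile> is_real a" and rb: "\<Gamma> \<tturnstile> is_real b"
    and x: "clean RatSeqT x" "\<And>n. seq_val x n = seq_val b (quint n) + seq_val b (quint n) - seq_val a (quint n)"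
  shows "\<Gamma> \<tturnstile> is_real x"
  unfolding is_real_iff[OF x(1)]
proof (intro allI impI conjI)
  fix m n assume m: "positive m" and n: "positive n"
  let ?M = "quint m" and ?N = "quint n"
  have M: "positive ?M" and N: "positive ?N" using m n by simp_all
  note A = is_realD[OF ra a M N] and B = is_realD[OF rb b M N]
  let ?s = "recip ?M + recip ?M + (recip ?N + recip ?N)"
  have s: "nonneg \<Gamma> ?s" by (intro nonneg_add nonneg_recip M N)
  have "nonneg \<Gamma> ((recip ?M + recip ?N - (seq_val b ?M - seq_val b ?N)) + (recip ?M + recip ?N - (seq_val b ?M - seq_val b ?N))
     + (recip ?M + recip ?N + (seq_val a ?M - seq_val a ?N)) + ?s)"
    by (intro nonneg_add A B s)
  then show "nonneg \<Gamma> (recip m + recip n - (seq_val x m - seq_val x n))"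
    unfolding x(2) recip_quint[OF m] recip_quint[OF n] by (simp add: algebra_simps)
  have "nonneg \<Gamma> ((recip ?M + recip ?N + (seq_val b ?M - seq_val b ?N)) + (recip ?M + recip ?N + (seq_val b ?M - seq_val b ?N))
     + (recip ?M + recip ?N - (seq_val a ?M - seq_val a ?N)) + ?s)"
    by (intro nonneg_add A B s)
  then show "nonneg \<Gamma> (recip m + recip n + (seq_val x m - seq_val x n))"
    unfolding x(2) recip_quint[OF m] recip_quint[OF n] by (simp add: algebra_simps)
qed

text \<open>
  \<open>a \<le> b\<close> and \<open>2b - a \<le> b\<close>, that is \<open>b \<le> a\<close>, bound \<open>b\<^sub>n - a\<^sub>n\<close> from both sides: compare with the terms at
  a large index and let that index grow, by the Archimedean property.
\<close>

lemma reflection_le_imp_eq: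
  assumes a: "clean RatSeqT a" and b: "clean RatSeqT b" and ra: "\<Gamma> \<tturnstile> is_real a" and rb: "\<Gamma> \<tturnstile> is_real b"
    and x: "clean RatSeqT x" "\<And>n. seq_val x n = seq_val b (quint n) + seq_val b (quint n) - seq_val a (quint n)"
    and ab: "\<Gamma> \<tturnstile> a \<le>\<^sub>R b" and xb: "\<Gamma> \<tturnstile> x \<le>\<^sub>R b"
  shows "\<Gamma> \<tturnstile> a =\<^sub>R b"
  unfolding real_eq_iff[OF a b]
proof (intro allI impI conjI)
  fix n assume n: "positive n"
  note A = is_realD[OF ra a] and B = is_realD[OF rb b]
  show "nonneg \<Gamma> (recip n + recip n - (seq_val a n - seq_val b n))"
  proof (rule archimedean)
    fix N assume N: "positive N"
    \<comment> \<open>At index \<open>4N\<close> the errors are \<open>1/(2N)\<close> from \<open>a \<le> b\<close> and \<open>1/(4N)\<close> from each of the two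
      regularity estimates; they add up to exactly \<open>1/N\<close>.\<close>
    let ?M = "N + N" let ?L = "?M + ?M"
    have M: "positive ?M" and L: "positive ?L" using N by simp_all
    have h: "nonneg \<Gamma> (seq_val b ?L - seq_val a ?L + recip ?M)" using ab M by (simp add: real_le_iff a b)
    have "nonneg \<Gamma> ((seq_val b ?L - seq_val a ?L + recip ?M) + (recip n + recip ?L - (seq_val a n - seq_val a ?L))
        + (recip n + recip ?L + (seq_val b n - seq_val b ?L)))"
      by (intro nonneg_add h A B n L)
    moreover have "recip N = recip ?M + (recip ?L + recip ?L)"
      using recip_double[OF N] recip_double[OF M] by simp
    ultimately show "nonneg \<Gamma> (recip n + recip n - (seq_val a n - seq_val b n) + recip N)"
      by (simp add: algebra_simps)
  qed
  show "nonneg \<Gamma> (recip n + recip n + (seq_val a n - seq_val b n))"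
  proof (rule archimedean)
    fix N assume N: "positive N"
    define M where "M = N + N"
    define L where "L = M + M"
    define K where "K = quint L"
    \<comment> \<open>In units of \<open>e = 1/(20N)\<close> the errors add up to \<open>18e\<close>, which is below \<open>1/N = 20e\<close>.\<close>
    define e where "e = recip K"
    have M: "positive M" and L: "positive L" and K: "positive K" using N by (simp_all add: M_def L_def K_def)
    have h: "nonneg \<Gamma> (seq_val b L - seq_val x L + recip M)" using xb M by (simp add: real_le_iff x(1) b L_def)
    have "nonneg \<Gamma> ((seq_val b L - seq_val x L + recip M) + (recip n + recip K - (seq_val b n - seq_val b K))
        + (recip n + recip K + (seq_val a n - seq_val a K)) + (recip L + recip K - (seq_val b L - seq_val b K)) + (recip K + recip K))"
      by (intro nonneg_add h A B n K L nonneg_recip)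
    moreover have L': "recip L = e + e + e + e + e" unfolding e_def K_def by (rule recip_quint[OF L])
    moreover have M': "recip M = recip L + recip L" unfolding L_def by (rule recip_double[OF M])
    moreover have "recip N = recip M + recip M" unfolding M_def by (rule recip_double[OF N])
    ultimately show "nonneg \<Gamma> (recip n + recip n + (seq_val a n - seq_val b n) + recip N)"
      by (simp add: x(2) algebra_simps flip: K_def e_def)
  qed
qed

text \<open>
  If the difference of \<open>2b - a\<close> and \<open>a\<close> exceeds \<open>1/n\<close> at index \<open>2n\<close>, then that of \<open>b\<close> and \<open>a\<close> exceeds \<open>1/(5n)\<close>
  at index \<open>10n\<close>.
\<close>

lemma less_reflection_imp_less:
  assumes a: "clean RatSeqT a" and b: "clean RatSeqT b" and ra: "\<Gamma> \<tturnstile> is_real a"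
    and x: "clean RatSeqT x" "\<And>n. seq_val x n = seq_val b (quint n) + seq_val b (quint n) - seq_val a (quint n)"
    and ax: "\<Gamma> \<tturnstile> a <\<^sub>R x"
  shows "\<Gamma> \<tturnstile> a <\<^sub>R b"
proof (rule real_lessE[OF ax a x(1)])
  fix \<Delta> n assume "\<Gamma> \<subseteq> \<Delta>" and n: "positive n"
    and gap: "\<And>\<Theta>. \<Delta> \<subseteq> \<Theta> \<Longrightarrow> nonneg \<Theta> (recip n - (seq_val x (n + n) - seq_val a (n + n))) \<Longrightarrow> \<Theta> \<tturnstile> Falsum"
  define m where "m = quint n"
  show "\<Delta> \<tturnstile> a <\<^sub>R b"
  proof (rule real_lessI[OF a b])
    show m: "positive m" using n by (simp add: m_def)
    fix \<Theta> assume "\<Delta> \<subseteq> \<Theta>" and h: "nonneg \<Theta> (recip m - (seq_val b (m + m) - seq_val a (m + m)))"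
    have L: "positive (n + n)" and K: "positive (m + m)" using n m by simp_all
    have ra': "\<Theta> \<tturnstile> is_real a" using ra \<open>\<Gamma> \<subseteq> \<Delta>\<close> \<open>\<Delta> \<subseteq> \<Theta>\<close> by (blast intro: entails_mono)
    have K_quint: "quint (n + n) = m + m" by (simp add: m_def quint_double)
    \<comment> \<open>In units of \<open>e = 1/(10n)\<close>: the assumption, used twice, contributes \<open>2e + 2e\<close> and the regularity
      of \<open>a\<close> contributes \<open>5e + e\<close>, which together is \<open>10e = 1/n\<close>.\<close>
    let ?e = "recip (m + m)"
    have "nonneg \<Theta> ((recip m - (seq_val b (m + m) - seq_val a (m + m))) + (recip m - (seq_val b (m + m) - seq_val a (m + m)))
        + (recip (n + n) + recip (m + m) + (seq_val a (n + n) - seq_val a (m + m))))"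
      by (intro nonneg_add h is_realD[OF ra' a L K])
    moreover have "recip m = ?e + ?e" by (rule recip_double[OF m])
    moreover have "recip (n + n) = ?e + ?e + ?e + ?e + ?e" using recip_quint[OF L] by (simp only: K_quint)
    moreover have "recip n = recip (n + n) + recip (n + n)" by (rule recip_double[OF n])
    ultimately have "nonneg \<Theta> (recip n - (seq_val x (n + n) - seq_val a (n + n)))"
      by (simp add: x(2) K_quint algebra_simps)
    with \<open>\<Delta> \<subseteq> \<Theta>\<close> show "\<Theta> \<tturnstile> Falsum" by (rule gap)
  qed
qed

lemma real_less_irrefl:
  assumes "\<Gamma> \<tturnstile> a <\<^sub>R a" "clean RatSeqT a" shows "\<Gamma> \<tturnstile> Falsum"
  by (rule real_lessE[OF assms(1,2,2)]) simp

section \<open>Weighted sums of a binary sequence\<close>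

definition fun_val :: "tm \<Rightarrow> natq \<Rightarrow> natq" where "fun_val f n = nq (f \<cdot> (SOME t. clean NatT t \<and> nq t = n))"

lemma clean_fun_app [simp]: "clean (NatT \<rightarrow> NatT) f \<Longrightarrow> clean NatT t \<Longrightarrow> clean NatT (f \<cdot> t)" by (rule clean_App)

lemma fun_val_nq:
  assumes f: "clean (NatT \<rightarrow> NatT) f" and t: "clean NatT t"
  shows "fun_val f (nq t) = nq (f \<cdot> t)"
proof -
  let ?s = "SOME s. clean NatT s \<and> nq s = nq t"
  have s: "clean NatT ?s" "nq ?s = nq t" using someI[of "\<lambda>s. clean NatT s \<and> nq s = nq t" t] t by auto
  then have "nateq {} ?s t" using t by (simp add: nq_eq_iff)
  then show ?thesis unfolding fun_val_def using s t f by (simp add: nq_eq_iff nateq_app)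
qed

text \<open>
  The summand \<open>\<alpha>\<^sub>j / (j (j + 1))\<close> for \<open>j = k + 1\<close>; the sequence \<open>\<alpha>\<close> is only specified at positive indices.
\<close>

definition weight :: "tm \<Rightarrow> natq \<Rightarrow> ratq" where
  "weight f k = fraction (fun_val f (k + 1)) 0 ((k + 1) * (k + 1 + 1))"

text \<open>
  The recursor needs a step function of two arguments.  Bracket abstraction over a pair provides an uncurried
  one, and a combinator then curries it.
\<close>

lemma weighted_sums_exist:
  assumes f: "clean (NatT \<rightarrow> NatT) f"
  obtains z where "clean RatSeqT z" "seq_val z 0 = 0" "\<And>k. seq_val z (k + 1) = seq_val z k + weight f k"
proof -
  let ?P = "ProdT NatT RatT"
  let ?fst = "\<lambda>p. Const (CFst NatT RatT) \<cdot> p" and ?snd = "\<lambda>p. Const (CSnd NatT RatT) \<cdot> p"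
  let ?w = "\<lambda>k. mkrat (f \<cdot> Succ k) Zero (Succ k \<^bold>* Succ k \<^bold>+ k)"
  let ?t = "\<lambda>p. add_tm (?snd p) (?w (?fst p))"
  let ?v = "Var (''n'', ?P)"
  have tyfs: "typed (?fst ?v) NatT" "typed (?snd ?v) RatT" by auto
  have "typed (f \<cdot> Succ (?fst ?v)) NatT" using f by (auto simp: clean_def simp del: clean_has_type)
  then have ty: "typed (?t ?v) RatT" using tyfs by (simp del: has_type_simps)
  obtain F where F: "clean (?P \<rightarrow> RatT) F"
    "\<And>p. clean ?P p \<Longrightarrow> {} \<tturnstile> Eq RatT (F \<cdot> p) (subst_tm (''n'', ?P) p (?t ?v))"
    using abstraction[OF ty, of "''n''" ?P] f by (auto simp: clean_fv)
  let ?pair = "Const (CPair NatT RatT)"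
  \<comment> \<open>\<open>?h\<close> is the curried form of \<open>F\<close>: \<open>S (K (S (K F))) pair\<close> maps \<open>k\<close> and \<open>r\<close> to \<open>F (pair k r)\<close>.\<close>
  let ?KF = "Const (CK (?P \<rightarrow> RatT) RatT) \<cdot> F"
  let ?SKF = "Const (CS RatT ?P RatT) \<cdot> ?KF"
  let ?h = "Const (CS NatT (RatT \<rightarrow> ?P) (RatT \<rightarrow> RatT)) \<cdot> (Const (CK ((RatT \<rightarrow> ?P) \<rightarrow> RatT \<rightarrow> RatT) NatT) \<cdot> ?SKF) \<cdot> ?pair"
  let ?Z = "Const (CRec RatT) \<cdot> mkrat Zero Zero Zero \<cdot> ?h"
  have KF: "clean (RatT \<rightarrow> ?P \<rightarrow> RatT) ?KF" using F(1) by (auto simp: clean_def simp del: clean_has_type)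
  have SKF: "clean ((RatT \<rightarrow> ?P) \<rightarrow> RatT \<rightarrow> RatT) ?SKF"
    using KF by (auto simp: clean_def simp del: clean_has_type)
  have pair: "clean (NatT \<rightarrow> RatT \<rightarrow> ?P) ?pair" by (simp add: clean_Const)
  have h: "clean (NatT \<rightarrow> RatT \<rightarrow> RatT) ?h"
    using SKF by (auto simp: clean_def simp del: clean_has_type)
  have Z: "clean RatSeqT ?Z"
  proof (rule clean_App[OF clean_App h])
    show "clean (RatT \<rightarrow> (NatT \<rightarrow> RatT \<rightarrow> RatT) \<rightarrow> RatSeqT) (Const (CRec RatT))"
      by (simp add: clean_Const)
  qed simp
  have h_app: "{} \<tturnstile> Eq RatT (?h \<cdot> k \<cdot> r) (F \<cdot> (?pair \<cdot> k \<cdot> r))" if k: "clean NatT k" and r: "clean RatT r" for k r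
  proof -
    let ?T = "RatT \<rightarrow> RatT"
    let ?K = "Const (CK ((RatT \<rightarrow> ?P) \<rightarrow> RatT \<rightarrow> RatT) NatT) \<cdot> ?SKF"
    have K: "clean (NatT \<rightarrow> (RatT \<rightarrow> ?P) \<rightarrow> ?T) ?K" using SKF by (auto simp: clean_def simp del: clean_has_type)
    have 1: "{} \<tturnstile> Eq ?T (?h \<cdot> k) (?K \<cdot> k \<cdot> (?pair \<cdot> k))"
      by (intro entails_axiom comb_S clean_typed K pair k)
    have 2: "{} \<tturnstile> Eq ((RatT \<rightarrow> ?P) \<rightarrow> ?T) (?K \<cdot> k) ?SKF"
      by (intro entails_axiom comb_K clean_typed SKF k)
    have oks: "clean ?T (?h \<cdot> k)" "clean (RatT \<rightarrow> ?P) (?pair \<cdot> k)" "clean ((RatT \<rightarrow> ?P) \<rightarrow> ?T) (?K \<cdot> k)"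
      "clean ?P (?pair \<cdot> k \<cdot> r)" "clean (?P \<rightarrow> RatT) (?KF \<cdot> r)"
      by (rule clean_App[OF h k] clean_App[OF pair k] clean_App[OF K k] clean_App[OF clean_App[OF pair k] r] clean_App[OF KF r])+
    have 3: "{} \<tturnstile> Eq ?T (?h \<cdot> k) (?SKF \<cdot> (?pair \<cdot> k))"
      by (rule entails_trans[OF 1 entails_cong_fun[OF 2]]) (rule oks SKF clean_App[OF oks(3,2)] clean_App[OF SKF oks(2)])+
    have 4: "{} \<tturnstile> Eq RatT (?h \<cdot> k \<cdot> r) (?SKF \<cdot> (?pair \<cdot> k) \<cdot> r)"
      by (rule entails_cong_fun[OF 3 r oks(1) clean_App[OF SKF oks(2)]])
    have 5: "{} \<tturnstile> Eq RatT (?SKF \<cdot> (?pair \<cdot> k) \<cdot> r) (?KF \<cdot> r \<cdot> (?pair \<cdot> k \<cdot> r))"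
      by (intro entails_axiom comb_S clean_typed KF oks r)
    have 6: "{} \<tturnstile> Eq (?P \<rightarrow> RatT) (?KF \<cdot> r) F"
      by (intro entails_axiom comb_K clean_typed F(1) r)
    have 7: "{} \<tturnstile> Eq RatT (?KF \<cdot> r \<cdot> (?pair \<cdot> k \<cdot> r)) (F \<cdot> (?pair \<cdot> k \<cdot> r))"
      by (rule entails_cong_fun[OF 6 oks(4,5) F(1)])
    show ?thesis
      by (rule entails_trans[OF 4 entails_trans[OF 5 7]])
         (rule clean_App[OF oks(1) r] clean_App[OF clean_App[OF SKF oks(2)] r] clean_App[OF oks(5,4)] clean_App[OF F(1) oks(4)])+
  qed
  have "seq_val ?Z 0 = 0"
  proof -
    have "{} \<tturnstile> Eq RatT (?Z \<cdot> Zero) (mkrat Zero Zero Zero)"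
      by (intro entails_axiom rec_zero clean_typed clean_mkrat clean_nat h)
    then have "rat_val (rat_of (?Z \<cdot> Zero)) = rat_val (rat_of (mkrat Zero Zero Zero))"
      by (rule rat_val_cong) (use Z in simp_all)
    then show ?thesis using seq_val_nq[OF Z, of Zero] by (simp add: nq_simps rat_val_mkrat fraction_zero)
  qed
  moreover have "seq_val ?Z (k + 1) = seq_val ?Z k + weight f k" for k
  proof -
    obtain s where s: "clean NatT s" "k = nq s" by (rule natq_cases)
    let ?p = "?pair \<cdot> s \<cdot> (?Z \<cdot> s)"
    have Zs: "clean RatT (?Z \<cdot> s)" and ZS: "clean RatT (?Z \<cdot> Succ s)" using Z s by simp_all
    have p: "clean ?P ?p" by (rule clean_App[OF clean_App[OF pair s(1)] Zs])
    have fs: "clean NatT (?fst ?p)" and sn: "clean RatT (?snd ?p)" using p by (auto simp: clean_def simp del: clean_has_type)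
    have "{} \<tturnstile> Eq RatT (?Z \<cdot> Succ s) (?h \<cdot> s \<cdot> (?Z \<cdot> s))"
      by (intro entails_axiom rec_succ clean_typed clean_mkrat clean_nat h s)
    then have "rat_val (rat_of (?Z \<cdot> Succ s)) = rat_val (rat_of (?h \<cdot> s \<cdot> (?Z \<cdot> s)))"
      by (rule rat_val_cong) (rule ZS clean_App[OF clean_App[OF h s(1)] Zs])+
    also have "\<dots> = rat_val (rat_of (F \<cdot> ?p))"
      by (rule rat_val_cong[OF h_app[OF s(1) Zs]]) (rule clean_App[OF clean_App[OF h s(1)] Zs] clean_App[OF F(1) p])+
    also have "\<dots> = rat_val (rat_of (?t ?p))"
    proof (rule rat_val_cong)
      show "{} \<tturnstile> Eq RatT (F \<cdot> ?p) (?t ?p)" using F(2)[OF p] f by simp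
    qed (use clean_App[OF F(1) p] fs sn f in simp_all)
    also have "\<dots> = rat_val (rat_of (?snd ?p)) + rat_val (rat_of (?w (?fst ?p)))"
      using fs sn f by (intro rat_val_add_tm) simp_all
    also have "rat_val (rat_of (?snd ?p)) = rat_val (rat_of (?Z \<cdot> s))"
      by (rule rat_val_cong[OF entails_axiom[OF snd_pair]]) (rule clean_typed s Zs sn)+
    also have "rat_val (rat_of (?w (?fst ?p))) = weight f k"
    proof -
      have "{} \<tturnstile> ?fst ?p \<doteq> s" by (rule entails_axiom[OF fst_pair]) (rule clean_typed s Zs)+
      then have eq: "nq (?fst ?p) = k" using fs s by (simp add: nq_eq_iff nateq_def)
      have "nq (f \<cdot> Succ (?fst ?p)) = fun_val f (k + 1)"
        using fun_val_nq[OF f, of "Succ (?fst ?p)"] fs eq by (simp add: nq_simps)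
      then show ?thesis using fs f eq by (simp add: rat_val_mkrat weight_def nq_simps algebra_simps)
    qed
    finally show ?thesis using seq_val_nq[OF Z, of "Succ s"] seq_val_nq[OF Z s(1)] s by (simp add: nq_simps)
  qed
  ultimately show ?thesis by (rule that[OF Z])
qed

text \<open>
  Object-level induction on the distance of \<open>m\<close> and \<open>n\<close>.
\<close>

lemma mono_sequence:
  assumes g: "clean RatSeqT g" and step: "\<And>\<Delta> k. \<Gamma> \<subseteq> \<Delta> \<Longrightarrow> nonneg \<Delta> (seq_val g (k + 1) - seq_val g k)"
    and "leN \<Gamma> m n"
  shows "nonneg \<Gamma> (seq_val g n - seq_val g m)"
proof (rule leN_E[OF assms(3) sentence_nonneg])
  fix \<Delta> k assume \<Delta>: "\<Gamma> \<subseteq> \<Delta>" and k: "eqN \<Delta> (m + k) n"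
  obtain s where s: "clean NatT s" "m = nq s" by (rule natq_cases)
  obtain t where t: "clean NatT t" "k = nq t" by (rule natq_cases)
  let ?A = "rat_le (rat_of (g \<cdot> s)) (rat_of (g \<cdot> (s \<^bold>+ nvar)))"
  have A: "(\<Theta> \<tturnstile> subst (''n'', NatT) t ?A) \<longleftrightarrow> nonneg \<Theta> (seq_val g (m + nq t) - seq_val g m)"
    if "clean NatT t" for t \<Theta>
    using that s g seq_val_nq[OF g s(1)] seq_val_nq[OF g, of "s \<^bold>+ t"] by (simp add: entails_rat_le nq_simps)
  have "\<Delta> \<tturnstile> subst (''n'', NatT) t ?A"
  proof (rule entails_induct[OF _ t(1)])
    show "wff ?A" using g s typed_seq_app[OF g clean_typed[OF s(1)]] by simp
    show "\<Delta> \<tturnstile> subst (''n'', NatT) Zero ?A" by (simp only: A clean_nat) (simp add: nq_simps)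
  next
    fix \<Theta> u assume "\<Delta> \<subseteq> \<Theta>" and u: "clean NatT u" and "\<Theta> \<tturnstile> subst (''n'', NatT) u ?A"
    then have "nonneg \<Theta> ((seq_val g (m + nq u + 1) - seq_val g (m + nq u)) + (seq_val g (m + nq u) - seq_val g m))"
      using \<Delta> by (intro nonneg_add step) (auto simp only: A)
    then show "\<Theta> \<tturnstile> subst (''n'', NatT) (Succ u) ?A"
      using u by (simp only: A clean_nat) (simp add: nq_simps ac_simps)
  qed
  then have "nonneg \<Delta> (seq_val g (m + k) - seq_val g m)" using A t by simp
  then have "nonneg \<Delta> ((seq_val g (m + k) - seq_val g m) + (seq_val g n - seq_val g (m + k)))"
    by (rule nonneg_add) (rule seq_val_cong[OF g eqN_sym[OF k]])
  then show "nonneg \<Delta> (seq_val g n - seq_val g m)" by simp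
qed

definition binary :: "tm \<Rightarrow> fm" where
  "binary f = all_pos ''n'' (\<lambda>n. f \<cdot> n \<doteq> Zero \<^bold>\<or> f \<cdot> n \<doteq> One)"
definition vanishes :: "tm \<Rightarrow> fm" where
  "vanishes f = all_pos ''n'' (\<lambda>n. f \<cdot> n \<doteq> Zero)"
text \<open>
  Together with the two definitions above, this is the body of LPO for the sequence \<open>f\<close>.
\<close>

definition hits :: "tm \<Rightarrow> fm" where
  "hits f = ex_pos ''n'' (\<lambda>n. f \<cdot> n \<doteq> One)"

lemma wff_binary [simp]: "typed f (NatT \<rightarrow> NatT) \<Longrightarrow> wff (binary f)"
  by (auto simp: binary_def)
lemma wff_vanishes [simp]: "typed f (NatT \<rightarrow> NatT) \<Longrightarrow> wff (vanishes f)"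
  by (auto simp: vanishes_def)
lemma wff_hits [simp]: "typed f (NatT \<rightarrow> NatT) \<Longrightarrow> wff (hits f)"
  by (auto simp: hits_def)

lemma binary_cases:
  assumes f: "clean (NatT \<rightarrow> NatT) f" and bin: "\<Gamma> \<tturnstile> binary f" and P: "sentence P" 
    and 0: "\<And>\<Delta>. \<Gamma> \<subseteq> \<Delta> \<Longrightarrow> eqN \<Delta> (fun_val f (k + 1)) 0 \<Longrightarrow> P \<Delta>"
    and 1: "\<And>\<Delta>. \<Gamma> \<subseteq> \<Delta> \<Longrightarrow> eqN \<Delta> (fun_val f (k + 1)) 1 \<Longrightarrow> P \<Delta>"
  shows "P \<Gamma>"
proof -
  obtain C where C: "\<And>\<Gamma>. P \<Gamma> \<longleftrightarrow> (\<Gamma> \<tturnstile> C)" using P by (auto simp: sentence_def)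
  obtain t where t: "clean NatT t" "k = nq t" by (rule natq_cases)
  have fun_val: "fun_val f (k + 1) = nq (f \<cdot> Succ t)" using t f fun_val_nq[OF f, of "Succ t"] by (simp add: nq_simps)
  have eq: "eqN \<Delta> (fun_val f (k + 1)) 0 \<longleftrightarrow> (\<Delta> \<tturnstile> f \<cdot> Succ t \<doteq> Zero)"
    "eqN \<Delta> (fun_val f (k + 1)) 1 \<longleftrightarrow> (\<Delta> \<tturnstile> f \<cdot> Succ t \<doteq> One)" for \<Delta>
    unfolding fun_val using f t eqN_nq[of "f \<cdot> Succ t" Zero] eqN_nq[of "f \<cdot> Succ t" One]
    by (simp_all add: nq_simps)
  have "\<Gamma> \<tturnstile> f \<cdot> Succ t \<doteq> Zero \<^bold>\<or> f \<cdot> Succ t \<doteq> One"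
    using bin t(1) f unfolding binary_def by (subst (asm) all_pos_iff) auto
  then have "\<Gamma> \<tturnstile> C"
    by (rule entails_OrE) (use f t(1) 0[unfolded eq C] 1[unfolded eq C] in auto)
  then show ?thesis by (simp add: C)
qed

lemma hitsI:
  assumes f: "clean (NatT \<rightarrow> NatT) f" and "eqN \<Gamma> (fun_val f (k + 1)) 1" shows "\<Gamma> \<tturnstile> hits f"
proof -
  obtain t where t: "clean NatT t" "k = nq t" by (rule natq_cases)
  have "fun_val f (k + 1) = nq (f \<cdot> Succ t)" using t f fun_val_nq[OF f, of "Succ t"] by (simp add: nq_simps)
  then have "\<Gamma> \<tturnstile> f \<cdot> Succ t \<doteq> One"
    using assms t eqN_nq[of "f \<cdot> Succ t" One] by (simp add: nq_simps)
  then show ?thesis unfolding hits_def by (intro ex_posI[where t = t]) (use f t in auto)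
qed

lemma vanishesI:
  assumes f: "clean (NatT \<rightarrow> NatT) f" and "\<And>k. eqN \<Gamma> (fun_val f (k + 1)) 0" shows "\<Gamma> \<tturnstile> vanishes f"
proof -
  have "\<Gamma> \<tturnstile> f \<cdot> Succ t \<doteq> Zero" if t: "clean NatT t" for t
    using assms(2)[of "nq t"] t f fun_val_nq[OF f, of "Succ t"] eqN_nq[of "f \<cdot> Succ t" Zero]
    by (simp add: nq_simps)
  then show ?thesis unfolding vanishes_def by (subst all_pos_iff) (use f in auto)
qed

text \<open>
  The partial sums \<open>z\<close> of the weights of a sequence \<open>f\<close> that \<open>\<Gamma>\<close> proves to be binary.
\<close>

locale weighted_sum =
  fixes f z :: tm and \<Gamma> :: "fm set"
  assumes f: "clean (NatT \<rightarrow> NatT) f" and z: "clean RatSeqT z" and bin: "\<Gamma> \<tturnstile> binary f"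
    and z0: "seq_val z 0 = 0" and zS: "\<And>k. seq_val z (k + 1) = seq_val z k + weight f k"
begin

lemma weight_nonneg: "nonneg \<Delta> (weight f k)"
  by (simp add: weight_def nonneg_frc)

lemma weight_eq_recip: "recip (k + 1) - recip (k + 1 + 1) = fraction 1 0 ((k + 1) * (k + 1 + 1))"
  by (rule trans[OF recip_telescope recip_def]) simp

lemma weight_le:
  assumes "\<Gamma> \<subseteq> \<Delta>" shows "nonneg \<Delta> (recip (k + 1) - recip (k + 1 + 1) - weight f k)"
proof -
  have "leN \<Delta> (fun_val f (k + 1)) 1"
    by (rule binary_cases[OF f entails_mono[OF bin assms] sentence_leN, of k])
       (auto intro: leN_eqN leN_trans[OF leN_eqN])
  then show ?thesis unfolding weight_eq_recip weight_def by (rule fraction_mono) simp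
qed

lemma weight_hit: "eqN \<Delta> (fun_val f (k + 1)) 1 \<Longrightarrow> nonneg \<Delta> (weight f k - (recip (k + 1) - recip (k + 1 + 1)))"
  unfolding weight_eq_recip weight_def by (rule fraction_mono) (auto intro: leN_eqN eqN_sym)

lemma weight_miss: "eqN \<Delta> (fun_val f (k + 1)) 0 \<Longrightarrow> nonneg \<Delta> (- weight f k)"
  using fraction_mono[of \<Delta> "fun_val f (k + 1)" 0 "(k + 1) * (k + 1 + 1)"]
    fraction_eq_iff[of "(k + 1) * (k + 1 + 1)" 1 0 0 0 0]
  by (simp add: weight_def leN_eqN fraction_zero[symmetric])

lemma sum_mono: "leN \<Delta> m n \<Longrightarrow> nonneg \<Delta> (seq_val z n - seq_val z m)"
  by (rule mono_sequence[OF z]) (simp_all add: zS weight_nonneg)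

lemma sum_nonneg: "nonneg \<Delta> (seq_val z n)"
  using sum_mono[of \<Delta> 0 n] by (simp add: z0)

text \<open>
  \<open>z\<^sub>n + 1/(n + 1)\<close> is decreasing, because each weight is at most the telescoping difference
  \<open>1/(k + 1) - 1/(k + 2)\<close>.  The monotonicity lemma applies to the sequence of its negatives.
\<close>

lemma sum_tail:
  assumes "\<Gamma> \<subseteq> \<Delta>" and "leN \<Delta> m n"
  shows "nonneg \<Delta> (seq_val z m + recip (m + 1) - (seq_val z n + recip (n + 1)))"
proof -
  let ?t = "\<lambda>n. neg_tm (add_tm (z \<cdot> n) (mkrat One Zero n))"
  obtain g where g: "clean RatSeqT g"
    "\<And>s. clean NatT s \<Longrightarrow> seq_val g (nq s) = rat_val (rat_of (subst_tm (''n'', NatT) s (?t nvar)))"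
    by (rule sequence_exists[of "?t nvar"]) (use z in \<open>auto simp: clean_fv\<close>)
  have seq_val_g: "seq_val g n = - (seq_val z n + recip (n + 1))" for n
  proof -
    obtain s where s: "clean NatT s" "n = nq s" by (rule natq_cases)
    show ?thesis using g(2)[OF s(1)] s z seq_val_nq[OF z s(1)]
      by (simp add: rat_val_add_tm rat_val_neg_tm rat_val_mkrat recip_def nq_simps)
  qed
  have "nonneg \<Delta> (seq_val g n - seq_val g m)"
  proof (rule mono_sequence[OF g(1) _ assms(2)])
    fix \<Theta> k assume "\<Delta> \<subseteq> \<Theta>"
    then have "nonneg \<Theta> (recip (k + 1) - recip (k + 1 + 1) - weight f k)" using assms(1) by (intro weight_le) simp
    then show "nonneg \<Theta> (seq_val g (k + 1) - seq_val g k)"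
      unfolding seq_val_g zS by (simp add: algebra_simps)
  qed
  then show ?thesis by (simp add: seq_val_g algebra_simps)
qed

text \<open>
  The order of \<open>m\<close> and \<open>n\<close> is decidable.  If \<open>m \<le> n\<close> the difference \<open>z\<^sub>m - z\<^sub>n\<close> is not positive; otherwise it
  is a tail after \<open>n\<close> and so at most \<open>1/(n + 1)\<close>.
\<close>

lemma sum_diff_le:
  assumes m: "positive m" and n: "positive n" and \<Delta>: "\<Gamma> \<subseteq> \<Delta>"
  shows "nonneg \<Delta> (recip m + recip n - (seq_val z m - seq_val z n))"
proof (rule leN_cases[OF sentence_nonneg, of _ m n])
  fix \<Theta> assume "leN \<Theta> m n"
  then have "nonneg \<Theta> (recip m + recip n + (seq_val z n - seq_val z m))" by (intro nonneg_add nonneg_recip m n sum_mono)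
  then show "nonneg \<Theta> (recip m + recip n - (seq_val z m - seq_val z n))" by (simp add: algebra_simps)
next
  fix \<Theta> assume \<Theta>: "\<Delta> \<subseteq> \<Theta>" and "leN \<Theta> (n + 1) m"
  moreover have "leN \<Theta> n (n + 1)" by (rule leN_I[of _ _ 1]) simp
  ultimately have nm: "leN \<Theta> n m" by (blast intro: leN_trans)
  have "nonneg \<Theta> ((seq_val z n + recip (n + 1) - (seq_val z m + recip (m + 1))) + (recip n - recip (n + 1)) + recip (m + 1) + recip m)"
    using \<Delta> \<Theta> nm \<open>leN \<Theta> n (n + 1)\<close> by (intro nonneg_add sum_tail recip_antimono nonneg_recip m n) auto
  then show "nonneg \<Theta> (recip m + recip n - (seq_val z m - seq_val z n))" by (simp add: algebra_simps)
qed

lemma sum_real: "\<Gamma> \<tturnstile> is_real z"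
  unfolding is_real_iff[OF z]
proof (intro allI impI conjI)
  fix m n assume "positive m" "positive n"
  then show "nonneg \<Gamma> (recip m + recip n - (seq_val z m - seq_val z n))" by (simp add: sum_diff_le)
  show "nonneg \<Gamma> (recip m + recip n + (seq_val z m - seq_val z n))"
    using sum_diff_le[OF \<open>positive n\<close> \<open>positive m\<close> order_refl] by (simp add: algebra_simps)
qed

text \<open>
  Bounded search, by object-level induction on \<open>t\<close>: either the partial sum is still \<open>\<le> 0\<close>, or a hit has been found.
  The induction variable is named \<open>m\<close> because \<open>n\<close> is bound in \<open>hits\<close>.
\<close>

lemma sum_nonpos_or_hits:
  assumes "wff C" and t: "clean NatT t" and \<Delta>: "\<Gamma> \<subseteq> \<Delta>"
    and nonpos: "\<And>\<Theta>. \<Delta> \<subseteq> \<Theta> \<Longrightarrow> nonneg \<Theta> (- seq_val z (nq t)) \<Longrightarrow> \<Theta> \<tturnstile> C"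
    and hits: "\<And>\<Theta>. \<Delta> \<subseteq> \<Theta> \<Longrightarrow> \<Theta> \<tturnstile> hits f \<Longrightarrow> \<Theta> \<tturnstile> C"
  shows "\<Delta> \<tturnstile> C"
proof -
  let ?m = "Var (''m'', NatT)"
  let ?le = "\<lambda>t. rat_le (rat_of (z \<cdot> t)) (frac Zero One)"
  have le: "(\<Theta> \<tturnstile> ?le t) \<longleftrightarrow> nonneg \<Theta> (- seq_val z (nq t))" if "clean NatT t" for \<Theta> t
  proof -
    have "rat_val (frac Zero One) = 0" by (simp add: frac_def nq_simps fraction_zero)
    then show ?thesis using that z by (simp add: entails_rat_le seq_val_nq)
  qed
  have sub: "subst (''m'', NatT) t (?le ?m \<^bold>\<or> hits f) = (?le t \<^bold>\<or> hits f)" if "clean NatT t" for t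
    using that z f by (simp add: hits_def ex_pos_def subst_ex)
  have wff: "wff (?le t)" if "clean NatT t" for t
    using z that typed_seq_app[OF z clean_typed[OF that]] by simp
  have wffh: "wff (hits f)" using f by simp
  have "\<Delta> \<tturnstile> subst (''m'', NatT) t (?le ?m \<^bold>\<or> hits f)"
  proof (rule entails_induct[OF _ t])
    show "wff (?le ?m \<^bold>\<or> hits f)" using z f by simp
    show "\<Delta> \<tturnstile> subst (''m'', NatT) Zero (?le ?m \<^bold>\<or> hits f)"
      using wffh by (simp only: sub clean_nat) (rule entails_OrI1, simp_all add: le nq_simps z0)
  next
    fix \<Theta> u assume \<Theta>: "\<Delta> \<subseteq> \<Theta>" and u: "clean NatT u" and "\<Theta> \<tturnstile> subst (''m'', NatT) u (?le ?m \<^bold>\<or> hits f)"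
    then have "\<Theta> \<tturnstile> ?le u \<^bold>\<or> hits f" by (simp only: sub)
    then have "\<Theta> \<tturnstile> ?le (Succ u) \<^bold>\<or> hits f"
    proof (rule entails_OrE)
      show "wff (?le u)" "wff (hits f)" using wff u wffh by blast+
      fix \<Xi> assume \<Xi>: "\<Theta> \<subseteq> \<Xi>"
      {
        assume "\<Xi> \<tturnstile> hits f"
        then show "\<Xi> \<tturnstile> ?le (Succ u) \<^bold>\<or> hits f" using wff[of "Succ u"] u by (simp add: entails_OrI2)
      next
        assume "\<Xi> \<tturnstile> ?le u"
        then have np: "nonneg \<Xi> (- seq_val z (nq u))" using u by (simp add: le)
        have "sentence (\<lambda>\<Gamma>. \<Gamma> \<tturnstile> ?le (Succ u) \<^bold>\<or> hits f)"
          using wff[of "Succ u"] u wffh by (intro sentence_entails) simp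
        then show "\<Xi> \<tturnstile> ?le (Succ u) \<^bold>\<or> hits f"
        proof (rule binary_cases[OF f entails_mono[OF bin], rotated, where k = "nq u"])
          show "\<Gamma> \<subseteq> \<Xi>" using \<Delta> \<Theta> \<Xi> by blast
        next
          fix \<Omega> assume "\<Xi> \<subseteq> \<Omega>" "eqN \<Omega> (fun_val f (nq u + 1)) 0"
          then have "nonneg \<Omega> (- seq_val z (nq u) + - weight f (nq u))"
            using np by (intro nonneg_add weight_miss) (auto intro: nonneg_mono)
          then have "\<Omega> \<tturnstile> ?le (Succ u)" using u by (simp add: le nq_simps zS)
          then show "\<Omega> \<tturnstile> ?le (Succ u) \<^bold>\<or> hits f" using wffh by (rule entails_OrI1)
        next
          fix \<Omega> assume "\<Xi> \<subseteq> \<Omega>" "eqN \<Omega> (fun_val f (nq u + 1)) 1"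
          then have "\<Omega> \<tturnstile> hits f" by (intro hitsI[OF f])
          then show "\<Omega> \<tturnstile> ?le (Succ u) \<^bold>\<or> hits f" using wff[of "Succ u"] u by (simp add: entails_OrI2)
        qed
      }
    qed
    then show "\<Theta> \<tturnstile> subst (''m'', NatT) (Succ u) (?le ?m \<^bold>\<or> hits f)" using u by (simp only: sub clean_nat)
  qed
  then have "\<Delta> \<tturnstile> ?le t \<^bold>\<or> hits f" using t by (simp only: sub)
  then show ?thesis
    by (rule entails_OrE) (use wff[OF t] wffh t nonpos hits in \<open>auto simp: le\<close>)
qed

end

text \<open>
  Index \<open>2n\<close> compensates for adding the errors of \<open>a\<close> and \<open>z\<close>.
\<close>

lemma sum_exists:
  assumes a: "clean RatSeqT a" and z: "clean RatSeqT z"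
  obtains x where "clean RatSeqT x" "\<And>n. seq_val x n = seq_val a (n + n) + seq_val z (n + n)"
proof -
  let ?t = "\<lambda>n. add_tm (a \<cdot> (n \<^bold>+ n)) (z \<cdot> (n \<^bold>+ n))"
  obtain x where x: "clean RatSeqT x"
    "\<And>s. clean NatT s \<Longrightarrow> seq_val x (nq s) = rat_val (rat_of (subst_tm (''n'', NatT) s (?t nvar)))"
    by (rule sequence_exists[of "?t nvar"]) (use a z in \<open>auto simp: clean_fv\<close>)
  have "seq_val x n = seq_val a (n + n) + seq_val z (n + n)" for n
  proof -
    obtain s where s: "clean NatT s" "n = nq s" by (rule natq_cases)
    then show ?thesis using x(2)[OF s(1)] a z seq_val_nq[OF a, of "s \<^bold>+ s"] seq_val_nq[OF z, of "s \<^bold>+ s"]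
      by (simp add: rat_val_add_tm nq_simps)
  qed
  with x(1) show ?thesis by (rule that)
qed

lemma sum_is_real:
  assumes a: "clean RatSeqT a" and z: "clean RatSeqT z" and ra: "\<Gamma> \<tturnstile> is_real a" and rz: "\<Gamma> \<tturnstile> is_real z"
    and x: "clean RatSeqT x" "\<And>n. seq_val x n = seq_val a (n + n) + seq_val z (n + n)"
  shows "\<Gamma> \<tturnstile> is_real x"
  unfolding is_real_iff[OF x(1)]
proof (intro allI impI conjI)
  fix m n assume m: "positive m" and n: "positive n"
  then have M: "positive (m + m)" and N: "positive (n + n)" by simp_all
  note A = is_realD[OF ra a M N] and Z = is_realD[OF rz z M N]
  show "nonneg \<Gamma> (recip m + recip n - (seq_val x m - seq_val x n))" "nonneg \<Gamma> (recip m + recip n + (seq_val x m - seq_val x n))"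
    using nonneg_add[OF A(1) Z(1)] nonneg_add[OF A(2) Z(2)]
    unfolding recip_double[OF m] recip_double[OF n] x(2) by (simp_all add: algebra_simps)
qed

context weighted_sum
begin

text \<open>
  A hit at \<open>j = k + 1\<close> would make all later partial sums at least \<open>1/(j (j + 1))\<close>, whereas \<open>a + z \<le> b = a\<close>
  makes them arbitrarily small.
\<close>

lemma le_imp_vanishes:
  assumes a: "clean RatSeqT a" and b: "clean RatSeqT b" and ra: "\<Gamma> \<tturnstile> is_real a" and ab: "\<Gamma> \<tturnstile> a =\<^sub>R b"
    and x: "clean RatSeqT x" "\<And>n. seq_val x n = seq_val a (n + n) + seq_val z (n + n)" and xb: "\<Gamma> \<tturnstile> x \<le>\<^sub>R b"
  shows "\<Gamma> \<tturnstile> vanishes f"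
proof (rule vanishesI[OF f])
  fix k
  show "eqN \<Gamma> (fun_val f (k + 1)) 0"
  proof (rule binary_cases[OF f bin sentence_eqN, of k])
    fix \<Delta> assume \<Delta>: "\<Gamma> \<subseteq> \<Delta>" and hit: "eqN \<Delta> (fun_val f (k + 1)) 1"
    define D where "D = (k + 1) * (k + 1 + 1)"
    define N where "N = D + D + D"
    define M where "M = N + N"
    define L where "L = M + M"
    \<comment> \<open>With \<open>L = 12D\<close> and \<open>e = 1/L\<close>, the terms of \<open>a\<close>, \<open>b\<close> and \<open>x \<le> b\<close> allow an error of \<open>11e\<close> for
      \<open>z\<^sub>L \<le> 0\<close>, whereas the hit contributes \<open>1/D = 12e\<close> to \<open>z\<^sub>L\<close>.\<close>
    define e where "e = recip L"
    have D: "positive D" by (simp add: D_def)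
    then have N: "positive N" and M: "positive M" and L: "positive L" by (simp_all add: N_def M_def L_def)
    \<comment> \<open>The summand is \<open>L - (k + 1)\<close>, using \<open>D = (k + 1) + (k + 1)(k + 1)\<close>.\<close>
    have "eqN \<Delta> (k + 1 + ((k + 1) * (k + 1) + D + D + (N + M))) L"
      by (simp add: L_def M_def N_def D_def algebra_simps)
    then have kL: "leN \<Delta> (k + 1) L" by (rule leN_I)
    have iD: "recip (k + 1) - recip (k + 1 + 1) = recip D" by (simp add: D_def recip_telescope)
    have xb': "nonneg \<Delta> (seq_val b M - seq_val x M + recip N)"
      using entails_mono[OF xb \<Delta>] N by (simp add: real_le_iff[OF x(1) b] M_def)
    have ab': "nonneg \<Delta> (recip M + recip M + (seq_val a M - seq_val b M))"
      using entails_mono[OF ab \<Delta>] M by (simp add: real_eq_iff[OF a b])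
    have "nonneg \<Delta> (weight f k - recip D)" using weight_hit[OF hit] by (simp only: iD)
    then have "nonneg \<Delta> ((seq_val b M - seq_val x M + recip N) + (recip M + recip M + (seq_val a M - seq_val b M))
        + (recip M + recip L - (seq_val a M - seq_val a L)) + (seq_val z L - seq_val z (k + 1)) + seq_val z k + (weight f k - recip D))"
      by (intro nonneg_add xb' ab' is_realD(1)[OF entails_mono[OF ra \<Delta>] a M L] sum_mono kL sum_nonneg)
    moreover have "seq_val z (k + 1) = seq_val z k + weight f k" by (rule zS)
    moreover have "recip M = e + e" unfolding e_def L_def by (rule recip_double[OF M])
    moreover have "recip N = recip M + recip M" unfolding M_def by (rule recip_double[OF N])
    moreover have "recip D = recip N + recip N + recip N" unfolding N_def by (rule recip_triple[OF D])
    moreover have "seq_val x M = seq_val a L + seq_val z L" by (simp add: x(2) L_def)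
    ultimately have "nonneg \<Delta> (- e)" by (simp add: algebra_simps flip: e_def)
    then have "\<Delta> \<tturnstile> Falsum" unfolding e_def by (rule recip_nonpos_absurd[OF L])
    then show "eqN \<Delta> (fun_val f (k + 1)) 0" using sentence_eqN by (rule sentence_absurd)
  qed
qed

text \<open>
  If \<open>a < a + z\<close> is witnessed at index \<open>2n\<close>, the partial sum \<open>z\<close> at index \<open>4n\<close> cannot be nonpositive, since
  the terms of \<open>a\<close> at these two indices differ by at most \<open>3/(4n)\<close>.
\<close>

lemma less_imp_hits:
  assumes a: "clean RatSeqT a" and ra: "\<Gamma> \<tturnstile> is_real a"
    and x: "clean RatSeqT x" "\<And>n. seq_val x n = seq_val a (n + n) + seq_val z (n + n)" and ax: "\<Gamma> \<tturnstile> a <\<^sub>R x"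
  shows "\<Gamma> \<tturnstile> hits f"
proof (rule real_lessE[OF ax a x(1)])
  fix \<Delta> n assume \<Delta>: "\<Gamma> \<subseteq> \<Delta>" and n: "positive n"
    and gap: "\<And>\<Theta>. \<Delta> \<subseteq> \<Theta> \<Longrightarrow> nonneg \<Theta> (recip n - (seq_val x (n + n) - seq_val a (n + n))) \<Longrightarrow> \<Theta> \<tturnstile> Falsum"
  define M where "M = n + n"
  define L where "L = M + M"
  have M: "positive M" and L: "positive L" using n by (simp_all add: M_def L_def)
  obtain t where t: "clean NatT t" "L = nq t" by (rule natq_cases)
  have wff: "wff (hits f)" using f by simp
  show "\<Delta> \<tturnstile> hits f"
  proof (rule sum_nonpos_or_hits[OF wff t(1) \<Delta>])
    fix \<Theta> assume \<Theta>: "\<Delta> \<subseteq> \<Theta>" and np: "nonneg \<Theta> (- seq_val z (nq t))"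
    have "\<Theta> \<tturnstile> is_real a" using ra \<Delta> \<Theta> by (blast intro: entails_mono)
    then have "nonneg \<Theta> ((recip M + recip L + (seq_val a M - seq_val a L)) + - seq_val z L + recip L)"
      using np[folded t(2)] by (intro nonneg_add is_realD a M L nonneg_recip)
    moreover have "recip M = recip L + recip L" unfolding L_def by (rule recip_double[OF M])
    moreover have "recip n = recip M + recip M" unfolding M_def by (rule recip_double[OF n])
    moreover have "seq_val x M = seq_val a L + seq_val z L" by (simp add: x(2) L_def)
    ultimately have "nonneg \<Theta> (recip n - (seq_val x M - seq_val a M))" by (simp add: algebra_simps)
    then have "\<Theta> \<tturnstile> Falsum" using \<Theta> by (intro gap) (simp_all add: M_def)
    then show "\<Theta> \<tturnstile> hits f" using wff by (rule entails_FalsumE)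
  qed
qed

end

section \<open>The theorem\<close>

definition split_line :: "tm \<Rightarrow> tm \<Rightarrow> fm" where
  "split_line a b = all_real ''x'' (\<lambda>x. x \<le>\<^sub>R b \<^bold>\<or> a <\<^sub>R x)"

lemma wff_is_real [simp]: "typed x RatSeqT \<Longrightarrow> wff (is_real x)"
  by (simp add: is_real_def)
lemma wff_real_rels [simp]:
  assumes "typed x RatSeqT" "typed y RatSeqT"
  shows "wff (x =\<^sub>R y)" "wff (x <\<^sub>R y)" "wff (x \<le>\<^sub>R y)"
  using assms by (simp_all add: real_eq_def real_less_def real_le_def)

lemma wff_split_line [simp]: "typed a RatSeqT \<Longrightarrow> typed b RatSeqT \<Longrightarrow> wff (split_line a b)"
  by (simp add: split_line_def all_real_def wff_all)

lemma wff_LPO [simp]: "wff LPO"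
  by (auto simp: LPO_def Let_def intro!: wff_all)

lemma subst_real [simp]:
  assumes "fst v \<noteq> ''m''" "fst v \<noteq> ''n''" "clean \<tau> t"
  shows "subst v t (is_real x) = is_real (subst_tm v t x)"
    "subst v t (x =\<^sub>R y) = (subst_tm v t x =\<^sub>R subst_tm v t y)"
    "subst v t (x <\<^sub>R y) = (subst_tm v t x <\<^sub>R subst_tm v t y)"
    "subst v t (x \<le>\<^sub>R y) = (subst_tm v t x \<le>\<^sub>R subst_tm v t y)"
  using assms
  by (cases v; auto simp: is_real_def real_eq_def real_less_def real_le_def all_pos_def ex_pos_def subst_all subst_ex)+

lemma subst_split_line [simp]:
  assumes "fst v \<noteq> ''m''" "fst v \<noteq> ''n''" "fst v \<noteq> ''x''" "clean \<tau> t"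
  shows "subst v t (split_line a b) = split_line (subst_tm v t a) (subst_tm v t b)"
  using assms by (cases v) (auto simp: split_line_def all_real_def subst_all)

lemma subst_LPO [simp]:
  assumes "fst v \<noteq> ''n''" "fst v \<noteq> ''alpha''" "clean \<tau> t"
  shows "subst v t LPO = LPO"
  using assms by (cases v) (auto simp: LPO_def Let_def all_pos_def ex_pos_def subst_all subst_ex)

lemma split_lineD:
  assumes "\<Gamma> \<tturnstile> split_line a b" and a: "clean RatSeqT a" and b: "clean RatSeqT b"
    and x: "clean RatSeqT x" "\<Gamma> \<tturnstile> is_real x"
  shows "\<Gamma> \<tturnstile> x \<le>\<^sub>R b \<^bold>\<or> a <\<^sub>R x"
proof -
  let ?x = "Var (''x'', RatSeqT)"
  have "\<Gamma> \<tturnstile> subst (''x'', RatSeqT) x (is_real ?x \<^bold>\<longrightarrow> ?x \<le>\<^sub>R b \<^bold>\<or> a <\<^sub>R ?x)"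
    using assms(1)[unfolded split_line_def all_real_def] by (rule entails_allE) (use a b x in simp_all)
  then have "\<Gamma> \<tturnstile> is_real x \<^bold>\<longrightarrow> x \<le>\<^sub>R b \<^bold>\<or> a <\<^sub>R x" using a b x(1) by simp
  then show ?thesis using x(2) by (rule entails_ImpE)
qed

lemma split_line_less_or_eq:
  assumes a: "clean RatSeqT a" and b: "clean RatSeqT b" and ra: "\<Gamma> \<tturnstile> is_real a" and rb: "\<Gamma> \<tturnstile> is_real b"
    and H: "\<Gamma> \<tturnstile> split_line a b"
  shows "\<Gamma> \<tturnstile> a <\<^sub>R b \<^bold>\<or> a =\<^sub>R b"
proof -
  have ab: "\<Gamma> \<tturnstile> a \<le>\<^sub>R b"
  proof (rule entails_OrE[OF split_lineD[OF H a b a ra]])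
    fix \<Delta> assume "\<Delta> \<tturnstile> a <\<^sub>R a"
    from real_less_irrefl[OF this a] show "\<Delta> \<tturnstile> a \<le>\<^sub>R b" using a b by (simp add: entails_FalsumE)
  qed (use a b in simp_all)
  obtain x where x: "clean RatSeqT x" "\<And>n. seq_val x n = seq_val b (quint n) + seq_val b (quint n) - seq_val a (quint n)"
    using reflection_exists[OF a b] by blast
  have rx: "\<Gamma> \<tturnstile> is_real x" by (rule reflection_real[OF a b ra rb x])
  show ?thesis
  proof (rule entails_OrE[OF split_lineD[OF H a b x(1) rx]])
    fix \<Delta> assume \<Delta>: "\<Gamma> \<subseteq> \<Delta>" and "\<Delta> \<tturnstile> x \<le>\<^sub>R b"
    with reflection_le_imp_eq[OF a b entails_mono[OF ra \<Delta>] entails_mono[OF rb \<Delta>] x entails_mono[OF ab \<Delta>]]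
    show "\<Delta> \<tturnstile> a <\<^sub>R b \<^bold>\<or> a =\<^sub>R b" using a b by (simp add: entails_OrI2)
  next
    fix \<Delta> assume \<Delta>: "\<Gamma> \<subseteq> \<Delta>" and "\<Delta> \<tturnstile> a <\<^sub>R x"
    with less_reflection_imp_less[OF a b entails_mono[OF ra \<Delta>] x]
    show "\<Delta> \<tturnstile> a <\<^sub>R b \<^bold>\<or> a =\<^sub>R b" using a b by (simp add: entails_OrI1)
  qed (use a b x in simp_all)
qed

lemma split_line_eq_imp_LPO:
  assumes a: "clean RatSeqT a" and b: "clean RatSeqT b" and ra: "\<Gamma> \<tturnstile> is_real a"
    and H: "\<Gamma> \<tturnstile> split_line a b" and eq: "\<Gamma> \<tturnstile> a =\<^sub>R b"
  shows "\<Gamma> \<tturnstile> LPO"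
proof -
  let ?v = "(''alpha'', NatT \<rightarrow> NatT)"
  have LPO: "LPO = all ?v (binary (Var ?v) \<^bold>\<longrightarrow> vanishes (Var ?v) \<^bold>\<or> hits (Var ?v))"
    by (simp add: LPO_def binary_def vanishes_def hits_def Let_def)
  show ?thesis unfolding LPO
  proof (rule entails_allI)
    fix f assume f: "clean (NatT \<rightarrow> NatT) f"
    have "\<Gamma> \<tturnstile> binary f \<^bold>\<longrightarrow> vanishes f \<^bold>\<or> hits f"
    proof (rule entails_ImpI)
      fix \<Delta> assume \<Delta>: "\<Gamma> \<subseteq> \<Delta>" and bin: "\<Delta> \<tturnstile> binary f"
      obtain z where z: "clean RatSeqT z" "seq_val z 0 = 0" "\<And>k. seq_val z (k + 1) = seq_val z k + weight f k"
        using weighted_sums_exist[OF f] by blast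
      have ws: "weighted_sum f z \<Theta>" if "\<Delta> \<subseteq> \<Theta>" for \<Theta>
        by (rule weighted_sum.intro) (use f z entails_mono[OF bin that] in simp_all)
      obtain x where x: "clean RatSeqT x" "\<And>n. seq_val x n = seq_val a (n + n) + seq_val z (n + n)"
        using sum_exists[OF a z(1)] by blast
      have rx: "\<Delta> \<tturnstile> is_real x"
        by (rule sum_is_real[OF a z(1) entails_mono[OF ra \<Delta>] weighted_sum.sum_real[OF ws] x]) simp
      show "\<Delta> \<tturnstile> vanishes f \<^bold>\<or> hits f"
      proof (rule entails_OrE[OF split_lineD[OF entails_mono[OF H \<Delta>] a b x(1) rx]])
        fix \<Theta> assume \<Theta>: "\<Delta> \<subseteq> \<Theta>" and "\<Theta> \<tturnstile> x \<le>\<^sub>R b"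
        moreover have "\<Gamma> \<subseteq> \<Theta>" using \<Delta> \<Theta> by blast
        ultimately have "\<Theta> \<tturnstile> vanishes f"
          by (intro weighted_sum.le_imp_vanishes[OF ws a b _ _ x] entails_mono[OF ra] entails_mono[OF eq])
        then show "\<Theta> \<tturnstile> vanishes f \<^bold>\<or> hits f" using f by (simp add: entails_OrI1)
      next
        fix \<Theta> assume \<Theta>: "\<Delta> \<subseteq> \<Theta>" and "\<Theta> \<tturnstile> a <\<^sub>R x"
        moreover have "\<Gamma> \<subseteq> \<Theta>" using \<Delta> \<Theta> by blast
        ultimately have "\<Theta> \<tturnstile> hits f"
          by (intro weighted_sum.less_imp_hits[OF ws a _ x] entails_mono[OF ra])
        then show "\<Theta> \<tturnstile> vanishes f \<^bold>\<or> hits f" using f by (simp add: entails_OrI2)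
      qed (use a b x in simp_all)
    qed (use f in simp)
    then show "\<Gamma> \<tturnstile> subst ?v f (binary (Var ?v) \<^bold>\<longrightarrow> vanishes (Var ?v) \<^bold>\<or> hits (Var ?v))"
      using f by (simp add: binary_def vanishes_def hits_def all_pos_def ex_pos_def subst_all subst_ex)
  qed
qed

theorem proposition6p1:
  shows "{} \<turnstile>
    all_real ''a'' (\<lambda>a. all_real ''b'' (\<lambda>b.
      all_real ''x'' (\<lambda>x. x \<le>\<^sub>R b \<^bold>\<or> a <\<^sub>R x) \<^bold>\<longrightarrow>
      (a <\<^sub>R b \<^bold>\<or> a =\<^sub>R b) \<^bold>\<and> (a =\<^sub>R b \<^bold>\<longrightarrow> LPO)))"
proof -
  let ?F = "\<lambda>a b. split_line a b \<^bold>\<longrightarrow> (a <\<^sub>R b \<^bold>\<or> a =\<^sub>R b) \<^bold>\<and> (a =\<^sub>R b \<^bold>\<longrightarrow> LPO)"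
  let ?a = "(''a'', RatSeqT)" and ?b = "(''b'', RatSeqT)"
  have main: "\<Gamma> \<tturnstile> ?F a b"
    if a: "clean RatSeqT a" and b: "clean RatSeqT b" and ra: "\<Gamma> \<tturnstile> is_real a" and rb: "\<Gamma> \<tturnstile> is_real b" for \<Gamma> a b
  proof (rule entails_ImpI)
    fix \<Delta> assume \<Delta>: "\<Gamma> \<subseteq> \<Delta>" and H: "\<Delta> \<tturnstile> split_line a b"
    have ra': "\<Delta> \<tturnstile> is_real a" and rb': "\<Delta> \<tturnstile> is_real b" using ra rb \<Delta> by (auto intro: entails_mono)
    have "\<Delta> \<tturnstile> a =\<^sub>R b \<^bold>\<longrightarrow> LPO"
    proof (rule entails_ImpI)
      fix \<Theta> assume "\<Delta> \<subseteq> \<Theta>" "\<Theta> \<tturnstile> a =\<^sub>R b"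
      then show "\<Theta> \<tturnstile> LPO"
        using split_line_eq_imp_LPO[OF a b] ra' H by (blast intro: entails_mono)
    qed (use a b in simp)
    then show "\<Delta> \<tturnstile> (a <\<^sub>R b \<^bold>\<or> a =\<^sub>R b) \<^bold>\<and> (a =\<^sub>R b \<^bold>\<longrightarrow> LPO)"
      by (intro entails_AndI split_line_less_or_eq[OF a b ra' rb' H])
  qed (use a b in simp)
  have inner: "\<Gamma> \<tturnstile> all ?b (is_real (Var ?b) \<^bold>\<longrightarrow> ?F a (Var ?b))"
    if a: "clean RatSeqT a" and ra: "\<Gamma> \<tturnstile> is_real a" for \<Gamma> a
  proof (rule entails_allI)
    fix b assume b: "clean RatSeqT b"
    have "\<Gamma> \<tturnstile> is_real b \<^bold>\<longrightarrow> ?F a b"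
      by (rule entails_ImpI[OF main[OF a b entails_mono[OF ra]]]) (use b in auto)
    then show "\<Gamma> \<tturnstile> subst ?b b (is_real (Var ?b) \<^bold>\<longrightarrow> ?F a (Var ?b))" using a b by simp
  qed
  have "{} \<tturnstile> all ?a (is_real (Var ?a) \<^bold>\<longrightarrow> all ?b (is_real (Var ?b) \<^bold>\<longrightarrow> ?F (Var ?a) (Var ?b)))"
  proof (rule entails_allI)
    fix a assume a: "clean RatSeqT a"
    have "{} \<tturnstile> is_real a \<^bold>\<longrightarrow> all ?b (is_real (Var ?b) \<^bold>\<longrightarrow> ?F a (Var ?b))"
      by (rule entails_ImpI[OF inner[OF a]]) (use a in auto)
    then show "{} \<tturnstile> subst ?a a (is_real (Var ?a) \<^bold>\<longrightarrow> all ?b (is_real (Var ?b) \<^bold>\<longrightarrow> ?F (Var ?a) (Var ?b)))"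
      using a by (simp add: subst_all)
  qed
  then have "{} \<turnstile> all ?a (is_real (Var ?a) \<^bold>\<longrightarrow> all ?b (is_real (Var ?b) \<^bold>\<longrightarrow> ?F (Var ?a) (Var ?b)))"
    by (rule entails_derivable) simp
  then show ?thesis by (simp only: all_real_def split_line_def)
qed

end
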